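(* Let $\mathfrak g$ be a simple Lie algebra not of type $C_n$, and let $f\in\mathfrak g$ be a minimal nilpotent element, included in an $\mathfrak{sl}_2$-triple $\{f,2x,e\}$. Then the set of embeddable elements $s\in\mathfrak g_{\frac12}$ is a non-empty Zariski open subset of $\mathfrak g_{\frac12}$. Moreover, any two embeddable elements of $\mathfrak g_{\frac12}$ can be obtained from one another by the adjoint action of $G_0^f$, up to a non-zero constant factor.
   Context: The base field $\mathbb F$ is algebraically closed of characteristic $0$; $\mathfrak g$ is finite-dimensional. The triple satisfies $[e,f]=2x$, $[x,e]=e$, $[x,f]=-f$; $\mathfrak g_i$ is the $\mathrm{ad}\,x$-eigenspace of eigenvalue $i\in\frac12\mathbb Z$. $f$ is minimal if it is a lowest root vector, equivalently $\mathfrak g=\mathbb Ff\oplus\mathfrak g_{-1/2}\oplus\mathfrak g_0\oplus\mathfrak g_{1/2}\oplus\mathbb Fe$. An element $s\in\mathfrak g_{\frac12}$ is called embeddable if there exists $s^*\in\mathfrak g_{-\frac12}$ such that $[s,s^*]=2x$. $\mathfrak g_0^f$ is the centralizer of $f$ in $\mathfrak g_0$ and $G_0^f$ is the corresponding connected algebraic subgroup of the adjoint group $G$ of $\mathfrak g$. "Type $C_n$" means $\mathfrak{sp}_{2n}$, $n\ge1$; in particular it includes $\mathfrak{sl}_2=C_1$ and $B_2=C_2$. *)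

theory Defs
  imports
    "HOL-Analysis.Abstract_Topology_2"
    "HOL-Computational_Algebra.Polynomial"
    "Jordan_Normal_Form.Matrix"
begin

section \<open>Lie algebras\<close>

locale lie_algebra = vector_space sc
  for sc :: "'k::field \<Rightarrow> 'g::ab_group_add \<Rightarrow> 'g" +
  fixes br :: "'g \<Rightarrow> 'g \<Rightarrow> 'g"
  assumes br_add_left: "br (a + b) c = br a c + br b c"
    and br_add_right: "br a (b + c) = br a b + br a c"
    and br_scale_left: "br (sc r a) b = sc r (br a b)"
    and br_scale_right: "br a (sc r b) = sc r (br a b)"
    and br_self: "br a a = 0"
    and jacobi: "br a (br b c) + br b (br c a) + br c (br a b) = 0"

definition lie_ideal ::
    "('k::field \<Rightarrow> 'g::ab_group_add \<Rightarrow> 'g) \<Rightarrow> ('g \<Rightarrow> 'g \<Rightarrow> 'g) \<Rightarrow> 'g set \<Rightarrow> bool" where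
  "lie_ideal sc br I \<longleftrightarrow> module.subspace sc I \<and> (\<forall>a. \<forall>b\<in>I. br a b \<in> I)"

locale simple_lie_algebra = lie_algebra +
  assumes nonabelian: "\<exists>a b. br a b \<noteq> 0"
    and simple: "lie_ideal sc br I \<Longrightarrow> I = {0} \<or> I = UNIV"

definition sp_form :: "nat \<Rightarrow> 'k::comm_ring_1 mat" where
  "sp_form n = four_block_mat (0\<^sub>m n n) (1\<^sub>m n) (- (1\<^sub>m n)) (0\<^sub>m n n)"

definition sp_mat :: "nat \<Rightarrow> 'k::comm_ring_1 mat set" where
  "sp_mat n = {A \<in> carrier_mat (2 * n) (2 * n).
      transpose_mat A * sp_form n + sp_form n * A = 0\<^sub>m (2 * n) (2 * n)}"

definition type_C ::
    "('k::field \<Rightarrow> 'g::ab_group_add \<Rightarrow> 'g) \<Rightarrow> ('g \<Rightarrow> 'g \<Rightarrow> 'g) \<Rightarrow> nat \<Rightarrow> bool" where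
  "type_C sc br n \<longleftrightarrow> (\<exists>\<phi> :: 'g \<Rightarrow> 'k mat. bij_betw \<phi> UNIV (sp_mat n) \<and>
      (\<forall>a b. \<phi> (a + b) = \<phi> a + \<phi> b) \<and>
      (\<forall>c a. \<phi> (sc c a) = c \<cdot>\<^sub>m \<phi> a) \<and>
      (\<forall>a b. \<phi> (br a b) = \<phi> a * \<phi> b - \<phi> b * \<phi> a))"


section \<open>Minimal nilpotent elements\<close>

definition eigenspace ::
    "('k::field \<Rightarrow> 'g::ab_group_add \<Rightarrow> 'g) \<Rightarrow> ('g \<Rightarrow> 'g) \<Rightarrow> 'k \<Rightarrow> 'g set" where
  "eigenspace sc A c = {v. A v = sc c v}"

text \<open>For (semi)simple Lie algebras over an algebraically closed field of characteristic 0: a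
  Cartan subalgebra is a self-centralizing commutative subalgebra that acts diagonalizably in the
  adjoint representation.\<close>

definition cartan_subalgebra ::
    "('k::field \<Rightarrow> 'g::ab_group_add \<Rightarrow> 'g) \<Rightarrow> ('g \<Rightarrow> 'g \<Rightarrow> 'g) \<Rightarrow> 'g set \<Rightarrow> bool" where
  "cartan_subalgebra sc br h \<longleftrightarrow> module.subspace sc h \<and>
      (\<forall>s\<in>h. \<forall>t\<in>h. br s t = 0) \<and>
      (\<forall>y. (\<forall>t\<in>h. br t y = 0) \<longrightarrow> y \<in> h) \<and>
      (\<forall>t\<in>h. module.span sc (\<Union>c. eigenspace sc (br t) c) = UNIV)"

definition root_space ::
    "('k::field \<Rightarrow> 'g::ab_group_add \<Rightarrow> 'g) \<Rightarrow> ('g \<Rightarrow> 'g \<Rightarrow> 'g) \<Rightarrow> 'g set \<Rightarrow> ('g \<Rightarrow> 'k) \<Rightarrow> 'g set" where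
  "root_space sc br h \<alpha> = {v. \<forall>t\<in>h. br t v = sc (\<alpha> t) v}"

text \<open>A root is a functional on \<open>h\<close>; it is represented by its extension by zero outside \<open>h\<close>, so
  that equal functionals are equal functions. Its linearity on \<open>h\<close> is automatic.\<close>

definition roots ::
    "('k::field \<Rightarrow> 'g::ab_group_add \<Rightarrow> 'g) \<Rightarrow> ('g \<Rightarrow> 'g \<Rightarrow> 'g) \<Rightarrow> 'g set \<Rightarrow> ('g \<Rightarrow> 'k) set" where
  "roots sc br h = {\<alpha>. (\<forall>t. t \<notin> h \<longrightarrow> \<alpha> t = 0) \<and> (\<exists>t\<in>h. \<alpha> t \<noteq> 0) \<and>
      (\<exists>v\<in>root_space sc br h \<alpha>. v \<noteq> 0)}"

definition positive_system :: "('g \<Rightarrow> 'k::field) set \<Rightarrow> ('g \<Rightarrow> 'k) set \<Rightarrow> bool" where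
  "positive_system R P \<longleftrightarrow> P \<subseteq> R \<and>
      (\<forall>\<alpha>\<in>R. (\<alpha> \<in> P) \<noteq> ((\<lambda>t. - \<alpha> t) \<in> P)) \<and>
      (\<forall>\<alpha>\<in>P. \<forall>\<beta>\<in>P. (\<lambda>t. \<alpha> t + \<beta> t) \<in> R \<longrightarrow> (\<lambda>t. \<alpha> t + \<beta> t) \<in> P)"

text \<open>The zero functional has to be excluded explicitly, as otherwise the positive root of a
  root system of rank one would qualify.\<close>

definition lowest_root :: "('g \<Rightarrow> 'k::field) set \<Rightarrow> ('g \<Rightarrow> 'k) set \<Rightarrow> ('g \<Rightarrow> 'k) \<Rightarrow> bool" where
  "lowest_root R P \<alpha> \<longleftrightarrow> \<alpha> \<in> R \<and>
      (\<forall>\<beta>\<in>P. (\<lambda>t. \<alpha> t - \<beta> t) \<notin> R \<union> {\<lambda>t. 0})"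

definition minimal_nilpotent ::
    "('k::field \<Rightarrow> 'g::ab_group_add \<Rightarrow> 'g) \<Rightarrow> ('g \<Rightarrow> 'g \<Rightarrow> 'g) \<Rightarrow> 'g \<Rightarrow> bool" where
  "minimal_nilpotent sc br f \<longleftrightarrow> (\<exists>h P \<alpha>. cartan_subalgebra sc br h \<and>
      positive_system (roots sc br h) P \<and> lowest_root (roots sc br h) P \<alpha> \<and>
      f \<in> root_space sc br h \<alpha> \<and> f \<noteq> 0)"

text \<open>The normalization of the triple \<open>{f, 2x, e}\<close> is the one for which \<open>e\<close> and \<open>f\<close> are
  eigenvectors of \<open>ad x\<close> with eigenvalues \<open>1\<close> and \<open>-1\<close>.\<close>

definition sl2_triple ::
    "('k::field \<Rightarrow> 'g::ab_group_add \<Rightarrow> 'g) \<Rightarrow> ('g \<Rightarrow> 'g \<Rightarrow> 'g) \<Rightarrow> 'g \<Rightarrow> 'g \<Rightarrow> 'g \<Rightarrow> bool" where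
  "sl2_triple sc br e x f \<longleftrightarrow> br e f = sc 2 x \<and> br x e = e \<and> br x f = - f"

definition grade ::
    "('k::field \<Rightarrow> 'g::ab_group_add \<Rightarrow> 'g) \<Rightarrow> ('g \<Rightarrow> 'g \<Rightarrow> 'g) \<Rightarrow> 'g \<Rightarrow> 'k \<Rightarrow> 'g set" where
  "grade sc br x i = eigenspace sc (br x) i"

definition embeddable ::
    "('k::field \<Rightarrow> 'g::ab_group_add \<Rightarrow> 'g) \<Rightarrow> ('g \<Rightarrow> 'g \<Rightarrow> 'g) \<Rightarrow> 'g \<Rightarrow> 'g set" where
  "embeddable sc br x =
      {s \<in> grade sc br x (1/2). \<exists>s'\<in>grade sc br x (-1/2). br s s' = sc 2 x}"

definition grade0_centralizer ::
    "('k::field \<Rightarrow> 'g::ab_group_add \<Rightarrow> 'g) \<Rightarrow> ('g \<Rightarrow> 'g \<Rightarrow> 'g) \<Rightarrow> 'g \<Rightarrow> 'g \<Rightarrow> 'g set" where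
  "grade0_centralizer sc br x f = {y \<in> grade sc br x 0. br f y = 0}"


section \<open>Zariski topology\<close>

text \<open>The algebra of functions generated by a set \<open>\<Phi>\<close> of coordinate functions.\<close>

inductive_set polyfuns :: "('v \<Rightarrow> 'k::field) set \<Rightarrow> ('v \<Rightarrow> 'k) set"
  for \<Phi> :: "('v \<Rightarrow> 'k) set" where
  coord: "\<phi> \<in> \<Phi> \<Longrightarrow> \<phi> \<in> polyfuns \<Phi>"
| const: "(\<lambda>_. c) \<in> polyfuns \<Phi>"
| add: "p \<in> polyfuns \<Phi> \<Longrightarrow> q \<in> polyfuns \<Phi> \<Longrightarrow> (\<lambda>v. p v + q v) \<in> polyfuns \<Phi>"
| mult: "p \<in> polyfuns \<Phi> \<Longrightarrow> q \<in> polyfuns \<Phi> \<Longrightarrow> (\<lambda>v. p v * q v) \<in> polyfuns \<Phi>"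

definition zariski_open :: "('v \<Rightarrow> 'k::field) set \<Rightarrow> 'v set \<Rightarrow> 'v set \<Rightarrow> bool" where
  "zariski_open \<Phi> X U \<longleftrightarrow> (\<exists>S\<subseteq>polyfuns \<Phi>. U = X - {v. \<forall>p\<in>S. p v = 0})"

definition zariski :: "('v \<Rightarrow> 'k::field) set \<Rightarrow> 'v set \<Rightarrow> 'v topology" where
  "zariski \<Phi> X = topology (zariski_open \<Phi> X)"

lemma istopology_zariski_open: "istopology (zariski_open \<Phi> X)"
  unfolding istopology_def
proof (intro conjI allI impI)
  fix U V assume "zariski_open \<Phi> X U" "zariski_open \<Phi> X V"
  then obtain S T where S: "S \<subseteq> polyfuns \<Phi>" "U = X - {v. \<forall>p\<in>S. p v = 0}"
    and T: "T \<subseteq> polyfuns \<Phi>" "V = X - {v. \<forall>p\<in>T. p v = 0}"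
    unfolding zariski_open_def by blast
  let ?W = "(\<lambda>(p, q) v. p v * q v) ` (S \<times> T)"
  have "?W \<subseteq> polyfuns \<Phi>" using S(1) T(1) by (auto intro!: polyfuns.mult)
  moreover have "U \<inter> V = X - {v. \<forall>p\<in>?W. p v = 0}" unfolding S(2) T(2) by auto
  ultimately show "zariski_open \<Phi> X (U \<inter> V)" unfolding zariski_open_def by blast
next
  fix K assume K: "\<forall>U\<in>K. zariski_open \<Phi> X U"
  let ?S = "\<Union>{S. S \<subseteq> polyfuns \<Phi> \<and> X - {v. \<forall>p\<in>S. p v = 0} \<in> K}"
  have "\<Union>K = X - {v. \<forall>p\<in>?S. p v = 0}" (is "_ = ?R")
  proof
    show "\<Union>K \<subseteq> ?R"
    proof
      fix v assume "v \<in> \<Union>K"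
      then obtain U where U: "U \<in> K" "v \<in> U" by blast
      with K obtain S where "S \<subseteq> polyfuns \<Phi>" "U = X - {v. \<forall>p\<in>S. p v = 0}"
        unfolding zariski_open_def by blast
      with U show "v \<in> ?R" by blast
    qed
    show "?R \<subseteq> \<Union>K" by blast
  qed
  moreover have "?S \<subseteq> polyfuns \<Phi>" by blast
  ultimately show "zariski_open \<Phi> X (\<Union>K)" unfolding zariski_open_def by blast
qed

lemma openin_zariski: "openin (zariski \<Phi> X) U \<longleftrightarrow> zariski_open \<Phi> X U"
  by (simp add: zariski_def istopology_zariski_open)

lemma topspace_zariski: "topspace (zariski \<Phi> X) = X"
proof -
  have "zariski_open \<Phi> X X"
    unfolding zariski_open_def
    by (rule exI[of _ "{\<lambda>_. 1}"]) (auto intro: polyfuns.const)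
  moreover have "U \<subseteq> X" if "zariski_open \<Phi> X U" for U
    using that by (auto simp: zariski_open_def)
  ultimately show ?thesis
    unfolding topspace_def openin_zariski by blast
qed

definition linear_functionals ::
    "('k::field \<Rightarrow> 'g::ab_group_add \<Rightarrow> 'g) \<Rightarrow> ('g \<Rightarrow> 'k) set" where
  "linear_functionals sc = {\<phi>. Vector_Spaces.linear sc (*) \<phi>}"

definition endos :: "('k::field \<Rightarrow> 'g::ab_group_add \<Rightarrow> 'g) \<Rightarrow> ('g \<Rightarrow> 'g) set" where
  "endos sc = {A. Vector_Spaces.linear sc sc A}"

text \<open>Coordinate functions on the space of endomorphisms: the matrix coefficients.\<close>

definition matrix_coeffs ::
    "('k::field \<Rightarrow> 'g::ab_group_add \<Rightarrow> 'g) \<Rightarrow> (('g \<Rightarrow> 'g) \<Rightarrow> 'k) set" where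
  "matrix_coeffs sc = {(\<lambda>A. \<phi> (A v)) | \<phi> v. \<phi> \<in> linear_functionals sc}"


section \<open>Algebraic groups\<close>

definition lie_automorphisms ::
    "('k::field \<Rightarrow> 'g::ab_group_add \<Rightarrow> 'g) \<Rightarrow> ('g \<Rightarrow> 'g \<Rightarrow> 'g) \<Rightarrow> ('g \<Rightarrow> 'g) set" where
  "lie_automorphisms sc br = {A \<in> endos sc. bij A \<and> (\<forall>a b. A (br a b) = br (A a) (A b))}"

text \<open>The adjoint group of a semisimple Lie algebra: the identity component of its automorphism
  group.\<close>

definition adjoint_group ::
    "('k::field \<Rightarrow> 'g::ab_group_add \<Rightarrow> 'g) \<Rightarrow> ('g \<Rightarrow> 'g \<Rightarrow> 'g) \<Rightarrow> ('g \<Rightarrow> 'g) set" where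
  "adjoint_group sc br =
      connected_component_of_set (zariski (matrix_coeffs sc) (lie_automorphisms sc br)) id"

definition algebraic_subgroup ::
    "('k::field \<Rightarrow> 'g::ab_group_add \<Rightarrow> 'g) \<Rightarrow> ('g \<Rightarrow> 'g) set \<Rightarrow> ('g \<Rightarrow> 'g) set \<Rightarrow> bool" where
  "algebraic_subgroup sc G H \<longleftrightarrow> closedin (zariski (matrix_coeffs sc) G) H \<and>
      id \<in> H \<and> (\<forall>A\<in>H. \<forall>B\<in>H. A \<circ> B \<in> H) \<and> (\<forall>A\<in>H. inv_into UNIV A \<in> H)"

text \<open>The Lie algebra of a subgroup \<open>H\<close> of \<open>GL(\<gg>)\<close>, as the tangent space at the identity: those
  endomorphisms \<open>D\<close> along which the derivative at \<open>id\<close> of every polynomial function vanishing on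
  \<open>H\<close> is zero. The derivative is the coefficient of \<open>t\<close> in the polynomial \<open>P (id + t D)\<close>.\<close>

definition lie_of_group ::
    "('k::field \<Rightarrow> 'g::ab_group_add \<Rightarrow> 'g) \<Rightarrow> ('g \<Rightarrow> 'g) set \<Rightarrow> ('g \<Rightarrow> 'g) set" where
  "lie_of_group sc H = {D \<in> endos sc.
      \<forall>P\<in>polyfuns (matrix_coeffs sc). (\<forall>A\<in>H. P A = 0) \<longrightarrow>
        (\<exists>q :: 'k poly. (\<forall>t. poly q t = P (\<lambda>v. v + sc t (D v))) \<and> coeff q 1 = 0)}"

text \<open>\<open>H\<close> is the connected algebraic subgroup of the adjoint group corresponding to the
  subalgebra \<open>L\<close>. In characteristic 0 there is at most one such \<open>H\<close>.\<close>

definition connected_subgroup_of ::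
    "('k::field \<Rightarrow> 'g::ab_group_add \<Rightarrow> 'g) \<Rightarrow> ('g \<Rightarrow> 'g \<Rightarrow> 'g) \<Rightarrow> 'g set \<Rightarrow> ('g \<Rightarrow> 'g) set \<Rightarrow> bool" where
  "connected_subgroup_of sc br L H \<longleftrightarrow> algebraic_subgroup sc (adjoint_group sc br) H \<and>
      connectedin (zariski (matrix_coeffs sc) (adjoint_group sc br)) H \<and>
      lie_of_group sc H = br ` L"

end

theory Submission
  imports Defs "HOL-Computational_Algebra.Polynomial_FPS"
begin

text \<open>
  Every \<open>s\<close> in \<open>g_1/2\<close> has a quartic invariant \<open>q\<close>, given by \<open>(ad s)^4 f = q e\<close>. If \<open>q\<close> is non-zero,
  then \<open>s\<close> is embeddable with the explicit partner \<open>- (2/q) [f, (ad s)^3 f]\<close>; conversely, if \<open>s\<close> is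
  embeddable, then \<open>f\<close> is a lowest weight vector of weight -4 for the resulting \<open>sl_2\<close>, so
  \<open>q\<close> is non-zero. This gives openness. If \<open>q\<close> vanishes identically, polarization and the Jacobi
  identity force the moment map of \<open>g_1/2\<close> to consist of symplectic transvections, and \<open>g\<close> acts
  faithfully on \<open>F + g_1/2 + F\<close> as the full symplectic Lie algebra.

  For transitivity, \<open>sl_2\<close> theory shows that \<open>[g_0^f, s] + F s = g_1/2\<close> for embeddable \<open>s\<close>. Hence a
  line through \<open>s\<close> is, up to a scalar power series, of the form \<open>A(t) s\<close> for a formal solution of
  \<open>A' = ad(y(t)) A\<close> with \<open>y(t)\<close> in \<open>g_0^f[[t]]\<close>. All polynomials vanishing on the group vanish on
  \<open>A(t)\<close>, and since the entries of \<open>A(t)\<close> generate a finitely generated ring over \<open>F[t]\<close>, specialization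
  at all but finitely many \<open>t\<close> puts a point of the line into the orbit of \<open>s\<close>. Running this from both
  ends of the line through two embeddable elements connects their orbits.

  The grading rests on \<open>(ad f)^2 g = F f\<close>, which needs the symmetry of the root system and hence a
  nondegenerate Killing form. Cartan's criterion is avoided: by simplicity it suffices that the form is
  non-zero, and it is positive at a semisimple \<open>x\<close>, whose eigenvalues are half-integers.
\<close>

section \<open>Weights and traces\<close>

text \<open>The field is only assumed algebraically closed of characteristic 0, so no convergent
  exponential is at hand to move along an orbit. A formal power series solution takes its place. The
  tangent condition is known at the starting point \<open>s\<close> only, and this is enough: along
  the line \<open>s + t w\<close> the equation is solved recursively in powers of \<open>t\<close>,
  and each step again expands a vector at \<open>s\<close>. A specialized solution is at first only
  an endomorphism satisfying all polynomial equations of the group. Invertibility is not such an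
  equation; it comes from simplicity of \<open>g\<close>, since the kernel is an ideal.

  The five eigenvalues of \<open>ad x\<close> come from polynomial identities with simple roots:
  \<open>[f,[f,e]] = -2f\<close> makes \<open>e\<close> the only direction outside the kernel of
  \<open>(ad f)^2\<close>, and \<open>ad x (ad x + 1/2)\<close> maps the kernel of
  \<open>ad f\<close> into \<open>F f\<close>.

  For vanishing quartic an explicit isomorphism is built, because type C means an isomorphism onto
  matrices. In \<open>W = F + V + F\<close> the outer summands form a hyperbolic plane and
  \<open>V\<close> is the natural module of the smaller symplectic algebra. \<open>V\<close> may be
  zero, which is the case of \<open>sl_2\<close>.\<close>

lemma vector_space_mult: "vector_space ((*) :: 'k::field \<Rightarrow> 'k \<Rightarrow> 'k)"
  by unfold_locales (simp_all add: algebra_simps)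

context vector_space
begin

text \<open>Applying \<open>A t - w k t\<close> kills the component of index \<open>k\<close> and
  multiplies the others by scalars. A suitable \<open>t\<close> makes a chosen scalar non-zero, so
  induction on \<open>I\<close> isolates each component. With \<open>W = {0}\<close> this is
  independence of eigenvectors.\<close>

lemma weight_components:
  assumes "finite I"
    and "\<And>t. t \<in> T \<Longrightarrow> Vector_Spaces.linear scale scale (A t)"
    and "\<And>i t. i \<in> I \<Longrightarrow> t \<in> T \<Longrightarrow> A t (v i) = scale (w i t) (v i)"
    and "\<And>i j. i \<in> I \<Longrightarrow> j \<in> I \<Longrightarrow> i \<noteq> j \<Longrightarrow> \<exists>t\<in>T. w i t \<noteq> w j t"
    and "subspace W" and "\<And>t u. t \<in> T \<Longrightarrow> u \<in> W \<Longrightarrow> A t u \<in> W"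
    and "sum v I \<in> W" and "i \<in> I"
  shows "v i \<in> W"
  using assms(1,3,4,7,8)
proof (induction I arbitrary: v i rule: finite_induct)
  case empty
  then show ?case by simp
next
  case (insert k I)
  have other: "v j \<in> W" if j: "j \<in> I" for j
  proof -
    have "j \<noteq> k" using insert.hyps j by auto
    then obtain t where t: "t \<in> T" "w j t \<noteq> w k t" using insert.prems(2)[of j k] j by auto
    interpret At: Vector_Spaces.linear scale scale "A t" by (rule assms(2)[OF t(1)])
    let ?u = "\<lambda>i. scale (w i t - w k t) (v i)"
    have "A t (sum v (insert k I)) - scale (w k t) (sum v (insert k I)) \<in> W"
      using insert.prems(3) assms(5,6) t by (intro subspace_diff subspace_scale) auto
    also have "A t (sum v (insert k I)) - scale (w k t) (sum v (insert k I)) =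
        (\<Sum>i\<in>insert k I. ?u i)"
      using insert.prems(1) t(1)
      by (simp add: At.sum scale_sum_right scale_left_diff_distrib sum_subtractf
          del: sum.insert)
    also have "\<dots> = sum ?u I" using insert.hyps by simp
    finally have s: "sum ?u I \<in> W" .
    have "?u j \<in> W"
    proof (rule insert.IH[OF _ _ s j])
      show "A s (?u i) = scale (w i s) (?u i)" if "i \<in> I" "s \<in> T" for i s
      proof -
        interpret As: Vector_Spaces.linear scale scale "A s" by (rule assms(2)[OF that(2)])
        show ?thesis using insert.prems(1) that by (simp add: As.scale mult.commute)
      qed
    qed (use insert.prems(2) in auto)
    then have "scale (inverse (w j t - w k t)) (?u j) \<in> W" using assms(5) subspace_scale by blast
    then show ?thesis using t(2) by simp
  qed
  show ?case
  proof (cases "i = k")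
    case False
    then show ?thesis using other insert.prems(4) by auto
  next
    case True
    have "sum v (insert k I) - sum v I \<in> W"
      by (rule subspace_diff[OF assms(5) insert.prems(3) subspace_sum[OF assms(5) other]])
    also have "sum v (insert k I) - sum v I = v k" using insert.hyps by simp
    finally show ?thesis using True by simp
  qed
qed

lemma span_family_decomp:
  assumes sub: "\<And>i. i \<in> I \<Longrightarrow> subspace (S i)" and "x \<in> span (\<Union>i\<in>I. S i)"
  shows "\<exists>J v. finite J \<and> J \<subseteq> I \<and> (\<forall>i\<in>J. v i \<in> S i) \<and> x = sum v J"
  using assms(2)
proof (induction rule: span_induct_alt)
  case base
  show ?case by (rule exI[of _ "{}"]) auto
next
  case (step c y x)
  from step(1) obtain k where k: "k \<in> I" "y \<in> S k" by blast
  from step(2) obtain J v where J: "finite J" "J \<subseteq> I" "\<forall>i\<in>J. v i \<in> S i" "x = sum v J" by blast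
  define u where "u i = (if i \<in> J then v i else 0) + (if i = k then scale c y else 0)" for i
  have "u i \<in> S i" if "i \<in> insert k J" for i
    unfolding u_def using that J(2,3) k sub
    by (intro subspace_add[OF sub]) (auto intro: subspace_0 subspace_scale)
  moreover have "sum u (insert k J) = scale c y + x"
  proof -
    have "(\<Sum>i\<in>insert k J. if i \<in> J then v i else 0) = sum v J"
      using J(1) by (intro sum.mono_neutral_cong_right) auto
    then show ?thesis unfolding u_def using J by (simp add: sum.distrib add.commute del: sum.insert)
  qed
  ultimately show ?case using J k by (intro exI[of _ "insert k J"] exI[of _ u]) auto
qed

lemma subspace_preimage:
  assumes "Vector_Spaces.linear scale scale g" "subspace S"
  shows "subspace {v. g v \<in> S}"
proof -
  interpret g: Vector_Spaces.linear scale scale g by (rule assms(1))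
  show ?thesis by (rule g.subspace_linear_preimage[OF assms(2)])
qed

lemma scale_2: "scale 2 v = v + v"
  using scale_left_distrib[of 1 1 v] by simp

lemma subspace_multiples:
  assumes "Vector_Spaces.linear scale scale g"
  shows "subspace {v. \<exists>c. g v = scale c w}"
  using subspace_preimage[OF assms subspace_span[of "{w}"]] by (simp add: span_singleton image_iff)

end

section \<open>Bases, coordinates and traces\<close>

locale based_space = vector_space sc for sc :: "'k::field \<Rightarrow> 'g::ab_group_add \<Rightarrow> 'g" +
  fixes B :: "'g set"
  assumes fin: "finite B" and indep: "independent B" and spanB: "span B = UNIV"
begin

lemma expand: "v = (\<Sum>b\<in>B. sc (representation B v b) b)"
  using sum_representation_eq[OF indep, of v B] spanB fin by simp

lemma rep_add: "representation B (u + v) b = representation B u b + representation B v b"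
  by (simp add: representation_add[OF indep] spanB)

lemma rep_scale: "representation B (sc r v) b = r * representation B v b"
  by (simp add: representation_scale[OF indep] spanB)

lemma rep_sum: "representation B (\<Sum>i\<in>I. f i) b = (\<Sum>i\<in>I. representation B (f i) b)"
  by (simp add: representation_sum[OF indep] spanB)

lemma rep_linear: "Vector_Spaces.linear sc (*) (\<lambda>v. representation B v b)"
  by (simp add: Vector_Spaces.linear_iff rep_add rep_scale vector_space_axioms vector_space_mult)

lemma rep_eqI: "(\<And>b. b \<in> B \<Longrightarrow> representation B u b = representation B v b) \<Longrightarrow> u = v"
  using expand[of u] expand[of v] by simp

text \<open>The basis is a parameter because traces are needed in two bases: a fixed one, and later
  an eigenbasis of \<open>ad x\<close>.\<close>

definition trace :: "('g \<Rightarrow> 'g) \<Rightarrow> 'k" where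
  "trace A = (\<Sum>b\<in>B. representation B (A b) b)"

lemma linear_expand: "Vector_Spaces.linear sc sc A \<Longrightarrow> A v = (\<Sum>b\<in>B. sc (representation B v b) (A b))"
proof -
  assume "Vector_Spaces.linear sc sc A"
  then interpret A: Vector_Spaces.linear sc sc A .
  show ?thesis by (subst expand[of v]) (simp add: A.sum A.scale)
qed

lemma trace_comp_commute:
  assumes "Vector_Spaces.linear sc sc A" "Vector_Spaces.linear sc sc C"
  shows "trace (\<lambda>v. A (C v)) = trace (\<lambda>v. C (A v))"
proof -
  have *: "trace (\<lambda>v. A (C v)) =
      (\<Sum>b\<in>B. \<Sum>c\<in>B. representation B (C b) c * representation B (A c) b)"
    if "Vector_Spaces.linear sc sc A" for A C
    unfolding trace_def by (subst linear_expand[OF that]) (simp add: rep_sum rep_scale)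
  show ?thesis
    unfolding *[OF assms(1)] *[OF assms(2)] by (subst sum.swap) (simp add: mult.commute)
qed

lemma trace_diff: "trace (\<lambda>v. A v - C v) = trace A - trace C"
proof -
  have "representation B (u - v) b = representation B u b - representation B v b" for u v b
    using rep_add[of "u - v" v b] by simp
  then show ?thesis by (simp add: trace_def sum_subtractf)
qed

end

section \<open>Lie algebras\<close>

context lie_algebra
begin

lemma br_zero [simp]: "br 0 a = 0" "br a 0 = 0"
  using br_add_left[of 0 0 a] br_add_right[of a 0 0] by simp_all

lemma br_minus_left [simp]: "br (- a) b = - br a b"
  using br_add_left[of a "- a" b] by (simp add: eq_neg_iff_add_eq_0 add.commute)

lemma br_minus_right [simp]: "br a (- b) = - br a b"
  using br_add_right[of a b "- b"] by (simp add: eq_neg_iff_add_eq_0 add.commute)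

lemma br_diff_left: "br (a - b) c = br a c - br b c"
  using br_add_left[of a "- b" c] by simp

lemma br_diff_right: "br a (b - c) = br a b - br a c"
  using br_add_right[of a b "- c"] by simp

lemma br_anti: "br a b = - br b a"
  using br_self[of "a + b"] br_self[of a] br_self[of b]
  by (simp add: br_add_left br_add_right eq_neg_iff_add_eq_0 add.commute)

lemma leibniz: "br a (br b c) = br (br a b) c + br b (br a c)"
  using jacobi[of a b c] br_anti[of c a] br_anti[of c "br a b"]
  by (simp add: eq_neg_iff_add_eq_0 algebra_simps)

lemma linear_ad: "Vector_Spaces.linear sc sc (br a)"
  by (simp add: Vector_Spaces.linear_iff vector_space_axioms br_add_right br_scale_right)

lemma linear_br_left: "Vector_Spaces.linear sc sc (\<lambda>a. br a b)"
  by (simp add: Vector_Spaces.linear_iff vector_space_axioms br_add_left br_scale_left)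

lemma br_sum_right: "br a (sum g I) = (\<Sum>i\<in>I. br a (g i))"
  by (induction I rule: infinite_finite_induct) (simp_all add: br_add_right)

lemma br_sum_left: "br (sum g I) a = (\<Sum>i\<in>I. br (g i) a)"
  by (induction I rule: infinite_finite_induct) (simp_all add: br_add_left)

lemmas br_lin = br_add_left br_add_right br_diff_left br_diff_right br_scale_left br_scale_right

lemma in_eigenspace: "v \<in> eigenspace sc A c \<longleftrightarrow> A v = sc c v"
  by (simp add: eigenspace_def)

lemma in_grade: "v \<in> grade sc br x i \<longleftrightarrow> br x v = sc i v"
  by (simp add: grade_def eigenspace_def)

lemma subspace_eigenspace: "subspace (eigenspace sc (br t) c)"
  by (auto intro!: subspaceI simp: in_eigenspace br_lin scale_right_distrib mult.commute)

lemma grade_br: "a \<in> grade sc br x i \<Longrightarrow> b \<in> grade sc br x j \<Longrightarrow> br a b \<in> grade sc br x (i + j)"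
  by (simp add: in_grade leibniz[of x] br_lin scale_left_distrib)

text \<open>Split a joint eigenvector of \<open>T\<close> into eigenvectors of \<open>ad t\<close>.
  As \<open>ad t\<close> commutes with each \<open>ad t'\<close>, it preserves the eigenspaces of
  \<open>ad t'\<close>, so the components stay joint eigenvectors.\<close>

lemma simultaneous_eigenvectors:
  assumes "finite T" and "\<And>s t. s \<in> T \<Longrightarrow> t \<in> T \<Longrightarrow> br s t = 0"
    and "\<And>t. t \<in> T \<Longrightarrow> span (\<Union>c. eigenspace sc (br t) c) = UNIV"
  shows "span {v. \<forall>t\<in>T. \<exists>c. br t v = sc c v} = UNIV"
  using assms
proof (induction T rule: finite_induct)
  case empty
  then show ?case by simp
next
  case (insert t T)
  let ?J = "\<lambda>T. {v. \<forall>t\<in>T. \<exists>c. br t v = sc c v}"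
  have "v \<in> span (?J (insert t T))" if v: "v \<in> ?J T" for v
  proof -
    have "v \<in> span (\<Union>c\<in>UNIV. eigenspace sc (br t) c)" using insert.prems(2)[of t] by simp
    from span_family_decomp[OF subspace_eigenspace this]
    obtain J u where J: "finite J" "\<forall>c\<in>J. u c \<in> eigenspace sc (br t) c" "v = sum u J" by blast
    have "u c \<in> ?J (insert t T)" if c: "c \<in> J" for c
    proof -
      have "\<exists>d. br t' (u c) = sc d (u c)" if t': "t' \<in> T" for t'
      proof -
        from v t' obtain d where d: "br t' v = sc d v" by blast
        have "u c \<in> eigenspace sc (br t') d"
        proof (rule weight_components[where T = "{t}" and A = br and I = J and w = "\<lambda>c _. c" and v = u])
          show "br s w \<in> eigenspace sc (br t') d"
            if "s \<in> {t}" "w \<in> eigenspace sc (br t') d" for s w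
            using that leibniz[of t' t w] insert.prems(1)[of t' t] t'
            by (simp add: in_eigenspace br_lin)
        qed (use J d c linear_ad subspace_eigenspace in \<open>auto simp: in_eigenspace\<close>)
        then show ?thesis by (auto simp: in_eigenspace)
      qed
      moreover have "br t (u c) = sc c (u c)" using J c by (auto simp: in_eigenspace)
      ultimately show ?thesis by auto
    qed
    then show ?thesis unfolding J(3) by (intro span_sum span_base)
  qed
  then have "span (?J T) \<subseteq> span (?J (insert t T))" by (intro span_minimal) auto
  then show ?case using insert by auto
qed

end

section \<open>Strings of eigenvectors and sl_2 theory\<close>

locale fd_lie_algebra = lie_algebra sc br
  for sc :: "'k::field_char_0 \<Rightarrow> 'g::ab_group_add \<Rightarrow> 'g" and br +
  assumes fd: "\<exists>Bs. finite_dimensional_vector_space sc Bs"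
begin

definition Bas :: "'g set" where "Bas = (SOME Bs. finite_dimensional_vector_space sc Bs)"

sublocale finite_dimensional_vector_space sc Bas
  unfolding Bas_def by (rule someI_ex[OF fd])

sublocale based_space sc Bas
  by unfold_locales (auto simp: finite_Basis independent_Basis span_Basis)

text \<open>Non-zero eigenvectors for distinct eigenvalues are independent, and there cannot be
  \<open>dimension + 1\<close> of them. This is what terminates the strings of sl_2 theory.\<close>

lemma eigenvector_sequence_vanishes:
  assumes A: "Vector_Spaces.linear sc sc A" and "\<And>k::nat. A (v k) = sc (c k) (v k)" and "inj c"
  shows "\<exists>k. v k = 0"
proof (rule ccontr)
  interpret A: Vector_Spaces.linear sc sc A by (rule A)
  assume nz: "\<nexists>k. v k = 0"
  have inj: "inj v"
  proof
    fix i j assume eq: "v i = v j"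
    then have "sc (c i) (v i) = sc (c j) (v i)" using assms(2)[of i] assms(2)[of j] by metis
    then have "c i = c j" using nz scale_cancel_right eq assms(2) by metis
    then show "i = j" using assms(3) by (auto dest: injD)
  qed
  have "independent (v ` {..dimension})"
  proof (rule independent_if_scalars_zero)
    fix a u assume s: "(\<Sum>u\<in>v ` {..dimension}. sc (a u) u) = 0" and u: "u \<in> v ` {..dimension}"
    then obtain k where k: "u = v k" "k \<le> dimension" by auto
    have "(\<Sum>i\<le>dimension. sc (a (v i)) (v i)) = 0"
      using s inj by (subst (asm) sum.reindex) (auto simp: inj_on_def)
    then have "sc (a (v k)) (v k) \<in> {0}" using A.zero
      using weight_components[where T = "{()}" and A = "\<lambda>_. A" and I = "{..dimension}" and
          W = "{0}" and v = "\<lambda>i. sc (a (v i)) (v i)" and w = "\<lambda>i _. c i" and i = k] A k assms(2,3)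
      by (auto simp: A.scale inj_def mult.commute)
    then show "a u = 0" using nz k by auto
  qed auto
  then have "card (v ` {..dimension}) \<le> dimension"
    by (metis dim_UNIV dimension_def independent_card_le_dim subset_UNIV)
  then show False using inj by (simp add: card_image inj_on_subset)
qed

lemma weight_shift:
  assumes "br x a = sc d a" "br x v = sc c v"
  shows "br x ((br a ^^ k) v) = sc (c + of_nat k * d) ((br a ^^ k) v)"
proof (induction k)
  case (Suc k)
  have "br x ((br a ^^ Suc k) v) = sc d (br a ((br a ^^ k) v)) + br a (br x ((br a ^^ k) v))"
    using leibniz[of x a] assms(1) by (simp add: br_lin)
  also have "\<dots> = sc (d + (c + of_nat k * d)) ((br a ^^ Suc k) v)"
    unfolding Suc by (simp add: br_lin scale_left_distrib)
  finally show ?case by (simp add: algebra_simps)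
qed (simp add: assms(2))

lemma weight_lowering:
  "br x f = - f \<Longrightarrow> br x v = sc c v \<Longrightarrow> br x ((br f ^^ k) v) = sc (c - of_nat k) ((br f ^^ k) v)"
  using weight_shift[of x f "- 1" v c k] by simp

lemma sl2_lowering_vanishes:
  assumes f: "br x f = - f" and v: "br x v = sc c v"
  shows "\<exists>k. (br f ^^ k) v = 0"
proof -
  have "br x ((br f ^^ k) v) = sc (c - of_nat k) ((br f ^^ k) v)" for k
    by (rule weight_lowering[OF f v])
  from eigenvector_sequence_vanishes[OF linear_ad this] show ?thesis by (auto simp: inj_def)
qed

text \<open>Lower \<open>v\<close> to a vector \<open>w\<close> killed by \<open>f\<close>, of
  weight \<open>l = c - k'\<close>, and then raise \<open>w\<close> until it dies. At the last step
  the coefficient in \<open>fe\<close> must vanish, so \<open>2 l = - j'\<close> and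
  \<open>2 c = 2 k' - j'\<close>. No complete reducibility is involved.\<close>

lemma sl2_half_integral:
  assumes tr: "sl2_triple sc br e x f" and v: "br x v = sc c v" "v \<noteq> 0"
  shows "\<exists>n. 2 * c = of_int n"
proof -
  have t: "br e f = sc 2 x" "br x e = e" "br x f = - f" using tr by (auto simp: sl2_triple_def)
  obtain k where k: "(br f ^^ k) v = 0" using sl2_lowering_vanishes[OF t(3) v(1)] by blast
  define k where "k = (LEAST k. (br f ^^ k) v = 0)"
  have k0: "(br f ^^ k) v = 0" unfolding k_def by (rule LeastI) (rule k)
  with v have "k \<noteq> 0" by (metis funpow_0)
  then obtain k' where k': "k = Suc k'" by (cases k) auto
  define w where "w = (br f ^^ k') v"
  have w: "w \<noteq> 0" using not_less_Least[of k' "\<lambda>k. (br f ^^ k) v = 0"] k' k_def w_def by auto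
  have fw: "br f w = 0" using k0 k' w_def by simp
  have xk: "br x ((br f ^^ k) v) = sc (c - of_nat k) ((br f ^^ k) v)" for k
    by (rule weight_lowering[OF t(3) v(1)])
  define l where "l = c - of_nat k'"
  have xw: "br x w = sc l w" unfolding w_def l_def by (rule xk)
  have xe: "br x ((br e ^^ j) w) = sc (l + of_nat j) ((br e ^^ j) w)" for j
    using weight_shift[of x e 1 w l j] xw t by simp
  have fe: "br f ((br e ^^ Suc j) w) = sc (- of_nat (Suc j) * (2 * l + of_nat j)) ((br e ^^ j) w)" for j
  proof (induction j)
    case 0
    have "br f (br e w) = br (br f e) w" using fw by (simp add: leibniz[of f e])
    also have "\<dots> = - sc (2 * l) w" using br_anti[of f e] xw by (simp add: t br_lin)
    finally show ?case by simp
  next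
    case (Suc j)
    let ?z = "(br e ^^ Suc j) w"
    have "br f (br e ?z) = br (br f e) ?z + br e (br f ?z)" by (rule leibniz)
    also have "br (br f e) ?z = sc (- 2 * (l + of_nat (Suc j))) ?z"
      using br_anti[of f e] xe[of "Suc j"] by (simp add: t br_lin algebra_simps)
    also have "br e (br f ?z) = sc (- of_nat (Suc j) * (2 * l + of_nat j)) ?z"
      unfolding Suc by (simp add: br_lin)
    also have "sc (- 2 * (l + of_nat (Suc j))) ?z + \<dots> = 
        sc (- 2 * (l + of_nat (Suc j)) + - of_nat (Suc j) * (2 * l + of_nat j)) ?z"
      by (rule scale_left_distrib[symmetric])
    also have "- 2 * (l + of_nat (Suc j)) + - of_nat (Suc j) * (2 * l + of_nat j) =
        - of_nat (Suc (Suc j)) * (2 * l + of_nat (Suc j))" by (simp add: algebra_simps)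
    finally show ?case by simp
  qed
  have "\<exists>j. (br e ^^ j) w = 0"
    by (rule eigenvector_sequence_vanishes[OF linear_ad xe]) (auto simp: inj_def)
  then obtain j where j: "(br e ^^ j) w = 0" by blast
  define j where "j = (LEAST j. (br e ^^ j) w = 0)"
  have j0: "(br e ^^ j) w = 0" unfolding j_def by (rule LeastI) (rule j)
  with w have "j \<noteq> 0" by (metis funpow_0)
  then obtain j' where j': "j = Suc j'" by (cases j) auto
  have nz: "(br e ^^ j') w \<noteq> 0"
    using not_less_Least[of j' "\<lambda>j. (br e ^^ j) w = 0"] j' j_def by auto
  have "- of_nat (Suc j') * (2 * l + of_nat j') = (0::'k)"
    using fe[of j'] nz j0 unfolding j' by (metis br_zero(2) scale_eq_0_iff)
  then have "2 * l + of_nat j' = 0"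
    by (metis mult_eq_0_iff neg_equal_0_iff_equal of_nat_eq_0_iff nat.distinct(1))
  then have "2 * c = of_int (2 * int k' - int j')"
    unfolding l_def by (simp add: algebra_simps add_eq_0_iff)
  then show ?thesis by blast
qed

end

section \<open>The invariant form and the roots\<close>

locale fd_simple_lie_algebra = fd_lie_algebra sc br + simple_lie_algebra sc br
  for sc :: "'k::field_char_0 \<Rightarrow> 'g::ab_group_add \<Rightarrow> 'g" and br
begin

definition killing :: "'g \<Rightarrow> 'g \<Rightarrow> 'k" where
  "killing a b = trace (\<lambda>v. br a (br b v))"

lemma killing_add_left: "killing (a + b) c = killing a c + killing b c"
  by (simp add: killing_def trace_def br_lin rep_add sum.distrib)

lemma killing_add_right: "killing c (a + b) = killing c a + killing c b"
  by (simp add: killing_def trace_def br_lin rep_add sum.distrib)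

lemma killing_scale_left: "killing (sc r a) b = r * killing a b"
  by (simp add: killing_def trace_def br_lin rep_scale sum_distrib_left)

lemma killing_scale_right: "killing a (sc r b) = r * killing a b"
  by (simp add: killing_def trace_def br_lin rep_scale sum_distrib_left)

lemma killing_zero [simp]: "killing 0 b = 0" "killing a 0 = 0"
  using killing_scale_left[of 0 0 b] killing_scale_right[of a 0 0] by simp_all

lemma killing_invariant: "killing (br z a) b + killing a (br z b) = 0"
proof -
  have lin: "Vector_Spaces.linear sc sc (\<lambda>v. br a (br b v))"
    by (simp add: Vector_Spaces.linear_iff vector_space_axioms br_lin)
  have "killing (br z a) b = trace (\<lambda>v. br z (br a (br b v)) - br a (br z (br b v)))"
    unfolding killing_def by (simp add: leibniz[of z a])
  moreover have "killing a (br z b) = trace (\<lambda>v. br a (br z (br b v)) - br a (br b (br z v)))"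
    unfolding killing_def by (simp add: leibniz[of z b] br_lin)
  ultimately show ?thesis
    unfolding trace_diff using trace_comp_commute[OF linear_ad[of z] lin] by simp
qed

text \<open>By invariance the radical is an ideal, and \<open>c\<close> does not belong to
  it.\<close>

lemma killing_nondegenerate:
  assumes "killing c d \<noteq> 0" and "\<And>b. killing a b = 0"
  shows "a = 0"
proof -
  let ?I = "{a. \<forall>b. killing a b = 0}"
  have "lie_ideal sc br ?I"
    unfolding lie_ideal_def
  proof (intro conjI allI ballI)
    show "module.subspace sc ?I"
      by (rule subspaceI) (auto simp: killing_add_left killing_scale_left)
    show "br z a \<in> ?I" if "a \<in> ?I" for z a
      using that killing_invariant[of z a] by auto
  qed
  from simple[OF this] show ?thesis using assms by auto
qed

end

section \<open>The root space decomposition\<close>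

locale rooted_lie_algebra = fd_simple_lie_algebra sc br
  for sc :: "'k::field_char_0 \<Rightarrow> 'g::ab_group_add \<Rightarrow> 'g" and br +
  fixes h :: "'g set"
  assumes cartan: "cartan_subalgebra sc br h"
begin

abbreviation "R \<equiv> roots sc br h"
abbreviation "rs \<equiv> root_space sc br h"

text \<open>Including the zero functional treats \<open>h\<close>, which is its weight space by
  \<open>rs_zero\<close>, on a par with the root spaces.\<close>

definition weights :: "('g \<Rightarrow> 'k) set" where
  "weights = insert (\<lambda>_. 0) R"

lemma sub_h: "subspace h" and h_comm: "s \<in> h \<Longrightarrow> t \<in> h \<Longrightarrow> br s t = 0"
  and h_max: "(\<And>t. t \<in> h \<Longrightarrow> br t y = 0) \<Longrightarrow> y \<in> h"
  and h_diag: "t \<in> h \<Longrightarrow> span (\<Union>c. eigenspace sc (br t) c) = UNIV"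
  using cartan unfolding cartan_subalgebra_def by blast+

lemma rs_iff: "v \<in> rs \<alpha> \<longleftrightarrow> (\<forall>t\<in>h. br t v = sc (\<alpha> t) v)"
  by (auto simp: root_space_def)

lemma subspace_rs: "subspace (rs \<alpha>)"
  by (rule subspaceI) (auto simp: rs_iff br_lin scale_right_distrib mult.commute)

lemma rs_zero: "rs (\<lambda>_. 0) = h"
  using h_comm h_max by (auto simp: rs_iff)

lemma rs_br: "a \<in> rs \<alpha> \<Longrightarrow> b \<in> rs \<beta> \<Longrightarrow> br a b \<in> rs (\<lambda>t. \<alpha> t + \<beta> t)"
  by (auto simp: rs_iff leibniz[of _ a] br_lin scale_left_distrib)

lemma weights_outside: "\<alpha> \<in> weights \<Longrightarrow> t \<notin> h \<Longrightarrow> \<alpha> t = 0"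
  by (auto simp: weights_def roots_def)

lemma rs_trivial:
  assumes "\<And>t. t \<notin> h \<Longrightarrow> \<gamma> t = 0" "\<gamma> \<notin> weights" "v \<in> rs \<gamma>"
  shows "v = 0"
proof (rule ccontr)
  assume "v \<noteq> 0"
  moreover have "\<exists>t\<in>h. \<gamma> t \<noteq> 0" using assms(1,2) by (force simp: weights_def)
  ultimately have "\<gamma> \<in> R" using assms by (auto simp: roots_def)
  then show False using assms(2) by (simp add: weights_def)
qed

text \<open>A basis \<open>T\<close> of \<open>h\<close> is finite, so its elements can be
  diagonalized together. Being an eigenvector is a linear condition on the acting element and hence
  passes from \<open>T\<close> to all of \<open>h\<close>.\<close>

lemma span_weights: "span (\<Union>\<gamma>\<in>weights. rs \<gamma>) = UNIV"
proof -
  obtain T where T: "T \<subseteq> h" "independent T" "h \<subseteq> span T"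
    using maximal_independent_subset[of h] by blast
  have finT: "finite T" using finiteI_independent T(2) .
  have "v \<in> (\<Union>\<gamma>\<in>weights. rs \<gamma>)" if v: "\<forall>t\<in>T. \<exists>c. br t v = sc c v" for v
  proof (cases "v = 0")
    case True
    then show ?thesis by (auto simp: weights_def rs_iff)
  next
    case False
    have "subspace {t. \<exists>c. br t v = sc c v}"
      by (rule subspace_multiples[OF linear_br_left])
    then have "span T \<subseteq> {t. \<exists>c. br t v = sc c v}" using v by (intro span_minimal) auto
    with T have "\<forall>t\<in>h. \<exists>c. br t v = sc c v" by blast
    then obtain c where c: "\<And>t. t \<in> h \<Longrightarrow> br t v = sc (c t) v" by metis
    define \<gamma> where "\<gamma> t = (if t \<in> h then c t else 0)" for t
    have g: "v \<in> rs \<gamma>" using c by (simp add: rs_iff \<gamma>_def)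
    have "\<gamma> \<in> weights"
      using rs_trivial[OF _ _ g] False by (auto simp: \<gamma>_def)
    then show ?thesis using g by blast
  qed
  then have "{v. \<forall>t\<in>T. \<exists>c. br t v = sc c v} \<subseteq> (\<Union>\<gamma>\<in>weights. rs \<gamma>)" by blast
  from span_mono[OF this] show ?thesis
    using simultaneous_eigenvectors[OF finT] h_comm h_diag T(1) by blast
qed

lemma weight_induct:
  assumes "subspace S" "\<And>\<gamma> v. \<gamma> \<in> weights \<Longrightarrow> v \<in> rs \<gamma> \<Longrightarrow> v \<in> S"
  shows "v \<in> S"
  using span_minimal[of "\<Union>\<gamma>\<in>weights. rs \<gamma>" S] assms span_weights by auto

lemma killing_orthogonal:
  assumes "a \<in> rs \<alpha>" "b \<in> rs \<beta>" "t \<in> h" "\<alpha> t + \<beta> t \<noteq> 0"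
  shows "killing a b = 0"
proof -
  have "(\<alpha> t + \<beta> t) * killing a b = 0"
    using killing_invariant[of t a b] assms(1-3)
    by (simp add: rs_iff killing_scale_left killing_scale_right algebra_simps)
  then show ?thesis using assms(4) by simp
qed

text \<open>The given \<open>x\<close> need not lie in \<open>h\<close>: replace \<open>e\<close> by its component in the root space of \<open>-\<alpha>\<close>.\<close>

lemma triple_in_root_spaces:
  assumes tr: "sl2_triple sc br e x f" and f: "f \<in> rs \<alpha>" "\<alpha> \<in> R"
  obtains e' x' where "sl2_triple sc br e' x' f" "x' \<in> h" "e' \<in> rs (\<lambda>t. - \<alpha> t)"
proof -
  have t: "br e f = sc 2 x" "br x e = e" "br x f = - f" using tr by (auto simp: sl2_triple_def)
  have "e \<in> span (\<Union>\<gamma>\<in>weights. rs \<gamma>)" by (simp add: span_weights)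
  from span_family_decomp[OF subspace_rs this] obtain J v where
    J: "finite J" "J \<subseteq> weights" "\<forall>\<gamma>\<in>J. v \<gamma> \<in> rs \<gamma>" "e = sum v J" by blast
  define n where "n = (\<lambda>t. - \<alpha> t)"
  \<comment> \<open>The index \<open>-\<alpha>\<close> is added because \<open>e\<close> might a
    priori have no component there.\<close>
  define J' where "J' = insert n J"
  define u where "u \<gamma> = (if \<gamma> \<in> J then v \<gamma> else 0)" for \<gamma>
  \<comment> \<open>These are the weight components of \<open>[[e,f],f] + 2 f = 0\<close>.
    Bracketing twice with \<open>f\<close> shifts weights by \<open>2\<alpha>\<close>, so the term
    \<open>2 f\<close> of weight \<open>\<alpha>\<close> belongs to the index
    \<open>n = -\<alpha>\<close>.\<close>
  define w where "w \<gamma> = br (br (u \<gamma>) f) f + (if \<gamma> = n then sc 2 f else 0)" for \<gamma>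
  have u: "u \<gamma> \<in> rs \<gamma>" for \<gamma> using J(3) by (auto simp: u_def intro: subspace_0 subspace_rs)
  have out: "\<gamma> t = 0" if "\<gamma> \<in> J'" "t \<notin> h" for \<gamma> t
    using that J(2) f(2) weights_outside[of \<gamma> t] weights_outside[of \<alpha> t]
    by (auto simp: J'_def n_def weights_def)
  have fin: "finite J'" and nJ: "n \<in> J'" using J(1) by (simp_all add: J'_def)
  have "sum u J' = e" unfolding J'_def J(4) u_def using J(1)
    by (intro sum.mono_neutral_cong_right) auto
  then have "(\<Sum>\<gamma>\<in>J'. br (br (u \<gamma>) f) f) = br (br e f) f"
    by (simp only: br_sum_left[symmetric])
  then have "sum w J' = br (br e f) f + sc 2 f"
    using sum.delta[OF fin, of n "\<lambda>_. sc 2 f"] by (simp add: w_def sum.distrib J'_def eq_commute del: sum.insert sum.delta sum.delta')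
  also have "\<dots> = 0" by (simp add: t br_lin)
  finally have s: "sum w J' \<in> {0}" by simp
  have "w n \<in> {0}"
  proof (rule weight_components[where T = h and A = br and I = J' and v = w and
        w = "\<lambda>\<gamma> t. \<gamma> t + 2 * \<alpha> t"])
    fix \<gamma> t assume "\<gamma> \<in> J'" "t \<in> h"
    have "br (br (u \<gamma>) f) f \<in> rs (\<lambda>t. \<gamma> t + 2 * \<alpha> t)"
      using rs_br[OF rs_br[OF u f(1)] f(1), of \<gamma>] unfolding mult_2 add.assoc .
    moreover have "(if \<gamma> = n then sc 2 f else 0) \<in> rs (\<lambda>t. \<gamma> t + 2 * \<alpha> t)"
      using f(1) by (auto simp: rs_iff n_def br_lin)
    ultimately have "w \<gamma> \<in> rs (\<lambda>t. \<gamma> t + 2 * \<alpha> t)"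
      unfolding w_def by (rule subspace_add[OF subspace_rs])
    then show "br t (w \<gamma>) = sc (\<gamma> t + 2 * \<alpha> t) (w \<gamma>)" using \<open>t \<in> h\<close> by (simp add: rs_iff)
  next
    fix \<gamma> \<delta> assume "\<gamma> \<in> J'" "\<delta> \<in> J'" "\<gamma> \<noteq> \<delta>"
    then obtain t where "\<gamma> t \<noteq> \<delta> t" by auto
    moreover from this have "t \<in> h" using out[of \<gamma> t] out[of \<delta> t] \<open>\<gamma> \<in> J'\<close> \<open>\<delta> \<in> J'\<close> by metis
    ultimately show "\<exists>t\<in>h. \<gamma> t + 2 * \<alpha> t \<noteq> \<delta> t + 2 * \<alpha> t" by auto
  qed (use s fin nJ in \<open>simp_all add: linear_ad\<close>)
  then have w0: "br (br (u n) f) f = - sc 2 f" unfolding w_def by (simp add: eq_neg_iff_add_eq_0)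
  define x' where "x' = sc (1/2) (br (u n) f)"
  have "br (u n) f \<in> rs (\<lambda>t. 0)" using rs_br[OF u[of n] f(1)] by (simp add: n_def)
  then have x': "x' \<in> h" unfolding x'_def rs_zero by (rule subspace_scale[OF sub_h])
  have xf: "br x' f = - f" unfolding x'_def by (simp add: br_scale_left w0)
  have ef: "br (u n) f = sc 2 x'" by (simp add: x'_def)
  have un: "u n \<in> rs (\<lambda>t. - \<alpha> t)" using u[of n] unfolding n_def .
  show thesis
  proof (cases "f = 0")
    case True
    show thesis
      by (rule that[of 0 0])
        (simp_all add: sl2_triple_def rs_iff True subspace_0[OF sub_h])
  next
    case False
    have "sc (\<alpha> x') f = sc (- 1) f" using xf f(1) x' by (simp add: rs_iff)
    then have "\<alpha> x' = - 1" using False by (metis scale_cancel_right)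
    then have "br x' (u n) = u n" using un x' unfolding rs_iff by simp
    then have "sl2_triple sc br (u n) x' f" using xf ef by (simp add: sl2_triple_def)
    then show thesis using that x' un by blast
  qed
qed

text \<open>In an eigenbasis the trace of \<open>(ad x)^2\<close> is a sum of squares.
  Multiplication by 4 makes it a sum of squares of integers, so positivity makes sense although the
  field carries no order. Its vanishing would give \<open>ad x = 0\<close>, against
  \<open>[x,f] = -f\<close>.\<close>

lemma killing_nontrivial:
  assumes tr: "sl2_triple sc br e x f" and "f \<noteq> 0" "x \<in> h"
  shows "killing x x \<noteq> 0"
proof -
  have t: "br x f = - f" using tr by (auto simp: sl2_triple_def)
  obtain B where B: "B \<subseteq> (\<Union>\<gamma>\<in>weights. rs \<gamma>)" "independent B" "(\<Union>\<gamma>\<in>weights. rs \<gamma>) \<subseteq> span B"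
    using maximal_independent_subset by blast
  interpret rb: based_space sc B
  proof
    show "span B = UNIV" using span_minimal[OF B(3)] span_weights by auto
  qed (use B finiteI_independent in auto)
  have "\<exists>c n. br x b = sc c b \<and> 2 * c = of_int n" if b: "b \<in> B" for b
  proof -
    obtain \<gamma> where "b \<in> rs \<gamma>" using B(1) b by blast
    then have "br x b = sc (\<gamma> x) b" using assms(3) by (simp add: rs_iff)
    moreover have "b \<noteq> 0" using B(2) b dependent_zero by blast
    ultimately show ?thesis using sl2_half_integral[OF tr] by blast
  qed
  then obtain c n where c: "\<And>b. b \<in> B \<Longrightarrow> br x b = sc (c b) b" 
    and n: "\<And>b. b \<in> B \<Longrightarrow> 2 * c b = of_int (n b)" by metis
  \<comment> \<open>\<open>killing\<close> refers to the basis \<open>Bas\<close>; the trace has to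
    be moved to the eigenbasis \<open>B\<close>.\<close>
  have tr_eq: "trace A = rb.trace A" if A: "Vector_Spaces.linear sc sc A" for A
  proof -
    have "trace A = (\<Sum>b\<in>Bas. \<Sum>d\<in>B. representation B b d * representation Bas (A d) b)"
      unfolding trace_def
      by (subst rb.linear_expand[OF A]) (simp add: rep_sum rep_scale)
    also have "\<dots> = (\<Sum>d\<in>B. \<Sum>b\<in>Bas. representation Bas (A d) b * representation B b d)"
      by (subst sum.swap) (simp add: mult.commute)
    also have "\<dots> = (\<Sum>d\<in>B. representation B (\<Sum>b\<in>Bas. sc (representation Bas (A d) b) b) d)"
      by (simp add: rb.rep_sum rb.rep_scale)
    also have "\<dots> = rb.trace A" unfolding rb.trace_def by (simp flip: expand)
    finally show ?thesis .
  qed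
  have "killing x x = rb.trace (\<lambda>v. br x (br x v))"
    unfolding killing_def
    by (rule tr_eq) (simp add: Vector_Spaces.linear_iff vector_space_axioms br_lin)
  also have "\<dots> = (\<Sum>b\<in>B. c b * c b)"
    unfolding rb.trace_def
    by (intro sum.cong) (simp_all add: c br_lin rb.rep_scale representation_basis[OF B(2)])
  finally have "4 * killing x x = (\<Sum>b\<in>B. (2 * c b) * (2 * c b))"
    by (simp add: sum_distrib_left algebra_simps)
  also have "\<dots> = of_int (\<Sum>b\<in>B. n b * n b)" by (simp add: n)
  finally have eq: "4 * killing x x = of_int (\<Sum>b\<in>B. n b * n b)" .
  show ?thesis
  proof
    assume "killing x x = 0"
    then have "(\<Sum>b\<in>B. n b * n b) = 0" using eq by (simp del: of_int_sum)
    then have "\<forall>b\<in>B. n b = 0" using rb.fin by (simp add: sum_nonneg_eq_0_iff)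
    then have "\<forall>b\<in>B. br x b = 0" using n c by fastforce
    then have "br x f = 0" using rb.linear_expand[OF linear_ad, of x f] by simp
    then show False using t assms(2) by simp
  qed
qed

text \<open>If \<open>-\<beta>\<close> were not a root, a root vector for \<open>\<beta>\<close>
  would be Killing-orthogonal to every weight space and hence lie in the radical.\<close>

lemma roots_symmetric:
  assumes "killing c d \<noteq> 0" "\<beta> \<in> R"
  shows "(\<lambda>t. - \<beta> t) \<in> R"
proof (rule ccontr)
  assume n: "(\<lambda>t. - \<beta> t) \<notin> R"
  from assms(2) obtain v t where v: "v \<in> rs \<beta>" "v \<noteq> 0" and t: "t \<in> h" "\<beta> t \<noteq> 0"
    and out: "\<And>t. t \<notin> h \<Longrightarrow> \<beta> t = 0"
    unfolding roots_def by blast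
  have "b \<in> {b. killing v b = 0}" for b
  proof (rule weight_induct)
    show "subspace {b. killing v b = 0}"
      by (rule subspaceI) (auto simp: killing_add_right killing_scale_right)
    fix \<gamma> u assume u: "\<gamma> \<in> weights" "u \<in> rs \<gamma>"
    have "\<gamma> \<noteq> (\<lambda>t. - \<beta> t)" using u(1) n t(2) by (auto simp: weights_def dest: fun_cong[where x = t])
    then obtain s where "\<gamma> s \<noteq> - \<beta> s" by auto
    moreover then have "s \<in> h" using out weights_outside[OF u(1)] by fastforce
    ultimately show "u \<in> {b. killing v b = 0}"
      using killing_orthogonal[OF v(1) u(2), of s] by (auto simp: eq_neg_iff_add_eq_0 add.commute)
  qed
  then show False using killing_nondegenerate[OF assms(1)] v(2) by blast
qed

text \<open>For \<open>v\<close> of weight \<open>\<beta>\<close>, the double bracket has weight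
  \<open>2\<alpha> + \<beta>\<close>. It can survive only for \<open>\<beta> = -\<alpha>\<close>,
  where \<open>[f,v]\<close> lies in \<open>h\<close>. Otherwise suppose
  \<open>\<gamma> = \<alpha> + \<beta>\<close> is a root. Were it positive,
  \<open>\<alpha> - \<gamma> = -\<beta>\<close> would not be a root, against symmetry; so
  \<open>-\<gamma>\<close> is positive and \<open>\<alpha> + \<gamma>\<close> is not a
  weight.\<close>

lemma lowest_root_ad_square:
  assumes P: "positive_system R P" and low: "lowest_root R P \<alpha>" and f: "f \<in> rs \<alpha>"
    and k: "killing c d \<noteq> 0"
  shows "\<exists>c. br f (br f v) = sc c f"
proof -
  note sym = roots_symmetric[OF k]
  have aR: "\<alpha> \<in> R" and low': "\<And>\<beta>. \<beta> \<in> P \<Longrightarrow> (\<lambda>t. \<alpha> t - \<beta> t) \<notin> weights"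
    using low by (auto simp: lowest_root_def weights_def)
  have PR: "P \<subseteq> R" and Pdich: "\<And>\<beta>. \<beta> \<in> R \<Longrightarrow> \<beta> \<notin> P \<Longrightarrow> (\<lambda>t. - \<beta> t) \<in> P"
    using P by (auto simp: positive_system_def)
  have up: "(\<lambda>t. \<alpha> t + \<beta> t) \<notin> weights" if "\<beta> \<in> R" "\<beta> \<notin> P" for \<beta>
    using low'[OF Pdich[OF that]] by simp
  have out: "\<alpha> t = 0" if "t \<notin> h" for t using weights_outside[of \<alpha>] aR that by (simp add: weights_def)
  have sub: "subspace {v. \<exists>c. br f (br f v) = sc c f}"
    by (rule subspace_multiples) (simp add: Vector_Spaces.linear_iff vector_space_axioms br_lin)
  have "v \<in> {v. \<exists>c. br f (br f v) = sc c f}"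
  proof (rule weight_induct[OF sub])
    fix \<beta> v assume b: "\<beta> \<in> weights" and v: "v \<in> rs \<beta>"
    have outb: "\<beta> t = 0" if "t \<notin> h" for t using weights_outside[OF b that] .
    have fv: "br f v \<in> rs (\<lambda>t. \<alpha> t + \<beta> t)" by (rule rs_br[OF f v])
    have zero: "br f (br f v) = 0" if "br f v = 0" using that by simp
    have Cartan: "\<exists>c. br f z = sc c f" if "z \<in> h" for z
      using f that br_anti[of f z] by (intro exI[of _ "- \<alpha> z"]) (simp add: rs_iff)
    consider "\<beta> = (\<lambda>_. 0)" | "(\<lambda>t. \<alpha> t + \<beta> t) \<notin> weights" | "(\<lambda>t. \<alpha> t + \<beta> t) = (\<lambda>_. 0)"
      | "\<beta> \<in> R" "(\<lambda>t. \<alpha> t + \<beta> t) \<in> R"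
      using b by (auto simp: weights_def)
    then have "\<exists>c. br f (br f v) = sc c f"
    proof cases
      case 1
      then have "v \<in> h" using v rs_zero by simp
      then obtain c where "br f v = sc c f" using Cartan by blast
      then show ?thesis by (intro exI[of _ 0]) (simp add: br_lin br_self)
    next
      case 2
      then have "br f v = 0" using rs_trivial[OF _ _ fv] out outb by simp
      then show ?thesis by (intro exI[of _ 0]) simp
    next
      case 3
      then show ?thesis using fv Cartan rs_zero by simp
    next
      case 4
      have "(\<lambda>t. \<alpha> t + (\<alpha> t + \<beta> t)) \<notin> weights"
      proof (cases "(\<lambda>t. \<alpha> t + \<beta> t) \<in> P")
        case True
        from low'[OF this] sym[OF 4(1)] show ?thesis by (simp add: weights_def)
      next
        case False
        then show ?thesis using up[OF 4(2)] by simp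
      qed
      then have "br f (br f v) = 0"
        using rs_trivial[OF _ _ rs_br[OF f fv]] out outb by simp
      then show ?thesis by (intro exI[of _ 0]) simp
    qed
    then show "v \<in> {v. \<exists>c. br f (br f v) = sc c f}" by simp
  qed
  then show ?thesis by simp
qed

end

context fd_simple_lie_algebra
begin

lemma minimal_nilpotent_properties:
  assumes "minimal_nilpotent sc br f" and tr: "sl2_triple sc br e x f"
  shows "f \<noteq> 0" "\<exists>c d. killing c d \<noteq> 0" "\<exists>c. br f (br f v) = sc c f"
proof -
  obtain h P \<alpha> where h: "cartan_subalgebra sc br h"
    and P: "positive_system (roots sc br h) P" "lowest_root (roots sc br h) P \<alpha>"
    and f: "f \<in> root_space sc br h \<alpha>" "f \<noteq> 0"
    using assms(1) unfolding minimal_nilpotent_def by blast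
  interpret rooted_lie_algebra sc br h by unfold_locales (rule h)
  show "f \<noteq> 0" by (rule f(2))
  have "\<alpha> \<in> R" using P(2) by (simp add: lowest_root_def)
  then obtain e' x' where "sl2_triple sc br e' x' f" "x' \<in> h" using triple_in_root_spaces[OF tr f(1)] by blast
  then have k: "killing x' x' \<noteq> 0" using killing_nontrivial f(2) by blast
  then show "\<exists>c d. killing c d \<noteq> 0" by blast
  show "\<exists>c. br f (br f v) = sc c f" by (rule lowest_root_ad_square[OF P f(1) k])
qed

end

section \<open>The grading of a minimal triple\<close>

text \<open>From here on minimality of \<open>f\<close> is seen through \<open>ad_f_square\<close>
  and the non-zero Killing form; the Cartan subalgebra has disappeared.\<close>

locale minimal_triple = fd_simple_lie_algebra sc br
  for sc :: "'k::field_char_0 \<Rightarrow> 'g::ab_group_add \<Rightarrow> 'g" and br +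
  fixes e x f :: 'g
  assumes triple: "sl2_triple sc br e x f" and f_nz: "f \<noteq> 0"
    and ad_f_square: "\<exists>c. br f (br f v) = sc c f"
    and killing_nz: "\<exists>c d. killing c d \<noteq> 0"
begin

abbreviation "G \<equiv> grade sc br x"
abbreviation "V \<equiv> G (1/2)"
abbreviation "L \<equiv> grade0_centralizer sc br x f"

lemma triple_simps [simp]:
  "br e f = sc 2 x" "br f e = - sc 2 x" "br x e = e" "br e x = - e" "br x f = - f" "br f x = f"
  using triple br_anti[of f e] br_anti[of e x] br_anti[of f x] by (auto simp: sl2_triple_def)

lemma x_nz: "x \<noteq> 0" and e_nz: "e \<noteq> 0"
proof -
  show "x \<noteq> 0" using f_nz triple_simps(6) by force
  then show "e \<noteq> 0" using triple_simps(1) by force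
qed

lemma subspace_G: "subspace (G c)"
  unfolding grade_def by (rule subspace_eigenspace)

lemma G_elems: "e \<in> G 1" "f \<in> G (- 1)" "x \<in> G 0"
  by (simp_all add: in_grade br_self)

lemma grade_disjoint:
  assumes "c \<notin> D" "v \<in> G c" "v \<in> span (\<Union>d\<in>D. G d)"
  shows "v = 0"
proof -
  obtain J u where J: "finite J" "J \<subseteq> D" "\<forall>d\<in>J. u d \<in> G d" "v = sum u J"
    using span_family_decomp[OF subspace_G assms(3)] by blast
  have c: "c \<notin> J" using J(2) assms(1) by blast
  \<comment> \<open>The relation \<open>sum u J - v = 0\<close> is read as a single family of
    eigenvectors, with \<open>- v\<close> at the new index \<open>c\<close>.\<close>
  have "(u(c := - v)) c \<in> {0}"
  proof (rule weight_components[where T = "{x}" and A = br and I = "insert c J" and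
        w = "\<lambda>d _. d" and W = "{0}" and v = "u(c := - v)" and i = c])
    show "sum (u(c := - v)) (insert c J) \<in> {0}"
    proof -
      have "sum (u(c := - v)) J = sum u J" using c by (intro sum.cong) auto
      then show ?thesis using J(1,4) c by simp
    qed
  qed (use J assms(2) c linear_ad in \<open>auto simp: in_grade\<close>)
  then show ?thesis by simp
qed

text \<open>On a sum of eigenspaces with eigenvalues other than \<open>c\<close>, the map
  \<open>ad x - c\<close> is invertible. Hence \<open>v\<close> differs from a vector
  \<open>w\<close> of that sum by an eigenvector for \<open>c\<close>. Used repeatedly, this strips
  linear factors off a polynomial identity in \<open>ad x\<close>.\<close>

lemma resolvent:
  assumes "c \<notin> D" "br x v - sc c v \<in> span (\<Union>d\<in>D. G d)"
  shows "v \<in> span (\<Union>d\<in>insert c D. G d)"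
proof -
  obtain J u where J: "finite J" "J \<subseteq> D" "\<forall>d\<in>J. u d \<in> G d" "br x v - sc c v = sum u J"
    using span_family_decomp[OF subspace_G assms(2)] by blast
  define w where "w = (\<Sum>d\<in>J. sc (1 / (d - c)) (u d))"
  have "br x w - sc c w = (\<Sum>d\<in>J. sc (1 / (d - c)) (sc d (u d)) - sc c (sc (1 / (d - c)) (u d)))"
    unfolding w_def using J(3)
    by (simp add: br_sum_right scale_sum_right br_lin in_grade sum_subtractf del: scale_scale)
  also have "\<dots> = sum u J"
  proof (intro sum.cong refl)
    fix d assume "d \<in> J"
    then have "d \<noteq> c" using J(2) assms(1) by auto
    then have "1 / (d - c) * d - c * (1 / (d - c)) = 1"
      using diff_divide_distrib[of d c "d - c"] by simp
    then show "sc (1 / (d - c)) (sc d (u d)) - sc c (sc (1 / (d - c)) (u d)) = u d"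
      by (simp flip: scale_left_diff_distrib)
  qed
  finally have "br x (v - w) = sc c (v - w)"
    using J(4) by (simp add: br_lin scale_right_diff_distrib algebra_simps)
  then have "v - w \<in> span (\<Union>d\<in>insert c D. G d)" by (intro span_base) (auto simp: in_grade)
  moreover have "w \<in> span (\<Union>d\<in>insert c D. G d)"
    unfolding w_def using J(2,3) by (intro span_sum span_scale span_base) auto
  ultimately show ?thesis using span_add[of "v - w" _ w] by simp
qed

text \<open>Evaluate \<open>ad_f_square\<close> at \<open>[e,v]\<close> and move \<open>f\<close>
  past \<open>e\<close>: the result is \<open>-4 [f, (ad x - 1/2) v]\<close>.\<close>

lemma ker_square:
  assumes "br f (br f v) = 0"
  shows "\<exists>c. br f (br x v - sc (1/2) v) = sc c f"
proof -
  obtain c where c: "br f (br f (br e v)) = sc c f" using ad_f_square by blast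
  have xf: "br x (br f v) = br f (br x v) - br f v"
    using leibniz[of f x v] by simp
  have "br f (br e v) = br e (br f v) - sc 2 (br x v)"
    using leibniz[of f e v] by (simp add: br_lin)
  moreover have "br f (br e (br f v)) = - sc 2 (br x (br f v))"
    using leibniz[of f e "br f v"] assms by (simp add: br_lin)
  ultimately have "sc c f = - sc 2 (br x (br f v)) - sc 2 (br f (br x v))"
    using c by (simp add: br_lin)
  also have "\<dots> = - sc 4 (br f (br x v)) + sc 2 (br f v)"
    unfolding xf using scale_left_distrib[of 2 2 "br f (br x v)"]
    by (simp add: scale_right_diff_distrib algebra_simps)
  finally have "sc (- 1/4) (sc c f) = sc (- 1/4) (- sc 4 (br f (br x v)) + sc 2 (br f v))" by simp
  also have "\<dots> = br f (br x v - sc (1/2) v)"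
    by (simp add: scale_right_distrib scale_right_diff_distrib br_lin)
  finally show ?thesis by (intro exI[of _ "- 1/4 * c"]) simp
qed

text \<open>If \<open>f\<close> kills \<open>v\<close>, then \<open>(ad f)^2\<close> kills
  \<open>[e,v]\<close>, and \<open>ker_square\<close> applied to \<open>[e,v]\<close> becomes a
  quadratic relation for \<open>ad x\<close> on \<open>v\<close>.\<close>

lemma ker_eq:
  assumes "br f v = 0"
  shows "\<exists>c. br x (br x v + sc (1/2) v) = sc c f"
proof -
  have fe: "br f (br e v) = - sc 2 (br x v)"
    using leibniz[of f e v] assms by (simp add: br_lin)
  have fx: "br f (br x v) = 0" using leibniz[of f x v] assms by simp
  have "br f (br f (br e v)) = 0" by (simp add: fe br_lin fx)
  from ker_square[OF this] obtain c where
    c: "br f (br x (br e v) - sc (1/2) (br e v)) = sc c f" by blast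
  have "br f (br x (br e v)) = - sc 2 (br x v) - sc 2 (br x (br x v))"
    using leibniz[of f x "br e v"] by (simp add: fe br_lin)
  then have "sc c f = - sc 2 (br x v) - sc 2 (br x (br x v)) + br x v"
    using c by (simp add: br_lin fe)
  then have "sc (- 1/2) (sc c f) = sc (- 1/2) (- sc 2 (br x v) - sc 2 (br x (br x v)) + br x v)"
    by simp
  also have "\<dots> = (br x v - sc (1/2) (br x v)) + br x (br x v)"
    by (simp add: scale_right_distrib scale_right_diff_distrib)
  also have "br x v - sc (1/2) (br x v) = sc (1/2) (br x v)"
    using scale_left_diff_distrib[of 1 "1/2" "br x v"] by simp
  finally show ?thesis by (intro exI[of _ "- 1/2 * c"]) (simp add: br_lin add.commute)
qed

lemma ker_span: "br f v = 0 \<Longrightarrow> v \<in> span (\<Union>d\<in>{-1/2, 0, -1}. G d)"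
proof -
  assume "br f v = 0"
  from ker_eq[OF this] obtain c where c: "br x (br x v + sc (1/2) v) = sc c f" by blast
  have "br x v + sc (1/2) v \<in> span (\<Union>d\<in>{0, -1}. G d)"
  proof (rule resolvent)
    show "br x (br x v + sc (1/2) v) - sc 0 (br x v + sc (1/2) v) \<in> span (\<Union>d\<in>{-1}. G d)"
      using G_elems(2) by (simp add: c span_scale span_base)
  qed simp
  then show ?thesis using resolvent[of "-1/2" "{0, -1}" v] by simp
qed

text \<open>Since \<open>[f,x] = f\<close>, subtracting \<open>c x\<close> from
  \<open>(ad x - 1/2) v\<close> brings it into the kernel of \<open>ad f\<close>; then
  \<open>ker_span\<close> and one more factor apply.\<close>

lemma ker_square_span: "br f (br f v) = 0 \<Longrightarrow> v \<in> span (\<Union>d\<in>{1/2, -1/2, 0, -1}. G d)"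
proof -
  assume "br f (br f v) = 0"
  from ker_square[OF this] obtain c where c: "br f (br x v - sc (1/2) v) = sc c f" by blast
  have "br f (br x v - sc (1/2) v - sc c x) = 0"
    using c by (simp add: br_lin)
  then have "br x v - sc (1/2) v - sc c x \<in> span (\<Union>d\<in>{-1/2, 0, -1}. G d)" by (rule ker_span)
  moreover have "sc c x \<in> span (\<Union>d\<in>{-1/2, 0, -1}. G d)"
    using G_elems(3) by (intro span_scale span_base) auto
  ultimately have "br x v - sc (1/2) v \<in> span (\<Union>d\<in>{-1/2, 0, -1}. G d)"
    using span_add by fastforce
  then show ?thesis using resolvent[of "1/2" "{-1/2, 0, -1}" v] by simp
qed

lemma into_ker_square: "\<exists>c. br f (br f (v + sc c e)) = 0"
proof -
  obtain c where c: "br f (br f v) = sc c f" using ad_f_square by blast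
  have "br f (br f (v + sc (c/2) e)) = 0"
    by (simp add: br_lin c)
  then show ?thesis by blast
qed

lemma span_grades: "span (\<Union>d\<in>{1, 1/2, -1/2, 0, -1}. G d) = UNIV"
proof -
  have "v \<in> span (\<Union>d\<in>{1, 1/2, -1/2, 0, -1}. G d)" for v
  proof -
    obtain c where "br f (br f (v + sc c e)) = 0" using into_ker_square by blast
    from ker_square_span[OF this] have "v + sc c e \<in> span (\<Union>d\<in>{1, 1/2, -1/2, 0, -1}. G d)"
      by (rule rev_subsetD) (intro span_mono, auto)
    moreover have "sc c e \<in> span (\<Union>d\<in>{1, 1/2, -1/2, 0, -1}. G d)"
      using G_elems(1) by (intro span_scale span_base) auto
    ultimately show ?thesis using span_add_eq2 by blast
  qed
  then show ?thesis by blast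
qed

lemma grade_trivial: "v \<in> G c \<Longrightarrow> c \<notin> {1, 1/2, -1/2, 0, -1} \<Longrightarrow> v = 0"
  by (rule grade_disjoint[where D = "{1, 1/2, -1/2, 0, -1}"]) (simp_all only: span_grades UNIV_I not_False_eq_True)

text \<open>A multiple of \<open>e\<close> moves \<open>v\<close> into the kernel of
  \<open>(ad f)^2\<close>, where the eigenvalue 1 does not occur.\<close>

lemma grade_1: "v \<in> G 1 \<Longrightarrow> \<exists>c. v = sc c e"
proof -
  assume v: "v \<in> G 1"
  obtain c where c: "br f (br f (v + sc c e)) = 0" using into_ker_square by blast
  have "v + sc c e = 0"
  proof (rule grade_disjoint[where c = 1 and D = "{1/2, -1/2, 0, -1}"])
    show "v + sc c e \<in> G 1"
      using v G_elems(1) by (intro subspace_add subspace_scale subspace_G)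
    show "v + sc c e \<in> span (\<Union>d\<in>{1/2, -1/2, 0, -1}. G d)" by (rule ker_square_span[OF c])
  qed (simp add: minus_equation_iff eq_commute[of 1])
  then have "v = sc (- c) e" by (simp add: eq_neg_iff_add_eq_0)
  then show ?thesis ..
qed

text \<open>On this eigenspace \<open>ad x (ad x + 1/2)\<close> is the scalar 1/2, so
  \<open>ker_eq\<close> makes \<open>v\<close> a multiple of \<open>f\<close>.\<close>

lemma grade_f: "v \<in> G (-1) \<Longrightarrow> \<exists>c. v = sc c f"
proof -
  assume v: "v \<in> G (-1)"
  have "br f v \<in> G (-1 + -1)" by (rule grade_br[OF G_elems(2) v])
  then have "br f v = 0" by (rule grade_trivial) simp
  from ker_eq[OF this] obtain c where c: "br x (br x v + sc (1/2) v) = sc c f" by blast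
  have xv: "br x v = - v" using v by (simp add: in_grade)
  have "v - sc (1/2) v = sc c f" using c by (simp add: br_lin xv)
  moreover have "v - sc (1/2) v = sc (1/2) v"
    using scale_left_diff_distrib[of 1 "1/2" v] by simp
  ultimately have "sc 2 (sc (1/2) v) = sc 2 (sc c f)" by simp
  then show ?thesis by (intro exI[of _ "2 * c"]) simp
qed

lemma in_L: "y \<in> L \<longleftrightarrow> br x y = 0 \<and> br f y = 0"
  by (simp add: grade0_centralizer_def in_grade)

lemma subspace_L: "subspace L"
  by (rule subspaceI) (auto simp: in_L br_lin)

lemma L_br: "y \<in> L \<Longrightarrow> z \<in> L \<Longrightarrow> br y z \<in> L"
  by (simp add: in_L leibniz[of _ y])

lemma grade_0: "y \<in> G 0 \<Longrightarrow> \<exists>c. y - sc c x \<in> L"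
proof -
  assume y: "y \<in> G 0"
  have "br f y \<in> G (-1 + 0)" by (rule grade_br[OF G_elems(2) y])
  then obtain c where "br f y = sc c f" using grade_f by auto
  then show ?thesis using y by (intro exI[of _ c]) (simp add: in_L in_grade br_lin br_self)
qed

text \<open>The centralizer of \<open>f\<close> in \<open>g_0\<close> also centralizes
  \<open>e\<close>: \<open>[y,e] = c e\<close> by grading, and bracketing with \<open>f\<close>
  gives \<open>c x = 0\<close>.\<close>

lemma L_simps:
  assumes "y \<in> L"
  shows "br y x = 0" "br x y = 0" "br y f = 0" "br f y = 0" "br y e = 0" "br e y = 0"
proof -
  show 1: "br x y = 0" "br f y = 0" using assms by (simp_all add: in_L)
  then show 2: "br y x = 0" "br y f = 0" using br_anti[of y] by simp_all
  have "br y e \<in> G (0 + 1)" using 1 by (intro grade_br G_elems) (simp add: in_grade)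
  then obtain c where c: "br y e = sc c e" using grade_1 by auto
  have "br f (br y e) = 0" using leibniz[of f y e] by (simp add: 1 2 br_lin)
  then have "c = 0" using x_nz by (simp add: c br_lin)
  then show "br y e = 0" using c by simp
  then show "br e y = 0" using br_anti[of e y] by simp
qed

lemma L_V: "y \<in> L \<Longrightarrow> v \<in> V \<Longrightarrow> br y v \<in> V"
  using grade_br[of y x 0 v "1/2"] by (simp add: in_L in_grade)

lemma fV: "v \<in> V \<Longrightarrow> br f v \<in> G (-1/2)"
  using grade_br[OF G_elems(2), of v "1/2"] by simp

lemma e_f_V: "v \<in> V \<Longrightarrow> br e (br f v) = v"
proof -
  assume v: "v \<in> V"
  have "br e v \<in> G (1 + 1/2)" by (rule grade_br[OF G_elems(1) v])
  then have "br e v = 0" by (rule grade_trivial) simp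
  then show ?thesis using leibniz[of e f v] v by (simp add: br_lin in_grade)
qed

lemma e_V: "v \<in> V \<Longrightarrow> br e v = 0"
  using grade_br[OF G_elems(1), of v "1/2"] by (intro grade_trivial[of _ "3/2"]) simp_all

lemma f_neg: "v \<in> G (-1/2) \<Longrightarrow> br f v = 0"
  using grade_br[OF G_elems(2), of v "-1/2"] by (intro grade_trivial[of _ "-3/2"]) (simp_all add: minus_equation_iff)

text \<open>Together with \<open>fV\<close> and \<open>e_f_V\<close>: \<open>ad e\<close> and
  \<open>ad f\<close> are inverse bijections between \<open>g_-1/2\<close> and \<open>V\<close>, so
  everything in degree -1/2 can be parametrized by \<open>V\<close>.\<close>

lemma neg_eq: "v \<in> G (-1/2) \<Longrightarrow> br e v \<in> V \<and> br f (br e v) = v"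
  using grade_br[OF G_elems(1), of v "-1/2"] leibniz[of f e v] f_neg[of v]
  by (simp add: br_lin in_grade)

section \<open>The quartic invariant\<close>

lemma quartic_scalar: "s \<in> V \<Longrightarrow> \<exists>c. br s (br s (br s (br s f))) = sc c e"
proof -
  assume s: "s \<in> V"
  have "br s (br s (br s (br s f))) \<in> G (1/2 + (1/2 + (1/2 + (1/2 + -1))))"
    by (intro grade_br s G_elems)
  then show ?thesis using grade_1 by simp
qed

text \<open>The string \<open>f, f1, f2, f3, [s,f3]\<close> is climbed down by \<open>s'\<close>.
  The coefficients 2, 3, 3, 2 are \<open>k (5 - k) / 2\<close>, those of the five-dimensional
  representation, halved because \<open>[s,s'] = 2x\<close> while the standard normalization would
  be \<open>4x\<close>. None is zero, so a vanishing top would propagate down to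
  \<open>f\<close>.\<close>

lemma embeddable_quartic:
  assumes "s \<in> embeddable sc br x"
  shows "br s (br s (br s (br s f))) \<noteq> 0"
proof
  obtain s' where s: "s \<in> V" and s': "s' \<in> G (-1/2)" "br s s' = sc 2 x"
    using assms by (auto simp: embeddable_def)
  have s's: "br s' s = - sc 2 x" using s'(2) br_anti[of s' s] by simp
  define f1 where "f1 = br s f"
  define f2 where "f2 = br s f1"
  define f3 where "f3 = br s f2"
  have 0: "br s' f = 0" using f_neg[OF s'(1)] br_anti[of s' f] by simp
  have w1: "br x f1 = sc (- 1/2) f1"
    using grade_br[OF s G_elems(2)] unfolding f1_def by (simp add: in_grade)
  have w2: "br x f2 = 0"
    using grade_br[OF s, of f1 "- 1/2"] w1 unfolding f2_def by (simp add: in_grade)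
  have w3: "br x f3 = sc (1/2) f3"
    using grade_br[OF s, of f2 0] w2 unfolding f3_def by (simp add: in_grade)
  have step: "br s' (br s u) = br s (br s' u) - sc 2 (br x u)" for u
    using leibniz[of s' s u] by (simp add: s's br_lin)
  have 1: "br s' f1 = sc 2 f" unfolding f1_def step by (simp add: 0)
  have "br s' f2 = sc 2 f1 + f1"
    unfolding f2_def step by (simp add: 1 w1 br_lin) (simp add: f1_def)
  then have 2: "br s' f2 = sc 3 f1" using scale_left_distrib[of 2 1 f1] by simp
  have 3: "br s' f3 = sc 3 f2" unfolding f3_def step by (simp add: 2 w2 br_lin) (simp add: f2_def)
  have "br s' (br s f3) = sc 3 f3 - f3"
    unfolding step by (simp add: 3 w3 br_lin) (simp add: f3_def)
  then have 4: "br s' (br s f3) = sc 2 f3" using scale_left_diff_distrib[of 3 1 f3] by simp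
  assume "br s (br s (br s (br s f))) = 0"
  then have "br s f3 = 0" by (simp add: f3_def f2_def f1_def)
  then have "f3 = 0" using 4 by simp
  then have "f2 = 0" using 3 by simp
  then have "f1 = 0" using 2 by simp
  then show False using 1 f_nz by simp
qed

text \<open>With \<open>u = (ad s)^3 f\<close>, the Leibniz rule splits \<open>[f,[s,u]]\<close>
  into \<open>[[f,s],u]\<close> and \<open>[s,[f,u]]\<close>. These two agree because
  \<open>f\<close> commutes with \<open>m = (ad s)^2 f\<close>. As
  \<open>[f,[s,u]] = q [f,e] = -2q x\<close>, each equals \<open>-q x\<close>, whence the factor
  \<open>-2/q\<close> of the partner.\<close>

lemma quartic_embeddable:
  assumes s: "s \<in> V" and "br s (br s (br s (br s f))) \<noteq> 0"
  shows "s \<in> embeddable sc br x"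
proof -
  obtain q where q: "br s (br s (br s (br s f))) = sc q e" using quartic_scalar[OF s] by blast
  have qnz: "q \<noteq> 0" using q assms(2) by auto
  define m where "m = br s (br s f)"
  define u where "u = br s m"
  have sf: "br s f = - br f s" by (rule br_anti)
  have "br f m = 0"
  proof -
    have "br f (br s f) = 0" unfolding sf using f_neg[OF fV[OF s]] by simp
    then show ?thesis unfolding m_def leibniz[of f s] sf by (simp add: br_self)
  qed
  have "br f u = br (br f s) m" unfolding u_def leibniz[of f s m] by (simp add: \<open>br f m = 0\<close>)
  then have "br s (br f u) = br (br s (br f s)) m + br (br f s) u"
    by (simp add: leibniz[of s "br f s" m] u_def)
  also have "br s (br f s) = - m" unfolding m_def sf by simp
  finally have 1: "br s (br f u) = br (br f s) u" by (simp add: br_self)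
  have "br f (br s u) = - sc (2 * q) x" 
    using q unfolding u_def m_def by (simp add: br_lin)
  then have "sc 2 (br s (br f u)) = - sc (2 * q) x"
    using leibniz[of f s u] 1 scale_left_distrib[of 1 1 "br s (br f u)"] by simp
  then have "sc (1/2) (sc 2 (br s (br f u))) = sc (1/2) (- sc (2 * q) x)" by simp
  then have 2: "br s (br f u) = - sc q x" by simp
  have "u \<in> G (1/2 + (1/2 + (1/2 + -1)))" unfolding u_def m_def by (intro grade_br s G_elems)
  then have "br f u \<in> G (-1/2)" using fV by simp
  then have "sc (- 2 / q) (br f u) \<in> G (-1/2)" by (rule subspace_scale[OF subspace_G])
  moreover have "br s (sc (- 2 / q) (br f u)) = sc 2 x" using qnz by (simp add: br_lin 2)
  ultimately show ?thesis using s unfolding embeddable_def by blast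
qed

lemma embeddable_iff:
  "s \<in> embeddable sc br x \<longleftrightarrow> s \<in> V \<and> br s (br s (br s (br s f))) \<noteq> 0"
  using embeddable_quartic quartic_embeddable by (auto simp: embeddable_def)

text \<open>First \<open>u = [y,s]\<close> is solved in \<open>g_0\<close>, then a multiple of
  \<open>x\<close> is removed to land in \<open>L\<close>; this costs a multiple of
  \<open>s\<close>.\<close>

lemma embeddable_tangent:
  assumes s: "s \<in> embeddable sc br x" and u: "u \<in> V"
  shows "\<exists>y\<in>L. \<exists>c. u = br y s + sc c s"
proof -
  obtain s' where sV: "s \<in> V" and s': "s' \<in> G (-1/2)" "br s s' = sc 2 x"
    using s by (auto simp: embeddable_def)
  have s's: "br s' s = - sc 2 x" using s'(2) br_anti[of s' s] by simp
  define z where "z = br s u"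
  have z: "br x z = z" using grade_br[OF sV u] unfolding z_def by (simp add: in_grade)
  have "br s z \<in> G (1/2 + 1)" unfolding z_def
    using grade_br[OF sV grade_br[OF sV u]] by simp
  then have sz: "br s z = 0" by (rule grade_trivial) simp
  have step: "br s (br s' w) = br s' (br s w) + sc 2 (br x w)" for w
    using leibniz[of s s' w] by (simp add: s'(2) br_lin add.commute)
  have xu: "br x u = sc (1/2) u" using u by (simp add: in_grade)
  have 1: "br s (br s' u) = br s' z + u" by (simp add: step z_def xu)
  have x1: "br x (br s' z) = sc (1/2) (br s' z)"
    using grade_br[OF s'(1), of z 1] z by (simp add: in_grade)
  have "br s (br s' (br s' z)) = br s' (sc 2 z) + br s' z"
    unfolding step[of "br s' z"] x1 by (simp add: step[of z] sz z)
  then have 2: "br s (br s' (br s' z)) = sc 3 (br s' z)"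
    using scale_left_distrib[of 2 1 "br s' z"] by (simp add: br_lin)
  \<comment> \<open>The equations \<open>1\<close> and \<open>2\<close> give
    \<open>[s,[s',u]] = [s',z] + u\<close> and \<open>[s,[s',[s',z]]] = 3 [s',z]\<close>. The
    combination cancels \<open>[s',z]\<close> and leaves \<open>[s,y] = - u\<close>.\<close>
  define y where "y = sc (1/3) (br s' (br s' z)) - br s' u"
  have ys: "br y s = u"
    using br_anti[of y s] by (simp add: y_def br_lin 1 2)
  have "br s' u \<in> G (-1/2 + 1/2)" "br s' (br s' z) \<in> G (-1/2 + (-1/2 + 1))"
    using z by (intro grade_br s' u; simp add: in_grade)+
  then have "y \<in> G 0" unfolding y_def
    by (intro subspace_diff subspace_scale subspace_G) simp_all
  then obtain c where c: "y - sc c x \<in> L" using grade_0 by blast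
  have "u = br (y - sc c x) s + sc (c / 2) s"
    using ys sV by (simp add: br_lin in_grade)
  then show ?thesis using c by blast
qed

section \<open>Vanishing of the quartic invariant\<close>

definition ecoord :: "'g \<Rightarrow> 'k" where
  "ecoord v = (let b = SOME b. representation Bas e b \<noteq> 0
    in representation Bas v b / representation Bas e b)"

lemma ecoord_lin: "ecoord (u + v) = ecoord u + ecoord v" "ecoord (sc r v) = r * ecoord v"
  by (simp_all add: ecoord_def Let_def rep_add rep_scale add_divide_distrib)

lemma ecoord_e: "ecoord (sc c e) = c"
proof -
  have "\<exists>b. representation Bas e b \<noteq> 0"
    using rep_eqI[of e 0] e_nz by (auto simp: representation_zero)
  from someI_ex[OF this] have "ecoord e = 1" by (simp add: ecoord_def Let_def)
  then show ?thesis by (simp add: ecoord_lin)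
qed

text \<open>On \<open>V\<close> this is the form with \<open>[a,b] = om a b e\<close>. Reading off
  the coefficient by the linear functional \<open>ecoord\<close>, which is defined everywhere, makes
  bilinearity and antisymmetry hold on all of \<open>g\<close>, without membership
  conditions.\<close>

definition om :: "'g \<Rightarrow> 'g \<Rightarrow> 'k" where
  "om a b = ecoord (br a b)"

lemma om_lin:
  "om (a + b) c = om a c + om b c" "om a (b + c) = om a b + om a c"
  "om (sc r a) b = r * om a b" "om a (sc r b) = r * om a b"
  by (simp_all add: om_def br_lin ecoord_lin)

lemma om_zero [simp]: "om 0 b = 0" "om a 0 = 0"
  using om_lin(3)[of 0 0 b] om_lin(4)[of a 0 0] by simp_all

lemma om_minus [simp]: "om (- a) b = - om a b" "om a (- b) = - om a b"
  using om_lin(3)[of "- 1" a b] om_lin(4)[of a "- 1" b] by simp_all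

lemma om_diff: "om (a - b) c = om a c - om b c" "om a (b - c) = om a b - om a c"
  using om_lin(1)[of a "- b" c] om_lin(2)[of a b "- c"] by simp_all

lemma om_anti: "om a b = - om b a"
proof -
  have "om a b = ecoord (sc (- 1) (br b a))" unfolding om_def by (subst br_anti) simp
  then show ?thesis unfolding ecoord_lin(2) om_def mult_minus1 .
qed

lemma om_self [simp]: "om a a = 0"
  by (simp add: om_def br_self ecoord_lin(2)[of 0 0, simplified])

lemma br_V: "a \<in> V \<Longrightarrow> b \<in> V \<Longrightarrow> br a b = sc (om a b) e"
  using grade_1[of "br a b"] grade_br[of a x "1/2" b "1/2"] by (auto simp: om_def ecoord_e)

lemma om_L: "y \<in> L \<Longrightarrow> a \<in> V \<Longrightarrow> b \<in> V \<Longrightarrow> om (br y a) b = - om a (br y b)"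
proof -
  assume y: "y \<in> L" and a: "a \<in> V" and b: "b \<in> V"
  have "sc (om (br y a) b + om a (br y b)) e = br (br y a) b + br a (br y b)"
    using y a b by (simp add: br_V L_V scale_left_distrib)
  also have "\<dots> = br y (br a b)" by (rule leibniz[symmetric])
  also have "\<dots> = 0" using y a b by (simp add: br_V br_lin L_simps)
  finally show ?thesis using e_nz by (simp add: eq_neg_iff_add_eq_0)
qed

lemma killing_grades: "a \<in> G i \<Longrightarrow> b \<in> G j \<Longrightarrow> i + j \<noteq> 0 \<Longrightarrow> killing a b = 0"
proof -
  assume "a \<in> G i" "b \<in> G j" "i + j \<noteq> 0"
  then have "(i + j) * killing a b = 0" 
    using killing_invariant[of x a b]
    by (simp add: in_grade killing_scale_left killing_scale_right algebra_simps)
  then show ?thesis using \<open>i + j \<noteq> 0\<close> by simp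
qed

text \<open>Only degree -1/2 can pair with \<open>V\<close> under the Killing form, and its elements
  are \<open>[f,b]\<close> with \<open>b\<close> in \<open>V\<close>. By invariance the pairing of
  \<open>a\<close> with \<open>[f,b]\<close> reduces to that of \<open>f\<close> with
  \<open>[a,b] = om a b e\<close>. So an element of the radical of \<open>om\<close> lies in the
  Killing radical.\<close>

lemma om_nondegenerate:
  assumes a: "a \<in> V" and "\<And>b. b \<in> V \<Longrightarrow> om a b = 0"
  shows "a = 0"
proof -
  have "b \<in> {b. killing a b = 0}" for b
  proof -
    have sub: "subspace {b. killing a b = 0}"
      by (rule subspaceI) (auto simp: killing_add_right killing_scale_right)
    have "killing a v = 0" if v: "v \<in> G (-1/2)" for v
    proof -
      let ?b = "br e v"
      have b: "?b \<in> V" "br f ?b = v" using neg_eq[OF v] by auto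
      have "killing (br a f) ?b = - killing f (br a ?b)"
        using killing_invariant[of a f ?b] by (simp add: eq_neg_iff_add_eq_0)
      also have "br a ?b = 0" using a b assms(2) by (simp add: br_V)
      finally have "killing (br f a) ?b = 0"
        using br_anti[of f a] killing_scale_left[of "-1" "br a f" ?b] by simp
      then show ?thesis using killing_invariant[of f a ?b] b(2) by simp
    qed
    moreover have "killing a v = 0" if "v \<in> G i" "i \<in> {1, 1/2, 0, -1}" for i v
    proof (rule killing_grades[OF a that(1)])
      show "1/2 + i \<noteq> 0" using that(2) by (elim insertE emptyE; hypsubst; simp)
    qed
    ultimately have "(\<Union>d\<in>{1, 1/2, -1/2, 0, -1}. G d) \<subseteq> {b. killing a b = 0}" by auto
    from span_minimal[OF this sub] show ?thesis using span_grades by auto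
  qed
  then show ?thesis using killing_nondegenerate killing_nz by blast
qed

text \<open>The polarized moment map of the action of \<open>L\<close> on the symplectic space \<open>V\<close>.\<close>

definition mom :: "'g \<Rightarrow> 'g \<Rightarrow> 'g" where
  "mom a b = br a (br f b) + sc (om a b) x"

lemma mom_lin:
  "mom (a + b) c = mom a c + mom b c" "mom a (b + c) = mom a b + mom a c"
  "mom (sc r a) b = sc r (mom a b)" "mom a (sc r b) = sc r (mom a b)"
  by (simp_all add: mom_def br_lin om_lin scale_left_distrib scale_right_distrib)

text \<open>The antisymmetric part of \<open>[a,[f,b]]\<close> is half of
  \<open>[f,[a,b]] = -2 om a b x\<close>, which the summand in \<open>x\<close> cancels. The same
  summand puts \<open>mom a b\<close> into the centralizer of \<open>f\<close> in
  \<open>mom_L\<close>.\<close>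

lemma mom_sym:
  assumes a: "a \<in> V" and b: "b \<in> V"
  shows "mom a b = mom b a"
proof -
  have "br a (br f b) - br b (br f a) = br f (br a b)"
    using leibniz[of f a b] br_anti[of "br f a" b] by simp
  also have "\<dots> = - sc (om a b) (sc 2 x)" using a b by (simp add: br_V br_lin)
  also have "\<dots> = sc (om b a) x - sc (om a b) x"
    unfolding scale_2 using om_anti[of b a] by (simp add: scale_right_distrib)
  finally show ?thesis unfolding mom_def by (simp add: algebra_simps)
qed

text \<open>Apply \<open>(ad f)^2\<close> to \<open>[a,b]\<close>. As it kills \<open>V\<close>,
  only twice the mixed term remains.\<close>

lemma br_f_f:
  assumes a: "a \<in> V" and b: "b \<in> V"
  shows "br (br f a) (br f b) = - sc (om a b) f"
proof -
  have "br f (br f (br a b)) = br (br f a) (br f b) + br (br f a) (br f b)"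
    using f_neg[OF fV[OF a]] f_neg[OF fV[OF b]] by (simp add: leibniz[of f a] leibniz[of f "br f a"]
        leibniz[of f a "br f b"] br_add_right)
  moreover have "br f (br f (br a b)) = sc 2 (- sc (om a b) f)"
    using a b by (simp add: br_V br_lin mult.commute)
  ultimately have "sc 2 (br (br f a) (br f b)) = sc 2 (- sc (om a b) f)" by (simp only: scale_2)
  then show ?thesis by (rule scale_left_imp_eq[rotated]) simp
qed

lemma mom_L:
  assumes a: "a \<in> V" and b: "b \<in> V"
  shows "mom a b \<in> L"
proof -
  have "br a (br f b) \<in> G (1/2 + -1/2)" by (intro grade_br a fV b)
  then have "br x (mom a b) = 0" by (simp add: mom_def in_grade br_lin br_self)
  moreover have "br f (mom a b) = 0"
    using f_neg[OF fV[OF b]] br_f_f[OF a b] by (simp add: mom_def br_lin leibniz[of f a])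
  ultimately show ?thesis by (simp add: in_L)
qed

text \<open>The Jacobi identity for \<open>a\<close>, \<open>b\<close> and \<open>[f,c]\<close>,
  rewritten in terms of \<open>mom\<close> and \<open>om\<close>.\<close>

lemma mom_exchange:
  assumes a: "a \<in> V" and b: "b \<in> V" and c: "c \<in> V"
  shows "br (mom b c) a = br (mom a c) b + sc (om b c / 2) a - sc (om a c / 2) b - sc (om a b) c"
proof -
  have D: "br b (br f c) = mom b c - sc (om b c) x" for b by (simp add: mom_def)
  have E: "br a (br b (br f c)) = - br (mom b c) a + sc (om b c / 2) a" if "a \<in> V" for a b
    using that br_anti[of a] unfolding D by (simp add: br_lin in_grade)
  have "br a (br b (br f c)) = br (br a b) (br f c) + br b (br a (br f c))" by (rule leibniz)
  also have "br (br a b) (br f c) = sc (om a b) c" using a b c by (simp add: br_V br_lin e_f_V)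
  finally show ?thesis unfolding E[OF a] E[OF b] by (simp add: algebra_simps)
qed

lemma quartic_eq: "s \<in> V \<Longrightarrow> br s (br s (br s (br s f))) = sc (om s (br (mom s s) s)) e"
proof -
  assume s: "s \<in> V"
  have "br s (br s f) = - mom s s" using br_anti[of s f] by (simp add: mom_def)
  then have "br s (br s (br s f)) = br (mom s s) s" using br_anti[of s "mom s s"] by simp
  then show ?thesis using br_V[OF s L_V[OF mom_L[OF s s] s]] by simp
qed

text \<open>This is the coefficient of \<open>k\<close> in the quartic at \<open>s + k u\<close>.
  The terms of degree 0 and 4 vanish by assumption, and three values of \<open>k\<close> eliminate
  those of degree 2 and 3.\<close>

lemma quartic_polarize:
  assumes q: "\<And>s. s \<in> V \<Longrightarrow> om s (br (mom s s) s) = 0" and s: "s \<in> V" and u: "u \<in> V"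
  shows "om u (br (mom s s) s) + om s (br (mom u s) s) + om s (br (mom s u) s) + om s (br (mom s s) u) = 0"
    (is "?A1 = 0")
proof -
  define A1 where "A1 = ?A1"
  define A2 where "A2 = om u (br (mom u s) s) + om u (br (mom s u) s) + om u (br (mom s s) u) +
      om s (br (mom u u) s) + om s (br (mom u s) u) + om s (br (mom s u) u)"
  define A3 where "A3 = om s (br (mom u u) u) + om u (br (mom s u) u) + om u (br (mom u s) u) +
      om u (br (mom u u) s)"
  have "k * A1 + k^2 * A2 + k^3 * A3 = 0" for k
  proof -
    have "s + sc k u \<in> V" using s u by (intro subspace_add subspace_scale subspace_G)
    from q[OF this] q[OF s] q[OF u] show ?thesis
      unfolding A1_def A2_def A3_def
      by (simp add: om_lin mom_lin br_lin algebra_simps power2_eq_square power3_eq_cube)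
  qed
  from this[of 1] this[of "-1"] this[of 2]
  have e: "A1 + A2 + A3 = 0" "- A1 + A2 - A3 = 0" "2 * A1 + 4 * A2 + 8 * A3 = 0" by simp_all
  have "6 * A1 = 6 * (A1 + A2 + A3) - 2 * (- A1 + A2 - A3) - (2 * A1 + 4 * A2 + 8 * A3)"
    by (simp add: algebra_simps)
  then have "6 * A1 = 0" unfolding e by simp
  then show "?A1 = 0" by (simp flip: A1_def)
qed

text \<open>All four terms of the polarized quartic equal \<open>om u [mom s s, s]\<close>, so
  nondegeneracy kills the cubic \<open>[mom s s, s]\<close>. Polarizing the cubic gives
  \<open>X + 2 Y = 0\<close>, while \<open>mom_exchange\<close> gives
  \<open>X = Y + 3/2 om s u s\<close>; eliminating \<open>Y\<close> determines
  \<open>X\<close>.\<close>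

lemma mom_transvection:
  assumes q: "\<And>s. s \<in> V \<Longrightarrow> om s (br (mom s s) s) = 0" and s: "s \<in> V" and u: "u \<in> V"
  shows "br (mom s s) u = sc (om s u) s"
proof -
  have cubic: "br (mom s s) s = 0" if s: "s \<in> V" for s
  proof (rule om_nondegenerate)
    show t: "br (mom s s) s \<in> V" by (rule L_V[OF mom_L[OF s s] s])
    fix u assume u: "u \<in> V"
    have 1: "om s (br (mom s s) u) = om u (br (mom s s) s)"
      using om_L[OF mom_L[OF s s] s u] om_anti[of u] by simp
    have 2: "om s (br (mom s u) s) = om u (br (mom s s) s)"
      using mom_exchange[OF s u s] mom_sym[OF s u] 1
      by (simp add: om_lin om_diff)
    have "4 * om u (br (mom s s) s) = 0"
      using quartic_polarize[OF q s u] mom_sym[OF s u] 1 2 by simp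
    then show "om (br (mom s s) s) u = 0" using om_anti[of "br (mom s s) s" u] by simp
  qed
  define X where "X = br (mom s s) u"
  define Y where "Y = br (mom s u) s"
  have XY: "X = Y + sc (3/2 * om s u) s"
    using mom_exchange[OF u s s] mom_sym[OF s u] om_anti[of u s]
      scale_left_distrib[of "om s u / 2" "om s u" s]
    by (simp add: X_def Y_def algebra_simps)
  have poly: "sc k (X + sc 2 Y) + sc (k^2) (sc 2 (br (mom s u) u) + br (mom u u) s) = 0" for k
  proof -
    have "s + sc k u \<in> V" using s u by (intro subspace_add subspace_scale subspace_G)
    from cubic[OF this] cubic[OF s] cubic[OF u] show ?thesis
      using mom_sym[OF s u] scale_left_distrib[of k k Y]
        scale_left_distrib[of "k^2" "k^2" "br (mom s u) u"]
      by (simp add: X_def Y_def mom_lin br_lin algebra_simps scale_right_distrib power2_eq_square)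
  qed
  define P where "P = X + sc 2 Y"
  define Q where "Q = sc 2 (br (mom s u) u) + br (mom u u) s"
  have "P + Q = 0" "- P + Q = 0"
    using poly[of 1] poly[of "-1"] unfolding P_def[symmetric] Q_def[symmetric] by simp_all
  then have "P = - P" by (metis add_eq_0_iff neg_equal_iff_equal)
  then have "sc 2 P = 0" unfolding scale_2 by (simp add: eq_neg_iff_add_eq_0)
  then have "X + sc 2 Y = 0" by (simp add: P_def)
  then have "sc 3 X = sc 3 (sc (om s u) s)"
    using scale_left_distrib[of 1 2 X] XY
    by (simp add: scale_right_distrib algebra_simps)
  then have "X = sc (om s u) s" by (rule scale_left_imp_eq[rotated]) simp
  then show ?thesis by (simp add: X_def)
qed

lemma mom_action:
  assumes q: "\<And>s. s \<in> V \<Longrightarrow> om s (br (mom s s) s) = 0"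
    and a: "a \<in> V" and b: "b \<in> V" and u: "u \<in> V"
  shows "br (mom a b) u = sc (om a u / 2) b + sc (om b u / 2) a"
proof -
  have ab: "a + b \<in> V" using a b by (intro subspace_add subspace_G)
  have "sc 2 (br (mom a b) u) = sc (om a u) b + sc (om b u) a"
    using mom_transvection[OF q ab u] mom_transvection[OF q a u] mom_transvection[OF q b u]
      mom_sym[OF a b] scale_left_distrib[of 1 1 "br (mom a b) u"]
    by (simp add: mom_lin br_lin om_lin scale_left_distrib scale_right_distrib algebra_simps)
  then have "sc (1/2) (sc 2 (br (mom a b) u)) = sc (1/2) (sc (om a u) b + sc (om b u) a)" by simp
  then show ?thesis by (simp add: scale_right_distrib)
qed

text \<open>The kernel of \<open>L\<close> on \<open>V\<close> is stable under each of the five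
  grades, hence an ideal, and it does not contain \<open>f\<close>.\<close>

lemma L_faithful:
  assumes y: "y \<in> L" and 0: "\<And>v. v \<in> V \<Longrightarrow> br y v = 0"
  shows "y = 0"
proof -
  let ?K = "{y\<in>L. \<forall>v\<in>V. br y v = 0}"
  have sub: "subspace ?K"
    by (rule subspaceI) (auto simp: br_lin intro: subspace_0 subspace_add subspace_scale subspace_L)
  have K: "br z y \<in> ?K" if y: "y \<in> ?K" for y z
  proof -
    have yL: "y \<in> L" and yV: "\<And>v. v \<in> V \<Longrightarrow> br y v = 0" using y by auto
    have "z \<in> {z. br z y \<in> ?K}" for z
    proof -
      have s2: "subspace {z. br z y \<in> ?K}"
        by (rule subspace_preimage[OF linear_br_left sub])
      have zero: "br z y \<in> ?K" if "br z y = 0" for z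
        unfolding that by (rule subspace_0[OF sub])
      have "br z y \<in> ?K" if z: "z \<in> G d" "d \<in> {1, 1/2, -1/2, 0, -1}" for d z
      proof -
        have zV: "br z y = 0" if "z \<in> V" for z using yV[OF that] br_anti[of z y] by simp
        consider "d = 1" | "d = 1/2" | "d = -1/2" | "d = 0" | "d = -1" using z(2) by auto
        then show ?thesis
        proof cases
          case 1
          then have "br z y = 0" using z(1) grade_1[of z] L_simps(6)[OF yL] by (auto simp: br_lin)
          then show ?thesis by (rule zero)
        next
          case 2
          then show ?thesis using zV z(1) by (intro zero) blast
        next
          case 3
          then have "z = br f (br e z)" "br e z \<in> V" using neg_eq z(1) by auto
          then have "br z y = br f (br (br e z) y) - br (br e z) (br f y)"
            using leibniz[of f "br e z" y] by simp
          then show ?thesis using zV[OF \<open>br e z \<in> V\<close>] L_simps(4)[OF yL] by (intro zero) simp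
        next
          case 4
          then obtain c where c: "z - sc c x \<in> L" using grade_0 z(1) by blast
          have "br z y = br (z - sc c x) y" using L_simps[OF yL] by (simp add: br_lin)
          moreover have "br (z - sc c x) y \<in> ?K"
          proof -
            have "br (br (z - sc c x) y) v = 0" if "v \<in> V" for v
              using leibniz[of "z - sc c x" y v] yV[OF that] yV[OF L_V[OF c that]] by simp
            then show ?thesis using L_br[OF c yL] by simp
          qed
          ultimately show ?thesis by simp
        next
          case 5
          then have "br z y = 0" using z(1) grade_f[of z] L_simps(4)[OF yL] by (auto simp: br_lin)
          then show ?thesis by (rule zero)
        qed
      qed
      then have "(\<Union>d\<in>{1, 1/2, -1/2, 0, -1}. G d) \<subseteq> {z. br z y \<in> ?K}" by auto
      from span_minimal[OF this s2] show ?thesis using span_grades by auto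
    qed
    then show ?thesis by simp
  qed
  have "lie_ideal sc br ?K" using sub K by (auto simp: lie_ideal_def)
  moreover have "f \<notin> ?K" using L_simps(2)[of f] f_nz by auto
  ultimately have "?K = {0}" using simple by blast
  then show ?thesis using y 0 by blast
qed

end

section \<open>Vanishing quartic: coordinates on \<open>g\<close> and the representation on
  \<open>W\<close>\<close>

locale flat_triple = minimal_triple sc br e x f
  for sc :: "'k::field_char_0 \<Rightarrow> 'g::ab_group_add \<Rightarrow> 'g" and br e x f +
  assumes flat: "\<And>s. s \<in> V \<Longrightarrow> br s (br s (br s (br s f))) = 0"
begin

text \<open>Coordinates with respect to \<open>g = F e + V + (F x + L) + [f, V] + F f\<close>, with the summands in this
  order and \<open>[f, V]\<close> parametrized by \<open>V\<close>.\<close>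

type_synonym ('a, 'b) comps = "'a \<times> 'b \<times> 'a \<times> 'b \<times> 'b \<times> 'a"

lemma flat_om: "s \<in> V \<Longrightarrow> om s (br (mom s s) s) = 0"
  using flat quartic_eq e_nz by simp

lemmas mom_act = mom_action[OF flat_om]

fun comb :: "('k, 'g) comps \<Rightarrow> 'g" where
  "comb (\<alpha>, a, \<beta>, m, b, \<gamma>) = sc \<alpha> e + a + sc \<beta> x + m + br f b + sc \<gamma> f"

fun valid :: "('k, 'g) comps \<Rightarrow> bool" where
  "valid (\<alpha>, a, \<beta>, m, b, \<gamma>) \<longleftrightarrow> a \<in> V \<and> m \<in> L \<and> b \<in> V"

fun smul :: "'k \<Rightarrow> ('k, 'g) comps \<Rightarrow> ('k, 'g) comps" where
  "smul c (\<alpha>, a, \<beta>, m, b, \<gamma>) = (c * \<alpha>, sc c a, c * \<beta>, sc c m, sc c b, c * \<gamma>)"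

lemmas V_closed = subspace_0[OF subspace_G] subspace_add[OF subspace_G] subspace_diff[OF subspace_G]
  subspace_scale[OF subspace_G] subspace_neg[OF subspace_G] L_V
lemmas L_closed = subspace_0[OF subspace_L] subspace_add[OF subspace_L] subspace_diff[OF subspace_L]
  subspace_scale[OF subspace_L] subspace_neg[OF subspace_L] mom_L L_br

lemma comb_add: "comb (s + t) = comb s + comb t"
  by (cases s; cases t) (simp add: scale_left_distrib br_lin algebra_simps)

lemma comb_smul: "comb (smul c t) = sc c (comb t)"
  by (cases t) (simp add: scale_right_distrib br_lin)

lemma valid_add: "valid s \<Longrightarrow> valid t \<Longrightarrow> valid (s + t)"
  by (cases s; cases t) (auto intro: V_closed L_closed)

lemma valid_smul: "valid t \<Longrightarrow> valid (smul c t)"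
  by (cases t) (auto intro: V_closed L_closed)

lemma comb_exists: "\<exists>t. valid t \<and> y = comb t"
proof -
  let ?S = "{y. \<exists>t. valid t \<and> y = comb t}"
  have "subspace ?S"
  proof (rule subspaceI)
    show "0 \<in> ?S" by (auto intro!: exI[of _ 0] V_closed L_closed simp: zero_prod_def)
    show "u + v \<in> ?S" if uv: "u \<in> ?S" "v \<in> ?S" for u v
    proof -
      obtain s t where "valid s" "u = comb s" "valid t" "v = comb t" using uv by blast
      then have "valid (s + t)" "u + v = comb (s + t)" by (simp_all only: valid_add comb_add)
      then show ?thesis by blast
    qed
    show "sc c u \<in> ?S" if u: "u \<in> ?S" for c u
    proof -
      obtain s where "valid s" "u = comb s" using u by blast
      then have "valid (smul c s)" "sc c u = comb (smul c s)" by (simp_all only: valid_smul comb_smul)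
      then show ?thesis by blast
    qed
  qed
  moreover have "y \<in> ?S" if y: "y \<in> G d" and d: "d \<in> {1, 1/2, -1/2, 0, -1}" for d y
  proof -
    note z = subspace_0[OF subspace_G] subspace_0[OF subspace_L]
    consider "y \<in> G 1" | "y \<in> V" | "y \<in> G (-1/2)" | "y \<in> G 0" | "y \<in> G (-1)" using y d by blast
    then show ?thesis
    proof cases
      case 1
      then obtain c where "y = sc c e" using grade_1 by blast
      then show ?thesis using z by (intro CollectI exI[of _ "(c, 0, 0, 0, 0, 0)"]) simp
    next
      case 2
      then show ?thesis using z by (intro CollectI exI[of _ "(0, y, 0, 0, 0, 0)"]) simp
    next
      case 3
      then show ?thesis using z neg_eq[OF 3] by (intro CollectI exI[of _ "(0, 0, 0, 0, br e y, 0)"]) simp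
    next
      case 4
      then obtain c where "y - sc c x \<in> L" using grade_0 by blast
      then show ?thesis using z by (intro CollectI exI[of _ "(0, 0, c, y - sc c x, 0, 0)"]) simp
    next
      case 5
      then obtain c where "y = sc c f" using grade_f by blast
      then show ?thesis using z by (intro CollectI exI[of _ "(0, 0, 0, 0, 0, c)"]) simp
    qed
  qed
  then have "(\<Union>d\<in>{1, 1/2, -1/2, 0, -1}. G d) \<subseteq> ?S" by blast
  ultimately have "span (\<Union>d\<in>{1, 1/2, -1/2, 0, -1}. G d) \<subseteq> ?S" by (intro span_minimal)
  then show ?thesis unfolding span_grades by blast
qed

text \<open>The components are read off one after another: \<open>(ad f)^2\<close> sees only
  \<alpha>, \<open>(ad e)^2\<close> only \<gamma>, then \<open>ad e\<close> isolates
  \<open>b\<close> and \<beta>, and \<open>ad x\<close> separates \<open>a\<close> from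
  \<open>m\<close>.\<close>

lemma comb_zero: "valid t \<Longrightarrow> comb t = 0 \<Longrightarrow> t = 0"
proof -
  assume v: "valid t" and 0: "comb t = 0"
  obtain \<alpha> a \<beta> m b \<gamma> where t: "t = (\<alpha>, a, \<beta>, m, b, \<gamma>)" by (cases t)
  have a: "a \<in> V" and m: "m \<in> L" and b: "b \<in> V" using v t by auto
  have f2: "br f (br f u) = 0" "br e (br f u) = u" "br e u = 0" if "u \<in> V" for u
    using that f_neg[OF fV] e_f_V e_V by auto
  have "br f (br f (comb t)) = sc (- 2 * \<alpha>) f"
    using L_simps[OF m] f2[OF a] f2[OF b] by (simp add: t br_lin br_self)
  then have \<alpha>: "\<alpha> = 0" using 0 f_nz by simp
  have "br e (br e (comb t)) = sc (- 2 * \<gamma>) e"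
    using L_simps[OF m] f2[OF a] f2[OF b] by (simp add: t br_lin br_self)
  then have \<gamma>: "\<gamma> = 0" using 0 e_nz by simp
  have 1: "br e (comb t) = b - sc \<beta> e"
    using L_simps[OF m] f2[OF a] f2[OF b] by (simp add: t br_lin br_self \<gamma>)
  then have "br x (b - sc \<beta> e) = 0" using 0 by simp
  then have "sc (1/2) b = b" using b 1 0 by (simp add: br_lin in_grade)
  then have "sc (1/2) b = sc 1 b" by simp
  then have b: "b = 0" unfolding scale_cancel_right by simp
  have \<beta>: "\<beta> = 0" using 1 0 e_nz by (simp add: b)
  have am: "a + m = 0" using 0 by (simp add: t \<alpha> \<beta> b \<gamma>)
  then have "br x (a + m) = 0" by simp
  then have "sc (1/2) a = 0" using a L_simps[OF m] by (simp add: br_lin in_grade)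
  then show ?thesis using am by (simp add: t \<alpha> \<beta> b \<gamma> zero_prod_def)
qed

lemma comb_inj: "valid s \<Longrightarrow> valid t \<Longrightarrow> comb s = comb t \<Longrightarrow> s = t"
proof -
  assume s: "valid s" and t: "valid t" and eq: "comb s = comb t"
  have "comb (s + smul (- 1) t) = 0" by (simp only: comb_add comb_smul) (simp add: eq)
  from comb_zero[OF valid_add[OF s valid_smul[OF t]] this] show ?thesis
    by (cases s; cases t) (simp add: zero_prod_def)
qed

definition dec :: "'g \<Rightarrow> ('k, 'g) comps" where
  "dec y = (SOME t. valid t \<and> y = comb t)"

lemma dec: "valid (dec y)" "comb (dec y) = y"
  using someI_ex[OF comb_exists[of y]] by (auto simp: dec_def)

lemma dec_comb: "valid t \<Longrightarrow> dec (comb t) = t"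
  using comb_inj dec by blast

lemma dec_add: "dec (y + z) = dec y + dec z"
  using dec_comb[OF valid_add[OF dec(1) dec(1)], of y z] by (simp add: comb_add dec)

lemma dec_smul: "dec (sc c y) = smul c (dec y)"
  using dec_comb[OF valid_smul[OF dec(1)], of c y] by (simp add: comb_smul dec)

fun brt :: "('k, 'g) comps \<Rightarrow> ('k, 'g) comps \<Rightarrow> ('k, 'g) comps" where
  "brt (\<alpha>, a, \<beta>, m, b, \<gamma>) (\<alpha>', a', \<beta>', m', b', \<gamma>') =
    (\<beta> * \<alpha>' - \<alpha> * \<beta>' + om a a',
     sc \<alpha> b' - sc \<alpha>' b + sc (\<beta> / 2) a' - sc (\<beta>' / 2) a + br m a' - br m' a,
     2 * \<alpha> * \<gamma>' - 2 * \<alpha>' * \<gamma> - om a b' + om a' b,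
     mom a b' - mom a' b + br m m',
     sc \<gamma> a' - sc \<gamma>' a - sc (\<beta> / 2) b' + sc (\<beta>' / 2) b + br m b' - br m' b,
     \<beta>' * \<gamma> - \<beta> * \<gamma>' - om b b')"

lemma valid_brt: "valid s \<Longrightarrow> valid t \<Longrightarrow> valid (brt s t)"
  by (cases s; cases t) (auto intro!: V_closed L_closed)

lemma br_comb:
  assumes "valid s" "valid t"
  shows "br (comb s) (comb t) = comb (brt s t)"
proof -
  obtain \<alpha> a \<beta> m b \<gamma> where s: "s = (\<alpha>, a, \<beta>, m, b, \<gamma>)" by (cases s)
  obtain \<alpha>' a' \<beta>' m' b' \<gamma>' where t: "t = (\<alpha>', a', \<beta>', m', b', \<gamma>')" by (cases t)
  have V: "a \<in> V" "b \<in> V" "m \<in> L" "a' \<in> V" "b' \<in> V" "m' \<in> L" using assms s t by auto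
  have D: "br u (br f v) = mom u v - sc (om u v) x" for u v by (simp add: mom_def)
  have D': "br (br f v) u = sc (om u v) x - mom u v" for u v using D[of u v] br_anti[of u] by (simp add: algebra_simps)
  have g1: "br x u = sc (1/2) u" "br u x = - sc (1/2) u" "br e u = 0" "br u e = 0"
      "br e (br f u) = u" "br (br f u) e = - u" "br f (br f u) = 0" "br (br f u) f = 0"
      "br x (br f u) = - sc (1/2) (br f u)" "br (br f u) x = sc (1/2) (br f u)" "br u f = - br f u"
    if u: "u \<in> V" for u
    using u e_V[OF u] e_f_V[OF u] f_neg[OF fV[OF u]] fV[OF u]
      br_anti[of u x] br_anti[of u e] br_anti[of "br f u" e] br_anti[of "br f u" f] br_anti[of "br f u" x]
      br_anti[of u f]
    by (simp_all add: in_grade)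
  have g2: "br y (br f u) = br f (br y u)" "br (br f u) y = - br f (br y u)"
      "br u y = - br y u" if "y \<in> L" for u y
    using leibniz[of y f u] L_simps[OF that] br_anti[of "br f u" y] br_anti[of u y] by simp_all
  show ?thesis
    unfolding s t
    by (simp add: br_lin br_self g1[OF V(1)] g1[OF V(2)] g1[OF V(4)] g1[OF V(5)] g2[OF V(3), where u = a'] g2[OF V(3), where u = b']
        g2[OF V(6), where u = a] g2[OF V(6), where u = b]
        L_simps[OF V(3)] L_simps[OF V(6)] br_V[OF V(1) V(4)] br_f_f[OF V(2) V(5)]
        D[of a b'] D'[of b a']
        scale_left_distrib scale_right_distrib scale_left_diff_distrib scale_right_diff_distrib
        algebra_simps)
qed

text \<open>Vectors of the standard representation \<open>W = F + V + F\<close>. The formulas for \<open>act\<close> come from identifying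
  \<open>g\<close> with \<open>Sym^2 W = sp(W)\<close>, where \<open>symprod\<close> is the product of the symmetric square.\<close>

type_synonym ('a, 'b) wvec = "'a \<times> 'b \<times> 'a"

fun act :: "('k, 'g) comps \<Rightarrow> ('k, 'g) wvec \<Rightarrow> ('k, 'g) wvec" where
  "act (\<alpha>, a, \<beta>, m, b, \<gamma>) (p, v, r) =
    (\<alpha> * r + om a v / 2 + \<beta> * p / 2, sc r a - sc p b + br m v, \<gamma> * p + om b v / 2 - \<beta> * r / 2)"

fun sW :: "'k \<Rightarrow> ('k, 'g) wvec \<Rightarrow> ('k, 'g) wvec" where
  "sW c (p, v, r) = (c * p, sc c v, c * r)"

text \<open>The factor 1/2 is the one in \<open>act\<close> and is needed for
  \<open>Om_act\<close>.\<close>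

fun Om :: "('k, 'g) wvec \<Rightarrow> ('k, 'g) wvec \<Rightarrow> 'k" where
  "Om (p, v, r) (p', v', r') = p * r' - r * p' + om v v' / 2"

definition W :: "('k, 'g) wvec set" where
  "W = {(p, v, r) | p v r. v \<in> V}"

lemma in_W [simp]: "(p, v, r) \<in> W \<longleftrightarrow> v \<in> V"
  by (auto simp: W_def)

lemma act_W: "valid t \<Longrightarrow> w \<in> W \<Longrightarrow> act t w \<in> W"
  by (cases t; cases w) (auto intro!: V_closed)

text \<open>Flatness enters here: by \<open>mom_act\<close> the components \<open>mom a b'\<close>
  and \<open>mom a' b\<close> of the bracket act on \<open>V\<close> by the same rank-two formula as
  the compositions of \<open>act\<close>.\<close>

lemma act_brt:
  assumes "valid s" "valid t" "w \<in> W"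
  shows "act (brt s t) w = act s (act t w) - act t (act s w)"
proof -
  obtain \<alpha> a \<beta> m b \<gamma> where s: "s = (\<alpha>, a, \<beta>, m, b, \<gamma>)" by (cases s)
  obtain \<alpha>' a' \<beta>' m' b' \<gamma>' where t: "t = (\<alpha>', a', \<beta>', m', b', \<gamma>')" by (cases t)
  obtain p v r where w: "w = (p, v, r)" by (cases w)
  have V: "a \<in> V" "b \<in> V" "m \<in> L" "a' \<in> V" "b' \<in> V" "m' \<in> L" "v \<in> V" using assms s t w by auto
  have omL: "om (br y u) v = - om u (br y v)" if "y \<in> L" "u \<in> V" for y u
    using om_L[OF that V(7)] .
  have mm: "br (br m m') v = br m (br m' v) - br m' (br m v)"
    using leibniz[of m m' v] by simp
  have sw: "om b' a = - om a b'" "om b a' = - om a' b" "om a' a = - om a a'" "om b' b = - om b b'"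
    by (rule om_anti)+
  show ?thesis
    unfolding s t w
    by (simp add: om_lin om_diff br_lin omL V mom_act mm sw algebra_simps add_divide_distrib diff_divide_distrib
        scale_left_distrib scale_right_distrib scale_left_diff_distrib scale_right_diff_distrib)
qed

lemma act_add: "act t (u + w) = act t u + act t w"
  by (cases t; cases u; cases w)
    (simp add: om_lin br_lin scale_left_distrib algebra_simps add_divide_distrib)

lemma act_sW: "act t (sW c w) = sW c (act t w)"
  by (cases t; cases w)
    (simp add: om_lin br_lin scale_right_distrib scale_right_diff_distrib algebra_simps)

lemma act_add_left: "act (s + t) w = act s w + act t w"
  by (cases s; cases t; cases w)
    (simp add: om_lin br_lin scale_right_distrib algebra_simps add_divide_distrib)

lemma act_smul: "act (smul c t) w = sW c (act t w)"
  by (cases t; cases w)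
    (simp add: om_lin br_lin scale_right_distrib scale_right_diff_distrib algebra_simps)

lemma sW_vector_space: "vector_space sW"
  by unfold_locales (auto simp: scale_right_distrib scale_left_distrib algebra_simps)

interpretation sW: vector_space sW
  by (rule sW_vector_space)

lemma Om_lin:
  "Om (u + v) w = Om u w + Om v w" "Om u (v + w) = Om u v + Om u w"
  "Om (sW c u) w = c * Om u w" "Om u (sW c w) = c * Om u w"
  by (cases u; cases v; cases w; simp add: om_lin algebra_simps add_divide_distrib)+

lemma Om_anti: "Om u w = - Om w u"
proof -
  obtain p v r p' v' r' where "u = (p, v, r)" "w = (p', v', r')" by (cases u; cases w)
  then show ?thesis using om_anti[of v v'] by (simp add: algebra_simps)
qed

lemma Om_minus [simp]: "Om (- u) w = - Om u w" "Om u (- w) = - Om u w"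
  using Om_lin(3)[of "- 1" u w] Om_lin(4)[of u "- 1" w] by simp_all

lemma Om_zero [simp]: "Om 0 w = 0" "Om u 0 = 0"
  using Om_lin(3)[of 0 0 w] Om_lin(4)[of u 0 0] by simp_all

lemma Om_sum: "Om (sum g I) w = (\<Sum>i\<in>I. Om (g i) w)" "Om u (sum g I) = (\<Sum>i\<in>I. Om u (g i))"
  by (induction I rule: infinite_finite_induct) (simp_all add: Om_lin)

lemma act_zero [simp]: "act t 0 = 0"
  using act_sW[of t 0 0] by simp

lemma act_zero_left [simp]: "act 0 w = 0"
  by (cases w) (simp add: zero_prod_def)

lemma act_sum: "act t (sum g I) = (\<Sum>i\<in>I. act t (g i))"
  by (induction I rule: infinite_finite_induct) (simp_all add: act_add)

lemma act_sum_left: "act (sum g I) w = (\<Sum>i\<in>I. act (g i) w)"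
  by (induction I rule: infinite_finite_induct) (simp_all add: act_add_left)

lemma valid_sum: "(\<And>i. i \<in> I \<Longrightarrow> valid (g i)) \<Longrightarrow> valid (sum g I)"
  by (induction I rule: infinite_finite_induct)
    (auto simp: zero_prod_def V_closed L_closed intro!: valid_add)

lemma subspace_W: "sW.subspace W"
  by (rule sW.subspaceI) (auto simp: W_def zero_prod_def V_closed)

lemma Om_act:
  assumes "valid t" "u \<in> W" "w \<in> W"
  shows "Om (act t u) w = - Om u (act t w)"
proof -
  obtain \<alpha> a \<beta> m b \<gamma> where t: "t = (\<alpha>, a, \<beta>, m, b, \<gamma>)" by (cases t)
  obtain p v r where u: "u = (p, v, r)" by (cases u)
  obtain p' v' r' where w: "w = (p', v', r')" by (cases w)
  have "om (br m v) v' = - om v (br m v')" using om_L assms t u w by simp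
  then show ?thesis unfolding t u w
    by (simp add: om_lin om_diff om_anti[of v a] om_anti[of v b] algebra_simps
        add_divide_distrib diff_divide_distrib)
qed

fun symprod :: "('k, 'g) wvec \<Rightarrow> ('k, 'g) wvec \<Rightarrow> ('k, 'g) comps" where
  "symprod (p, v, r) (p', v', r') =
    (2 * p * p', sc p v' + sc p' v, - 2 * (p * r' + p' * r), mom v v', sc r v' + sc r' v, - 2 * r * r')"

lemma valid_symprod: "u \<in> W \<Longrightarrow> w \<in> W \<Longrightarrow> valid (symprod u w)"
  by (cases u; cases w) (auto intro!: V_closed L_closed)

lemma act_symprod:
  assumes "u \<in> W" "w \<in> W" "z \<in> W"
  shows "act (symprod u w) z = sW (Om u z) w + sW (Om w z) u"
proof -
  obtain p v r where u: "u = (p, v, r)" by (cases u)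
  obtain p' v' r' where w: "w = (p', v', r')" by (cases w)
  obtain p'' v'' r'' where z: "z = (p'', v'', r'')" by (cases z)
  show ?thesis using assms unfolding u w z
    by (simp add: mom_act om_lin scale_right_distrib scale_right_diff_distrib scale_left_distrib
        scale_left_diff_distrib algebra_simps add_divide_distrib diff_divide_distrib)
qed

text \<open>Pairs are normalized to 2 because \<open>Om\<close> contains \<open>om / 2\<close>, so
  that they become dual under \<open>Om\<close>.\<close>

definition hyperbolic :: "nat \<Rightarrow> (nat \<Rightarrow> 'g) \<Rightarrow> (nat \<Rightarrow> 'g) \<Rightarrow> bool" where
  "hyperbolic m b b' \<longleftrightarrow> (\<forall>i<m. b i \<in> V \<and> b' i \<in> V) \<and>
    (\<forall>i<m. \<forall>j<m. om (b i) (b j) = 0 \<and> om (b' i) (b' j) = 0 \<and> om (b i) (b' j) = (if i = j then 2 else 0))"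

lemma hyperbolic_bound: "hyperbolic m b b' \<Longrightarrow> m \<le> dimension"
proof -
  assume h: "hyperbolic m b b'"
  have o: "om (b i) (b' j) = (if i = j then 2 else 0)" if "i < m" "j < m" for i j
    using h that by (auto simp: hyperbolic_def)
  have inj: "inj_on b {..<m}"
  proof (rule inj_onI)
    fix i j assume ij: "i \<in> {..<m}" "j \<in> {..<m}" "b i = b j"
    then have "om (b i) (b' j) = 2" using o[of j j] by simp
    then show "i = j" using o[of i j] ij by (simp split: if_splits)
  qed
  have "independent (b ` {..<m})"
  proof (rule independent_if_scalars_zero)
    fix c u assume s: "(\<Sum>u\<in>b ` {..<m}. sc (c u) u) = 0" and u: "u \<in> b ` {..<m}"
    then obtain j where j: "u = b j" "j < m" by auto
    have "(\<Sum>i<m. sc (c (b i)) (b i)) = 0" using s inj by (simp add: sum.reindex)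
    then have "om (\<Sum>i<m. sc (c (b i)) (b i)) (b' j) = 0" by simp
    moreover have "om (sum g I) v = (\<Sum>i\<in>I. om (g i) v)" for g :: "nat \<Rightarrow> 'g" and I v
      by (induction I rule: infinite_finite_induct) (simp_all add: om_lin)
    ultimately have "(\<Sum>i<m. c (b i) * om (b i) (b' j)) = 0" by (simp add: om_lin)
    also have "(\<Sum>i<m. c (b i) * om (b i) (b' j)) = (\<Sum>i<m. if i = j then c (b j) * 2 else 0)"
      using o j by (intro sum.cong) auto
    finally show "c u = 0" using j by simp
  qed simp
  then have "card (b ` {..<m}) \<le> dimension"
    by (metis dim_UNIV dimension_def independent_card_le_dim subset_UNIV)
  then show ?thesis by (simp add: card_image inj)
qed

text \<open>Take a hyperbolic family of maximal size, with \<open>P\<close> the orthogonal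
  projection onto its span. A non-zero residue \<open>v - P v\<close> pairs non-trivially with some
  \<open>u - P u\<close>, and this pair, rescaled, would enlarge the family.\<close>

lemma symplectic_basis:
  "\<exists>m b b'. hyperbolic m b b' \<and>
    (\<forall>v\<in>V. v = (\<Sum>i<m. sc (om v (b' i) / 2) (b i) - sc (om v (b i) / 2) (b' i)))"
proof -
  let ?Q = "\<lambda>m. \<exists>b b'. hyperbolic m b b'"
  have "?Q 0" by (simp add: hyperbolic_def)
  then have "\<exists>m. ?Q m \<and> (\<forall>m'. ?Q m' \<longrightarrow> m' \<le> m)"
    by (rule ex_has_greatest_nat[where b = "Suc dimension"]) (use hyperbolic_bound in \<open>auto simp: less_Suc_eq_le\<close>)
  then obtain m b b' where h: "hyperbolic m b b'" and max: "\<And>m'. ?Q m' \<Longrightarrow> m' \<le> m" by blast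
  have bV: "b i \<in> V" "b' i \<in> V" if "i < m" for i using h that by (auto simp: hyperbolic_def)
  have o: "om (b i) (b j) = 0" "om (b' i) (b' j) = 0" "om (b i) (b' j) = (if i = j then 2 else 0)"
    "om (b' i) (b j) = (if i = j then - 2 else 0)"
    if "i < m" "j < m" for i j
    using h that om_anti[of "b' i" "b j"] by (auto simp: hyperbolic_def)
  define P where "P v = (\<Sum>i<m. sc (om v (b' i) / 2) (b i) - sc (om v (b i) / 2) (b' i))" for v
  have PV: "P v \<in> V" for v unfolding P_def
    using bV by (intro subspace_sum[OF subspace_G] V_closed) auto
  have om_sum: "om (sum g I) v = (\<Sum>i\<in>I. om (g i) v)" for g :: "nat \<Rightarrow> 'g" and I v
    by (induction I rule: infinite_finite_induct) (simp_all add: om_lin)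
  have Pb: "om (P v) (b j) = om v (b j)" if j: "j < m" for v j
  proof -
    have "om (P v) (b j) = (\<Sum>i<m. if i = j then om v (b j) else 0)"
      unfolding P_def om_sum by (intro sum.cong) (auto simp: om_lin om_diff o j)
    then show ?thesis using j by simp
  qed
  have Pb': "om (P v) (b' j) = om v (b' j)" if j: "j < m" for v j
  proof -
    have "om (P v) (b' j) = (\<Sum>i<m. if i = j then om v (b' j) else 0)"
      unfolding P_def om_sum by (intro sum.cong) (auto simp: om_lin om_diff o j)
    then show ?thesis using j by simp
  qed
  have res: "om (v - P v) (b j) = 0" "om (v - P v) (b' j) = 0"
    "om (b j) (v - P v) = 0" "om (b' j) (v - P v) = 0" if "j < m" for v j
    using Pb[OF that, of v] Pb'[OF that, of v] om_anti[of _ "v - P v"] by (auto simp: om_diff)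
  have "v = P v" if v: "v \<in> V" for v
  proof (rule ccontr)
    assume ne: "v \<noteq> P v"
    define r where "r = v - P v"
    have rV: "r \<in> V" unfolding r_def using v PV by (intro V_closed)
    have "r \<noteq> 0" using ne by (simp add: r_def)
    then obtain u where u: "u \<in> V" "om r u \<noteq> 0" using om_nondegenerate[OF rV] by blast
    have "om r (P u) = 0"
    proof -
      have "om (P u) r = 0" unfolding P_def om_sum
        using res[of _ v] by (intro sum.neutral) (auto simp: om_diff om_lin r_def[symmetric])
      then show ?thesis using om_anti[of r "P u"] by simp
    qed
    then have ru: "om r (u - P u) \<noteq> 0" using u(2) by (simp add: om_diff)
    define c where "c = 2 / om r (u - P u)"
    define t where "t = sc c (u - P u)"
    have tV: "t \<in> V" unfolding t_def using u PV by (intro V_closed)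
    have rt: "om r t = 2" using ru by (simp add: t_def c_def om_lin)
    have tb: "om t (b j) = 0" "om t (b' j) = 0" "om (b j) t = 0" "om (b' j) t = 0" if "j < m" for j
      using res[OF that, of u] by (simp_all add: t_def om_lin)
    have rb: "om r (b j) = 0" "om r (b' j) = 0" "om (b j) r = 0" "om (b' j) r = 0" if "j < m" for j
      using res[OF that, of v] by (simp_all add: r_def)
    have "hyperbolic (Suc m) (b(m := r)) (b'(m := t))"
      unfolding hyperbolic_def by (auto simp: less_Suc_eq bV rV tV o rb tb rt)
    then have "Suc m \<le> m" using max by blast
    then show False by simp
  qed
  then show ?thesis using h unfolding P_def by blast
qed

lemma sum_split_double: "(\<Sum>k<n + n. g k) = (\<Sum>k<n. g k) + (\<Sum>k<n. g (n + k))"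
  for g :: "nat \<Rightarrow> 'a::comm_monoid_add" and n :: nat
proof -
  have "(\<Sum>k<n + j. g k) = (\<Sum>k<n. g k) + (\<Sum>k<j. g (n + k))" for j
    by (induction j) (simp_all add: add.assoc)
  then show ?thesis .
qed

text \<open>The pair \<open>(1,0,0)\<close>, \<open>(0,0,1)\<close> is put in front of a symplectic
  basis of \<open>V\<close>, so \<open>n = m + 1\<close> is positive even for \<open>V = 0\<close>.
  The indices \<open>i\<close> and \<open>n + i\<close> are paired, as in
  \<open>sp_form\<close>.\<close>

lemma symplectic_frame:
  obtains n :: nat and w where "n \<ge> 1" "\<And>i. i < n + n \<Longrightarrow> w i \<in> W"
    "\<And>i j. i < n \<Longrightarrow> j < n \<Longrightarrow> Om (w i) (w j) = 0"
    "\<And>i j. i < n \<Longrightarrow> j < n \<Longrightarrow> Om (w (n + i)) (w (n + j)) = 0"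
    "\<And>i j. i < n \<Longrightarrow> j < n \<Longrightarrow> Om (w i) (w (n + j)) = (if i = j then 1 else 0)"
    "\<And>u. u \<in> W \<Longrightarrow> u = (\<Sum>i<n. sW (Om u (w (n + i))) (w i) + sW (Om (w i) u) (w (n + i)))"
proof -
  obtain m b b' where h: "hyperbolic m b b'" and ex:
    "\<And>v. v \<in> V \<Longrightarrow> v = (\<Sum>i<m. sc (om v (b' i) / 2) (b i) - sc (om v (b i) / 2) (b' i))"
    using symplectic_basis by blast
  have bV: "b i \<in> V" "b' i \<in> V" if "i < m" for i using h that by (auto simp: hyperbolic_def)
  have o: "om (b i) (b j) = 0" "om (b' i) (b' j) = 0" "om (b i) (b' j) = (if i = j then 2 else 0)"
    if "i < m" "j < m" for i j
    using h that by (auto simp: hyperbolic_def)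
  define w1 :: "nat \<Rightarrow> ('k, 'g) wvec" where "w1 i = (case i of 0 \<Rightarrow> (1, 0, 0) | Suc i \<Rightarrow> (0, b i, 0))" for i
  define w2 :: "nat \<Rightarrow> ('k, 'g) wvec" where "w2 i = (case i of 0 \<Rightarrow> (0, 0, 1) | Suc i \<Rightarrow> (0, b' i, 0))" for i
  define w where "w i = (if i < Suc m then w1 i else w2 (i - Suc m))" for i
  have w: "w i = w1 i" "w (Suc m + i) = w2 i" if "i < Suc m" for i using that by (auto simp: w_def)
  show thesis
  proof (rule that[of "Suc m" w])
    show "w i \<in> W" if "i < Suc m + Suc m" for i
      using that bV by (auto simp: w_def w1_def w2_def V_closed split: nat.split)
    show "Om (w i) (w j) = 0" if "i < Suc m" "j < Suc m" for i j
      using that o by (auto simp: w w1_def split: nat.split)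
    show "Om (w (Suc m + i)) (w (Suc m + j)) = 0" if "i < Suc m" "j < Suc m" for i j
      unfolding w(2)[OF that(1)] w(2)[OF that(2)] using that o by (auto simp: w2_def split: nat.split)
    show "Om (w i) (w (Suc m + j)) = (if i = j then 1 else 0)" if "i < Suc m" "j < Suc m" for i j
      unfolding w(1)[OF that(1)] w(2)[OF that(2)] using that o by (auto simp: w1_def w2_def split: nat.split)
    show "u = (\<Sum>i<Suc m. sW (Om u (w (Suc m + i))) (w i) + sW (Om (w i) u) (w (Suc m + i)))"
      if u: "u \<in> W" for u
    proof -
      obtain p v r where uu: "u = (p, v, r)" by (cases u)
      have v: "v \<in> V" using u uu by simp
      have emb: "(\<Sum>i\<in>I. (0::'k, g i :: 'g, 0::'k)) = (0, sum g I, 0)" for g :: "nat \<Rightarrow> 'g" and I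
        by (induction I rule: infinite_finite_induct) (simp_all add: zero_prod_def)
      have "(\<Sum>i<Suc m. sW (Om u (w (Suc m + i))) (w i) + sW (Om (w i) u) (w (Suc m + i))) =
          (\<Sum>i<Suc m. sW (Om u (w2 i)) (w1 i) + sW (Om (w1 i) u) (w2 i))"
        by (intro sum.cong refl) (simp add: w del: add_Suc)
      also have "\<dots> = (p, 0, 0) + (0, 0, r) + (\<Sum>i<m. (0, sc (om v (b' i) / 2) (b i) + sc (om (b i) v / 2) (b' i), 0))"
        unfolding sum.lessThan_Suc_shift by (simp add: w1_def w2_def uu)
      also have "\<dots> = (p, (\<Sum>i<m. sc (om v (b' i) / 2) (b i) + sc (om (b i) v / 2) (b' i)), r)"
        unfolding emb by simp
      also have "(\<Sum>i<m. sc (om v (b' i) / 2) (b i) + sc (om (b i) v / 2) (b' i)) =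
          (\<Sum>i<m. sc (om v (b' i) / 2) (b i) - sc (om v (b i) / 2) (b' i))"
        by (intro sum.cong refl) (simp add: om_anti[of "b _" v])
      also have "\<dots> = v" using ex[OF v] by simp
      finally show ?thesis by (simp add: uu)
    qed
  qed simp
qed

end

section \<open>Symplectic matrices\<close>

lemma sum_double_if:
  fixes g :: "nat \<Rightarrow> 'a::comm_ring_1"
  assumes "\<And>k. k < n + n \<Longrightarrow> g k = (if k = c then a else 0)" "c < n + n"
  shows "(\<Sum>k\<in>{0..<n+n}. g k) = a"
proof -
  have "(\<Sum>k\<in>{0..<n+n}. g k) = (\<Sum>k\<in>{0..<n+n}. if k = c then a else 0)"
    using assms by (intro sum.cong) auto
  then show ?thesis using assms(2) by simp
qed

lemma sp_form_index:
  assumes "i < n + n" "j < n + n"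
  shows "(sp_form n :: 'a::comm_ring_1 mat) $$ (i, j) = (if j = i + n then 1 else if i = j + n then - 1 else 0)"
  using assms by (auto simp: sp_form_def)

lemma sp_form_carrier: "sp_form n \<in> carrier_mat (n + n) (n + n)"
  by (simp add: sp_form_def)

lemma sp_form_mult:
  fixes A :: "'a::comm_ring_1 mat"
  assumes "A \<in> carrier_mat (n + n) (n + n)" "i < n + n" "j < n + n"
  shows "(sp_form n * A) $$ (i, j) = (if i < n then A $$ (i + n, j) else - A $$ (i - n, j))"
proof -
  have "(sp_form n * A) $$ (i, j) = (\<Sum>k\<in>{0..<n+n}. sp_form n $$ (i, k) * A $$ (k, j))"
    using assms sp_form_carrier[of n, where ?'a = 'a] by (simp add: scalar_prod_def)
  also have "\<dots> = (if i < n then A $$ (i + n, j) else - A $$ (i - n, j))"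
    by (rule sum_double_if[where c = "if i < n then i + n else i - n"])
      (use assms in \<open>auto simp: sp_form_index\<close>)
  finally show ?thesis .
qed

lemma mult_sp_form:
  fixes A :: "'a::comm_ring_1 mat"
  assumes "A \<in> carrier_mat (n + n) (n + n)" "i < n + n" "j < n + n"
  shows "(transpose_mat A * sp_form n) $$ (i, j) = - (sp_form n * A) $$ (j, i)"
proof -
  have "(transpose_mat A * sp_form n) $$ (i, j) = (\<Sum>k\<in>{0..<n+n}. A $$ (k, i) * sp_form n $$ (k, j))"
    using assms sp_form_carrier[of n, where ?'a = 'a] by (simp add: scalar_prod_def)
  also have "\<dots> = (if j < n then - A $$ (j + n, i) else A $$ (j - n, i))"
    by (rule sum_double_if[where c = "if j < n then j + n else j - n"])
      (use assms in \<open>auto simp: sp_form_index\<close>)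
  also have "\<dots> = - (sp_form n * A) $$ (j, i)"
    using sp_form_mult[OF assms(1,3,2)] by simp
  finally show ?thesis .
qed

text \<open>For skew \<open>J = sp_form n\<close>, the product of the transpose of \<open>A\<close>
  with \<open>J\<close> is minus the transpose of \<open>J A\<close>; so the condition says that
  \<open>J A\<close> is symmetric.\<close>

lemma sp_mat_iff:
  fixes A :: "'a::comm_ring_1 mat"
  shows "A \<in> sp_mat n \<longleftrightarrow> A \<in> carrier_mat (n + n) (n + n) \<and>
    (\<forall>i<n+n. \<forall>j<n+n. (sp_form n * A) $$ (i, j) = (sp_form n * A) $$ (j, i))"
proof (cases "A \<in> carrier_mat (n + n) (n + n)")
  case True
  let ?X = "transpose_mat A * sp_form n + sp_form n * A"
  have X: "?X \<in> carrier_mat (n + n) (n + n)"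
    using True sp_form_carrier[of n, where ?'a = 'a] by auto
  have "?X $$ (i, j) = (sp_form n * A) $$ (i, j) - (sp_form n * A) $$ (j, i)"
    if "i < n + n" "j < n + n" for i j
    using mult_sp_form[OF True that] True that sp_form_carrier[of n, where ?'a = 'a]
    by (simp add: algebra_simps)
  moreover have "?X = 0\<^sub>m (n + n) (n + n) \<longleftrightarrow> (\<forall>i<n+n. \<forall>j<n+n. ?X $$ (i, j) = 0)"
  proof
    show "\<forall>i<n+n. \<forall>j<n+n. ?X $$ (i, j) = 0" if "?X = 0\<^sub>m (n + n) (n + n)"
      unfolding that by simp
    show "?X = 0\<^sub>m (n + n) (n + n)" if "\<forall>i<n+n. \<forall>j<n+n. ?X $$ (i, j) = 0"
      by (rule eq_matI) (use that X True sp_form_carrier[of n, where ?'a = 'a] in simp_all)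
  qed
  ultimately show ?thesis using True by (simp add: sp_mat_def mult_2)
next
  case False
  then show ?thesis by (simp add: sp_mat_def mult_2)
qed

section \<open>The isomorphism of \<open>g\<close> with the symplectic matrices\<close>

locale framed_triple = flat_triple sc br e x f
  for sc :: "'k::field_char_0 \<Rightarrow> 'g::ab_group_add \<Rightarrow> 'g" and br e x f +
  fixes n :: nat and w :: "nat \<Rightarrow> 'k \<times> 'g \<times> 'k"
  assumes n1: "n \<ge> 1" and wW: "\<And>i. i < n + n \<Longrightarrow> w i \<in> W"
    and Om_w1: "\<And>i j. i < n \<Longrightarrow> j < n \<Longrightarrow> Om (w i) (w j) = 0"
    and Om_w2: "\<And>i j. i < n \<Longrightarrow> j < n \<Longrightarrow> Om (w (n + i)) (w (n + j)) = 0"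
    and Om_w: "\<And>i j. i < n \<Longrightarrow> j < n \<Longrightarrow> Om (w i) (w (n + j)) = (if i = j then 1 else 0)"
    and w_expand: "\<And>u. u \<in> W \<Longrightarrow> u = (\<Sum>i<n. sW (Om u (w (n + i))) (w i) + sW (Om (w i) u) (w (n + i)))"
begin

interpretation sW: vector_space sW
  by (rule sW_vector_space)

text \<open>The basis dual to \<open>w\<close> with respect to \<open>Om\<close>.\<close>

definition d :: "nat \<Rightarrow> 'k \<times> 'g \<times> 'k" where
  "d k = (if k < n then - w (n + k) else w (k - n))"

definition coord :: "nat \<Rightarrow> 'k \<times> 'g \<times> 'k \<Rightarrow> 'k" where
  "coord k u = Om (d k) u"

lemma coord_lin: "coord k (u + v) = coord k u + coord k v" "coord k (sW c u) = c * coord k u"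
  by (simp_all add: coord_def Om_lin)

lemma coord_diff: "coord k (u - v) = coord k u - coord k v"
  using coord_lin(1)[of k "u - v" v] by simp

lemma coord_sum: "coord k (sum g I) = (\<Sum>i\<in>I. coord k (g i))"
  by (simp add: coord_def Om_sum)

lemma dW: "k < n + n \<Longrightarrow> d k \<in> W"
  using wW sW.subspace_neg[OF subspace_W] by (simp add: d_def)

lemma coord_w: "i < n + n \<Longrightarrow> j < n + n \<Longrightarrow> coord i (w j) = (if i = j then 1 else 0)"
proof -
  assume ij: "i < n + n" "j < n + n"
  have *: "\<not> k < n \<Longrightarrow> k < n + n \<Longrightarrow> \<exists>l<n. k = n + l" for k by (rule exI[of _ "k - n"]) auto
  have Om_w': "Om (w (n + i)) (w j) = (if i = j then - 1 else 0)" if "i < n" "j < n" for i j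
    using Om_w[OF that(2,1)] Om_anti[of "w (n + i)" "w j"] by auto
  show ?thesis
    using ij *[of i] *[of j]
    by (cases "i < n"; cases "j < n") (auto simp: coord_def d_def Om_w Om_w1 Om_w2 Om_w')
qed

lemma coord_expand: "u \<in> W \<Longrightarrow> u = (\<Sum>k<n+n. sW (coord k u) (w k))"
proof -
  assume "u \<in> W"
  then have "u = (\<Sum>i<n. sW (Om u (w (n + i))) (w i)) + (\<Sum>i<n. sW (Om (w i) u) (w (n + i)))"
    using w_expand by (simp add: sum.distrib)
  also have "\<dots> = (\<Sum>k<n+n. sW (coord k u) (w k))"
    unfolding sum_split_double by (simp add: coord_def d_def Om_anti[of u])
  finally show ?thesis .
qed

lemma dual_expand:
  assumes "u \<in> W"
  shows "(\<Sum>k<n+n. sW (Om (w k) u) (d k)) = - u"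
proof -
  have "(\<Sum>k<n+n. sW (Om (w k) u) (d k)) =
      - ((\<Sum>i<n. sW (Om u (w (n + i))) (w i)) + (\<Sum>i<n. sW (Om (w i) u) (w (n + i))))"
    unfolding sum_split_double by (simp add: d_def Om_anti[of u] sum_negf)
  then show ?thesis unfolding sum.distrib[symmetric] w_expand[OF assms, symmetric] .
qed

lemma coord_eqI: "u \<in> W \<Longrightarrow> v \<in> W \<Longrightarrow> (\<And>k. k < n + n \<Longrightarrow> coord k u = coord k v) \<Longrightarrow> u = v"
  using coord_expand[of u] coord_expand[of v] by simp

definition repr :: "'g \<Rightarrow> 'k mat" where
  "repr y = mat (n + n) (n + n) (\<lambda>(i, j). coord i (act (dec y) (w j)))"

lemma repr_carrier: "repr y \<in> carrier_mat (n + n) (n + n)"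
  by (simp add: repr_def)

lemma repr_index: "i < n + n \<Longrightarrow> j < n + n \<Longrightarrow> repr y $$ (i, j) = coord i (act (dec y) (w j))"
  by (simp add: repr_def)

text \<open>The signs in \<open>d\<close> are chosen so that multiplying by \<open>sp_form\<close>
  turns coordinates into values of \<open>Om\<close>. Symmetry of \<open>J A\<close> thereby becomes
  skewness of the endomorphism.\<close>

lemma sp_form_coord:
  assumes "A \<in> carrier_mat (n + n) (n + n)" "i < n + n" "j < n + n" "u \<in> W"
    and "\<And>k. k < n + n \<Longrightarrow> A $$ (k, j) = coord k u"
  shows "(sp_form n * A) $$ (i, j) = Om (w i) u"
proof (cases "i < n")
  case True
  then show ?thesis using sp_form_mult[OF assms(1-3)] assms(5)[of "i + n"]
    by (simp add: coord_def d_def)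
next
  case False
  then have "i - n < n" "n + (i - n) = i" using assms(2) by auto
  then show ?thesis using sp_form_mult[OF assms(1-3)] assms(5)[of "i - n"] False
    by (simp add: coord_def d_def)
qed

lemma repr_add: "repr (y + z) = repr y + repr z"
  by (rule eq_matI) (simp_all add: repr_def dec_add act_add_left coord_lin)

lemma repr_scale: "repr (sc c y) = c \<cdot>\<^sub>m repr y"
  by (rule eq_matI) (simp_all add: repr_def dec_smul act_smul coord_lin)

lemma repr_comp:
  assumes "i < n + n" "j < n + n"
  shows "(repr y * repr z) $$ (i, j) = coord i (act (dec y) (act (dec z) (w j)))"
proof -
  have "act (dec y) (act (dec z) (w j)) =
      act (dec y) (\<Sum>k<n+n. sW (coord k (act (dec z) (w j))) (w k))"
    by (rule arg_cong[OF coord_expand[OF act_W[OF dec(1) wW[OF assms(2)]]]])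
  also have "\<dots> = (\<Sum>k<n+n. sW (coord k (act (dec z) (w j))) (act (dec y) (w k)))"
    by (simp only: act_sW act_sum)
  finally have "act (dec y) (act (dec z) (w j)) =
      (\<Sum>k<n+n. sW (coord k (act (dec z) (w j))) (act (dec y) (w k)))" .
  then have "coord i (act (dec y) (act (dec z) (w j))) =
      (\<Sum>k<n+n. coord k (act (dec z) (w j)) * coord i (act (dec y) (w k)))"
    by (simp only: coord_sum coord_lin)
  moreover have "(repr y * repr z) $$ (i, j) = (\<Sum>k\<in>{0..<n+n}. repr y $$ (i, k) * repr z $$ (k, j))"
    using assms repr_carrier[of y] repr_carrier[of z] by (simp add: scalar_prod_def)
  ultimately show ?thesis
    using assms by (simp add: repr_index mult.commute lessThan_atLeast0)
qed

lemma dec_br: "dec (br y z) = brt (dec y) (dec z)"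
  using br_comb[OF dec(1) dec(1), of y z] dec_comb[OF valid_brt[OF dec(1) dec(1)], of y z]
  by (simp add: dec)

lemma repr_br: "repr (br y z) = repr y * repr z - repr z * repr y"
proof (rule eq_matI)
  fix i j assume "i < dim_row (repr y * repr z - repr z * repr y)" "j < dim_col (repr y * repr z - repr z * repr y)"
  then have ij: "i < n + n" "j < n + n" using repr_carrier[of y] repr_carrier[of z] by auto
  have "repr (br y z) $$ (i, j) = coord i (act (dec y) (act (dec z) (w j)) - act (dec z) (act (dec y) (w j)))"
    using ij by (simp add: repr_index dec_br act_brt dec wW)
  also have "\<dots> = (repr y * repr z) $$ (i, j) - (repr z * repr y) $$ (i, j)"
    using ij by (simp add: coord_diff repr_comp)
  also have "\<dots> = (repr y * repr z - repr z * repr y) $$ (i, j)"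
    using ij repr_carrier[of y] repr_carrier[of z] by simp
  finally show "repr (br y z) $$ (i, j) = (repr y * repr z - repr z * repr y) $$ (i, j)" .
qed (use repr_carrier[of y] repr_carrier[of z] repr_carrier[of "br y z"] in auto)

lemma repr_sp: "repr y \<in> sp_mat n"
  unfolding sp_mat_iff
proof (intro conjI allI impI repr_carrier)
  fix i j assume ij: "i < n + n" "j < n + n"
  have "(sp_form n * repr y) $$ (i, j) = Om (w i) (act (dec y) (w j))" if "i < n + n" "j < n + n" for i j
    using that by (intro sp_form_coord repr_carrier act_W dec wW) (simp_all add: repr_index)
  then show "(sp_form n * repr y) $$ (i, j) = (sp_form n * repr y) $$ (j, i)"
    using ij Om_act[OF dec(1) wW wW, of i j y] by (simp add: Om_anti[of "w j"])
qed

text \<open>The images of \<open>(0,0,1)\<close> and \<open>(1,0,0)\<close> reveal every component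
  except \<open>m\<close>, which is left to \<open>L_faithful\<close>.\<close>

lemma act_faithful:
  assumes t: "valid t" and 0: "\<And>u. u \<in> W \<Longrightarrow> act t u = 0"
  shows "t = 0"
proof -
  obtain \<alpha> a \<beta> m b \<gamma> where t': "t = (\<alpha>, a, \<beta>, m, b, \<gamma>)" by (cases t)
  have "act t (0, 0, 1) = 0" "act t (1, 0, 0) = 0" by (simp_all add: 0 V_closed)
  then have z: "\<alpha> = 0" "a = 0" "\<beta> = 0" "b = 0" "\<gamma> = 0" by (simp_all add: t' zero_prod_def)
  have "m = 0"
  proof (rule L_faithful)
    show "br m v = 0" if "v \<in> V" for v using 0[of "(0, v, 0)"] that by (simp add: t' zero_prod_def)
  qed (use t t' in auto)
  then show ?thesis using z by (simp add: t' zero_prod_def)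
qed

lemma repr_inj: "repr y = repr z \<Longrightarrow> y = z"
proof -
  assume eq: "repr y = repr z"
  let ?t = "dec y + smul (- 1) (dec z)"
  have v: "valid ?t" by (intro valid_add valid_smul dec)
  have w0: "act ?t (w j) = 0" if j: "j < n + n" for j
  proof (rule coord_eqI)
    show "coord k (act ?t (w j)) = coord k 0" if k: "k < n + n" for k
      using arg_cong[OF eq, of "\<lambda>A. A $$ (k, j)"] k j
      by (simp only: repr_index act_add_left act_smul coord_lin) (simp add: coord_def)
  qed (use act_W[OF v wW[OF j]] sW.subspace_0[OF subspace_W] in auto)
  have "act ?t u = 0" if "u \<in> W" for u
  proof -
    have "act ?t u = (\<Sum>k<n+n. sW (coord k u) (act ?t (w k)))"
      by (subst coord_expand[OF that]) (simp only: act_sum act_sW)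
    also have "\<dots> = 0" using w0 by (intro sum.neutral) simp
    finally show ?thesis .
  qed
  from act_faithful[OF v this] have "comb ?t = comb 0" by simp
  then show "y = z" by (simp only: comb_add comb_smul dec) (simp add: zero_prod_def)
qed

text \<open>An endomorphism with images \<open>T k\<close> of \<open>w k\<close> corresponds in
  Sym^2 W to half the sum of the products \<open>T k . d k\<close>. By \<open>act_symprod\<close>
  this sum acts on \<open>w j\<close> in two parts: the duality of \<open>d\<close> gives
  \<open>T j\<close>, and the symmetry \<open>sym\<close> gives \<open>T j\<close> once more, which
  explains the factor 1/2.\<close>

lemma repr_surj:
  assumes A: "A \<in> sp_mat n"
  shows "\<exists>y. repr y = A"
proof -
  have Ac: "A \<in> carrier_mat (n + n) (n + n)" using A by (simp add: sp_mat_iff)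
  define T where "T j = (\<Sum>i<n+n. sW (A $$ (i, j)) (w i))" for j
  have TW: "T j \<in> W" for j
    unfolding T_def using wW by (intro sW.subspace_sum[OF subspace_W] sW.subspace_scale[OF subspace_W]) auto
  have T: "coord i (T j) = A $$ (i, j)" if "i < n + n" for i j
  proof -
    have "coord i (T j) = (\<Sum>k<n+n. if k = i then A $$ (i, j) else 0)"
      unfolding T_def coord_sum using that by (intro sum.cong) (auto simp: coord_lin coord_w)
    then show ?thesis using that by simp
  qed
  have sym: "Om (w i) (T j) = Om (w j) (T i)" if "i < n + n" "j < n + n" for i j
  proof -
    have "(sp_form n * A) $$ (i, j) = Om (w i) (T j)" if "i < n + n" "j < n + n" for i j
      by (rule sp_form_coord[OF Ac that TW]) (simp add: T)
    then show ?thesis using A that unfolding sp_mat_iff by metis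
  qed
  define t where "t = smul (1/2) (\<Sum>k<n+n. symprod (T k) (d k))"
  have v: "valid t" unfolding t_def using TW dW by (intro valid_smul valid_sum valid_symprod) auto
  have act_t: "act t (w j) = T j" if j: "j < n + n" for j
  proof -
    have "(\<Sum>k<n+n. act (symprod (T k) (d k)) (w j)) =
        (\<Sum>k<n+n. sW (Om (T k) (w j)) (d k)) + (\<Sum>k<n+n. sW (coord k (w j)) (T k))"
      using act_symprod[OF TW dW wW] j by (simp add: coord_def flip: sum.distrib)
    also have "(\<Sum>k<n+n. sW (coord k (w j)) (T k)) = (\<Sum>k<n+n. if k = j then T j else 0)"
      using j by (intro sum.cong) (auto simp: coord_w simp del: sW.simps)
    also have "\<dots> = T j" using j by simp
    also have "(\<Sum>k<n+n. sW (Om (T k) (w j)) (d k)) = - (\<Sum>k<n+n. sW (Om (w k) (T j)) (d k))"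
      unfolding sum_negf[symmetric] using sym j
      by (intro sum.cong) (auto simp: Om_anti[of "T _" "w j"])
    also have "\<dots> = T j" using dual_expand[OF TW] by simp
    finally have "act t (w j) = sW (1/2) (sW 2 (T j))"
      unfolding t_def act_smul act_sum_left sW.scale_2 by (rule arg_cong)
    also have "\<dots> = T j" unfolding sW.scale_scale by (cases "T j") simp
    finally show ?thesis .
  qed
  have "repr (comb t) = A"
    by (rule eq_matI) (use Ac in \<open>auto simp: repr_def dec_comb[OF v] act_t T\<close>)
  then show ?thesis by blast
qed

lemma type_C: "type_C sc br n"
  unfolding type_C_def
proof (intro exI[of _ repr] conjI allI)
  show "bij_betw repr UNIV (sp_mat n)"
    unfolding bij_betw_def
  proof
    show "inj repr" by (rule injI) (rule repr_inj)
    show "range repr = sp_mat n" using repr_sp repr_surj by (metis image_subsetI subsetI subset_antisym rangeI)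
  qed
qed (simp_all add: repr_add repr_scale repr_br)

end

lemma (in flat_triple) flat_type_C: "\<exists>n\<ge>1. type_C sc br n"
proof (rule symplectic_frame)
  fix n :: nat and w assume "1 \<le> n" "\<And>i. i < n + n \<Longrightarrow> w i \<in> W"
    "\<And>i j. i < n \<Longrightarrow> j < n \<Longrightarrow> Om (w i) (w j) = 0"
    "\<And>i j. i < n \<Longrightarrow> j < n \<Longrightarrow> Om (w (n + i)) (w (n + j)) = 0"
    "\<And>i j. i < n \<Longrightarrow> j < n \<Longrightarrow> Om (w i) (w (n + j)) = (if i = j then 1 else 0)"
    "\<And>u. u \<in> W \<Longrightarrow> u = (\<Sum>i<n. sW (Om u (w (n + i))) (w i) + sW (Om (w i) u) (w (n + i)))"
  then interpret framed_triple sc br e x f n w by unfold_locales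
  show ?thesis using n1 type_C by blast
qed

section \<open>Extension of homomorphisms\<close>

definition subring_set :: "'a::comm_ring_1 set \<Rightarrow> bool" where
  "subring_set R \<longleftrightarrow> 0 \<in> R \<and> 1 \<in> R \<and> (\<forall>a\<in>R. \<forall>b\<in>R. a + b \<in> R \<and> a * b \<in> R) \<and> (\<forall>a\<in>R. - a \<in> R)"

definition hom_on :: "'a::comm_ring_1 set \<Rightarrow> ('a \<Rightarrow> 'b::comm_ring_1) \<Rightarrow> bool" where
  "hom_on R h \<longleftrightarrow> h 1 = 1 \<and> (\<forall>a\<in>R. \<forall>b\<in>R. h (a + b) = h a + h b \<and> h (a * b) = h a * h b)"

definition polys_over :: "'a::comm_ring_1 set \<Rightarrow> 'a poly set" where
  "polys_over R = {p. \<forall>i. coeff p i \<in> R}"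

definition adjoin :: "'a::comm_ring_1 set \<Rightarrow> 'a \<Rightarrow> 'a set" where
  "adjoin R a = {poly p a | p. p \<in> polys_over R}"

context
  fixes R :: "'a::comm_ring_1 set"
  assumes R: "subring_set R"
begin

lemma subring_closed:
  "0 \<in> R" "1 \<in> R" "a \<in> R \<Longrightarrow> b \<in> R \<Longrightarrow> a + b \<in> R" "a \<in> R \<Longrightarrow> b \<in> R \<Longrightarrow> a * b \<in> R" "a \<in> R \<Longrightarrow> - a \<in> R"
  using R by (auto simp: subring_set_def)

lemma subring_diff: "a \<in> R \<Longrightarrow> b \<in> R \<Longrightarrow> a - b \<in> R"
  using subring_closed(3)[of a "- b"] subring_closed(5)[of b] by simp

lemma subring_sum: "(\<And>i. i \<in> I \<Longrightarrow> g i \<in> R) \<Longrightarrow> sum g I \<in> R"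
  by (induction I rule: infinite_finite_induct) (auto intro: subring_closed)

lemma subring_power: "a \<in> R \<Longrightarrow> a ^ k \<in> R"
  by (induction k) (auto intro: subring_closed)

lemma polys_over_closed:
  "0 \<in> polys_over R" "c \<in> R \<Longrightarrow> [:c:] \<in> polys_over R" "c \<in> R \<Longrightarrow> monom c i \<in> polys_over R"
  "p \<in> polys_over R \<Longrightarrow> q \<in> polys_over R \<Longrightarrow> p + q \<in> polys_over R"
  "p \<in> polys_over R \<Longrightarrow> q \<in> polys_over R \<Longrightarrow> p - q \<in> polys_over R"
  "p \<in> polys_over R \<Longrightarrow> - p \<in> polys_over R"
  "p \<in> polys_over R \<Longrightarrow> q \<in> polys_over R \<Longrightarrow> p * q \<in> polys_over R"
  "c \<in> R \<Longrightarrow> p \<in> polys_over R \<Longrightarrow> Polynomial.smult c p \<in> polys_over R"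
  by (auto simp: polys_over_def coeff_mult coeff_pCons split: nat.split
      intro: subring_closed subring_diff subring_sum)

lemma adjoin_subring: "subring_set (adjoin R a)"
  unfolding subring_set_def
proof (intro conjI ballI)
  show "0 \<in> adjoin R a" unfolding adjoin_def
    using polys_over_closed(1) by (intro CollectI exI[of _ 0]) simp
  show "1 \<in> adjoin R a" unfolding adjoin_def
    using polys_over_closed(2)[OF subring_closed(2)] by (intro CollectI exI[of _ "[:1:]"]) simp
  fix b assume "b \<in> adjoin R a"
  then obtain p where p: "p \<in> polys_over R" "b = poly p a" by (auto simp: adjoin_def)
  show "- b \<in> adjoin R a" unfolding adjoin_def
    using polys_over_closed(6)[OF p(1)] p(2) by (intro CollectI exI[of _ "- p"]) simp
  fix c assume "c \<in> adjoin R a"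
  then obtain q where q: "q \<in> polys_over R" "c = poly q a" by (auto simp: adjoin_def)
  show "b + c \<in> adjoin R a" unfolding adjoin_def
    using polys_over_closed(4)[OF p(1) q(1)] p(2) q(2) by (intro CollectI exI[of _ "p + q"]) simp
  show "b * c \<in> adjoin R a" unfolding adjoin_def
    using polys_over_closed(7)[OF p(1) q(1)] p(2) q(2) by (intro CollectI exI[of _ "p * q"]) simp
qed

lemma adjoin_contains: "R \<subseteq> adjoin R a" "a \<in> adjoin R a"
proof -
  show "R \<subseteq> adjoin R a"
  proof
    fix c assume "c \<in> R"
    then show "c \<in> adjoin R a" unfolding adjoin_def
      using polys_over_closed(2)[of c] by (intro CollectI exI[of _ "[:c:]"]) simp
  qed
  have "[:0, 1:] \<in> polys_over R"
    using polys_over_closed(3)[OF subring_closed(2), of 1] by (simp add: monom_altdef)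
  then show "a \<in> adjoin R a" unfolding adjoin_def by (intro CollectI exI[of _ "[:0, 1:]"]) simp
qed

context
  fixes h :: "'a \<Rightarrow> 'b::comm_ring_1"
  assumes h: "hom_on R h"
begin

lemma hom_simps:
  "h 1 = 1" "a \<in> R \<Longrightarrow> b \<in> R \<Longrightarrow> h (a + b) = h a + h b" "a \<in> R \<Longrightarrow> b \<in> R \<Longrightarrow> h (a * b) = h a * h b"
  using h by (auto simp: hom_on_def)

lemma hom_zero: "h 0 = 0"
  using hom_simps(2)[OF subring_closed(1,1)] by simp

lemma hom_sum: "(\<And>i. i \<in> I \<Longrightarrow> g i \<in> R) \<Longrightarrow> h (sum g I) = (\<Sum>i\<in>I. h (g i))"
  by (induction I rule: infinite_finite_induct) (auto simp: hom_zero hom_simps subring_sum)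

lemma hom_power: "a \<in> R \<Longrightarrow> h (a ^ k) = h a ^ k"
  by (induction k) (auto simp: hom_simps subring_power)

lemma map_poly_hom:
  assumes "p \<in> polys_over R" "q \<in> polys_over R"
  shows "map_poly h (p + q) = map_poly h p + map_poly h q"
    "map_poly h (p * q) = map_poly h p * map_poly h q"
  using assms
  by (intro poly_eqI; auto simp: coeff_map_poly hom_zero polys_over_def hom_simps coeff_mult hom_sum
      subring_closed intro!: sum.cong)+

text \<open>Send \<open>a\<close> to \<open>z\<close>. The assumption makes the value independent of
  the polynomial chosen to represent an element of \<open>adjoin R a\<close>.\<close>

lemma extend_hom:
  assumes "\<And>p. p \<in> polys_over R \<Longrightarrow> poly p a = 0 \<Longrightarrow> poly (map_poly h p) z = 0"
  shows "\<exists>h'. hom_on (adjoin R a) h' \<and> (\<forall>p\<in>polys_over R. h' (poly p a) = poly (map_poly h p) z)"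
proof -
  define h' where "h' c = poly (map_poly h (SOME p. p \<in> polys_over R \<and> poly p a = c)) z" for c
  have h': "h' (poly p a) = poly (map_poly h p) z" if p: "p \<in> polys_over R" for p
  proof -
    define q where "q = (SOME q. q \<in> polys_over R \<and> poly q a = poly p a)"
    have q: "q \<in> polys_over R" "poly q a = poly p a"
      unfolding q_def using someI[of "\<lambda>q. q \<in> polys_over R \<and> poly q a = poly p a" p] p by auto
    have "poly (map_poly h (q - p)) z = 0"
      using q p by (intro assms polys_over_closed) auto
    moreover have "map_poly h q = map_poly h (q - p) + map_poly h p"
      using map_poly_hom(1)[OF polys_over_closed(5)[OF q(1) p] p] by simp
    ultimately show ?thesis unfolding h'_def q_def[symmetric] by simp
  qed
  have "hom_on (adjoin R a) h'"
    unfolding hom_on_def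
  proof (intro conjI ballI)
    have "h' (poly [:1:] a) = poly (map_poly h [:1:]) z"
      by (intro h' polys_over_closed subring_closed)
    also have "map_poly h [:1:] = [:1:]"
      by (rule poly_eqI) (simp add: coeff_map_poly hom_zero coeff_pCons hom_simps split: nat.split)
    finally show "h' 1 = 1" by simp
    fix b c assume "b \<in> adjoin R a" "c \<in> adjoin R a"
    then obtain p q where p: "p \<in> polys_over R" "b = poly p a" and q: "q \<in> polys_over R" "c = poly q a"
      by (auto simp: adjoin_def)
    show "h' (b + c) = h' b + h' c"
      using h'[OF polys_over_closed(4)[OF p(1) q(1)]] h'[OF p(1)] h'[OF q(1)]
      by (simp add: p q map_poly_hom)
    show "h' (b * c) = h' b * h' c"
      using h'[OF polys_over_closed(7)[OF p(1) q(1)]] h'[OF p(1)] h'[OF q(1)]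
      by (simp add: p q map_poly_hom)
  qed
  then show ?thesis using h' by blast
qed

end

end

text \<open>\<open>R\<close> is not a field, so instead of dividing by the leading coefficient of
  \<open>m\<close>, \<open>p\<close> is multiplied by a power of it.\<close>

lemma pseudo_division:
  fixes R :: "'a::idom set"
  assumes R: "subring_set R" and m: "m \<in> polys_over R" "m \<noteq> 0" and p: "p \<in> polys_over R"
  shows "\<exists>k q r. q \<in> polys_over R \<and> r \<in> polys_over R \<and>
    Polynomial.smult (lead_coeff m ^ k) p = m * q + r \<and> (r = 0 \<or> degree r < degree m)"
proof -
  note cl = polys_over_closed[OF R]
  have lR: "lead_coeff m \<in> R" using m by (simp add: polys_over_def)
  have "p = 0 \<or> degree p < n \<Longrightarrow> ?thesis" if "p \<in> polys_over R" for n
    using that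
  proof (induction n arbitrary: p)
    case 0
    then show ?case by (intro exI[of _ 0] exI[of _ 0]) (auto simp: cl)
  next
    case (Suc n)
    show ?case
    proof (cases "p = 0 \<or> degree p < degree m")
      case True
      then show ?thesis using Suc.prems by (intro exI[of _ 0] exI[of _ 0] exI[of _ p]) (auto simp: cl)
    next
      case False
      define s where "s = monom (lead_coeff p) (degree p - degree m)"
      define p' where "p' = Polynomial.smult (lead_coeff m) p - m * s"
      have sR: "s \<in> polys_over R" unfolding s_def using Suc.prems(2) by (intro cl) (simp add: polys_over_def)
      have p'R: "p' \<in> polys_over R" unfolding p'_def by (intro cl lR Suc.prems m sR)
      have s0: "s \<noteq> 0" using False by (simp add: s_def monom_eq_0_iff)
      have ds: "degree s = degree p - degree m" "lead_coeff s = lead_coeff p"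
        using False by (simp_all add: s_def degree_monom_eq)
      have dms: "degree (m * s) = degree p" using m(2) s0 False ds(1) by (simp add: degree_mult_eq)
      have "coeff (m * s) (degree p) = lead_coeff m * lead_coeff p"
        using lead_coeff_mult[of m s] dms ds(2) by simp
      then have "coeff p' (degree p) = 0" by (simp add: p'_def)
      moreover have "degree p' \<le> degree p"
        unfolding p'_def using dms by (intro degree_diff_le) (auto intro: degree_smult_le)
      ultimately have "p' = 0 \<or> degree p' < degree p"
        by (metis leading_coeff_0_iff order_le_imp_less_or_eq)
      then have "p' = 0 \<or> degree p' < n" using Suc.prems(1) False by linarith
      from Suc.IH[OF this p'R] obtain k q r where
        IH: "q \<in> polys_over R" "r \<in> polys_over R" "Polynomial.smult (lead_coeff m ^ k) p' = m * q + r"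
          "r = 0 \<or> degree r < degree m" by blast
      have "Polynomial.smult (lead_coeff m ^ Suc k) p = m * (q + Polynomial.smult (lead_coeff m ^ k) s) + r"
        using IH(3) by (simp add: p'_def smult_diff_right algebra_simps)
      moreover have "q + Polynomial.smult (lead_coeff m ^ k) s \<in> polys_over R"
        by (intro cl IH sR subring_power[OF R] lR)
      ultimately show ?thesis using IH by blast
    qed
  qed
  from this[OF p, of "Suc (degree p)"] show ?thesis by simp
qed

lemma least_degree:
  assumes "p \<in> S" "p \<noteq> 0"
  obtains m where "m \<in> S" "m \<noteq> 0" "\<And>q. q \<in> S \<Longrightarrow> q \<noteq> 0 \<Longrightarrow> degree m \<le> degree q"
  using ex_has_least_nat[of "\<lambda>p. p \<in> S \<and> p \<noteq> 0" p degree] assms by blast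

text \<open>Send \<open>a\<close> to a root \<open>z\<close> of the image of a polynomial
  \<open>m\<close> of least degree annihilating \<open>a\<close>. If \<open>h\<close> does not kill
  the leading coefficient of \<open>m\<close>, the image keeps positive degree and has a root, and
  pseudo-division shows that all polynomials vanishing at \<open>a\<close> have images vanishing at
  \<open>z\<close>. A second factor \<open>r\<close> keeps the image of \<open>poly p0 a\<close>
  non-zero.\<close>

lemma hom_extension_algebraic:
  fixes R :: "'a::idom set"
  assumes R: "subring_set R" and p0: "p0 \<in> polys_over R" "poly p0 a \<noteq> 0"
    and alg: "p1 \<in> polys_over R" "p1 \<noteq> 0" "poly p1 a = 0"
  shows "\<exists>r\<in>R. r \<noteq> 0 \<and> (\<forall>h :: 'a \<Rightarrow> 'b::alg_closed_field. hom_on R h \<and> h r \<noteq> 0 \<longrightarrow>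
    (\<exists>h'. hom_on (adjoin R a) h' \<and> (\<forall>c\<in>R. h' c = h c) \<and> h' (poly p0 a) \<noteq> 0))"
proof -
  note cl = polys_over_closed[OF R]
  obtain m where m: "m \<in> polys_over R" "poly m a = 0" "m \<noteq> 0"
    and min: "\<And>q. q \<in> polys_over R \<Longrightarrow> poly q a = 0 \<Longrightarrow> q \<noteq> 0 \<Longrightarrow> degree m \<le> degree q"
  proof -
    obtain m where "m \<in> {p \<in> polys_over R. poly p a = 0}" "m \<noteq> 0"
      "\<And>q. q \<in> {p \<in> polys_over R. poly p a = 0} \<Longrightarrow> q \<noteq> 0 \<Longrightarrow> degree m \<le> degree q"
      by (rule least_degree[of p1 "{p \<in> polys_over R. poly p a = 0}"]) (use alg in simp_all)
    then show thesis by (intro that[of m]) simp_all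
  qed
  have lR: "lead_coeff m \<in> R" using m by (simp add: polys_over_def)
  have mdeg: "degree m > 0"
  proof (rule ccontr)
    assume "\<not> degree m > 0"
    then obtain c where "m = [:c:]" using degree_eq_zeroE by blast
    then show False using m by simp
  qed
  \<comment> \<open>An element \<open>g\<close> of least degree in the ideal generated by \<open>p0\<close> and the minimal polynomial \<open>m\<close>
    turns out to be a constant \<open>r = poly u a * poly p0 a\<close>, so the image of \<open>poly p0 a\<close> is non-zero if that
    of \<open>r\<close> is.\<close>
  define I where "I = {u * p0 + v * m | u v. u \<in> polys_over R \<and> v \<in> polys_over R}"
  have mI: "m \<in> I" unfolding I_def
    by (intro CollectI exI[of _ 0] exI[of _ "[:1:]"]) (auto intro: cl subring_closed[OF R])
  have p0I: "p0 \<in> I" unfolding I_def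
    by (intro CollectI exI[of _ 0] exI[of _ "[:1:]"]) (auto intro: cl subring_closed[OF R])
  have IR: "q \<in> polys_over R" if "q \<in> I" for q
    using that unfolding I_def by (auto intro!: cl m p0)
  have Iclosed: "Polynomial.smult c q - g * s \<in> I" if qg: "q \<in> I" "g \<in> I" and cs: "c \<in> R" "s \<in> polys_over R" for q g c s
  proof -
    obtain u v u' v' where q: "q = u * p0 + v * m" "u \<in> polys_over R" "v \<in> polys_over R"
      and g: "g = u' * p0 + v' * m" "u' \<in> polys_over R" "v' \<in> polys_over R"
      using qg unfolding I_def by blast
    have "Polynomial.smult c q - g * s = (Polynomial.smult c u - u' * s) * p0 + (Polynomial.smult c v - v' * s) * m"
      unfolding q g by (simp add: algebra_simps smult_add_right)
    moreover have "Polynomial.smult c u - u' * s \<in> polys_over R" "Polynomial.smult c v - v' * s \<in> polys_over R"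
      using q g cs by (auto intro!: cl)
    ultimately show ?thesis unfolding I_def by blast
  qed
  obtain g where g: "g \<in> I" "g \<noteq> 0" and gmin: "\<And>q. q \<in> I \<Longrightarrow> q \<noteq> 0 \<Longrightarrow> degree g \<le> degree q"
    using least_degree[OF mI m(3)] by blast
  have gR: "g \<in> polys_over R" by (rule IR[OF g(1)])
  have divides: "\<exists>k s. s \<in> polys_over R \<and> Polynomial.smult (lead_coeff g ^ k) q = g * s" if q: "q \<in> I" for q
  proof -
    obtain k s r where kr: "s \<in> polys_over R" "Polynomial.smult (lead_coeff g ^ k) q = g * s + r"
        "r = 0 \<or> degree r < degree g"
      using pseudo_division[OF R gR g(2) IR[OF q]] by blast
    have "lead_coeff g ^ k \<in> R" using gR by (intro subring_power[OF R]) (simp add: polys_over_def)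
    from Iclosed[OF q g(1) this kr(1)] have "r \<in> I" using kr(2) by simp
    then have "r = 0" using gmin[of r] kr(3) by (metis not_less)
    then show ?thesis using kr by auto
  qed
  obtain k s where ks: "s \<in> polys_over R" "Polynomial.smult (lead_coeff g ^ k) m = g * s"
    using divides[OF mI] by blast
  have "poly g a \<noteq> 0"
  proof
    assume ga: "poly g a = 0"
    obtain k s where "Polynomial.smult (lead_coeff g ^ k) p0 = g * s" using divides[OF p0I] by blast
    from arg_cong[OF this, of "\<lambda>p. poly p a"] show False using ga p0(2) g(2) by simp
  qed
  then have "poly s a = 0" using arg_cong[OF ks(2), of "\<lambda>p. poly p a"] m(2) by simp
  moreover have s0: "s \<noteq> 0" using ks(2) m(3) g(2) by auto
  ultimately have "degree m \<le> degree s" using min ks(1) by blast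
  moreover have "degree m = degree g + degree s"
    using arg_cong[OF ks(2), of degree] g(2) s0 by (simp add: degree_mult_eq)
  ultimately have "degree g = 0" by simp
  then obtain r where r: "g = [:r:]" using degree_eq_zeroE by blast
  have rR: "r \<in> R" using gR r by (auto simp: polys_over_def dest: spec[of _ 0])
  obtain u v where uv: "u \<in> polys_over R" "v \<in> polys_over R" "g = u * p0 + v * m"
    using g(1) unfolding I_def by auto
  have ub: "poly u a * poly p0 a = r"
    using arg_cong[OF uv(3), of "\<lambda>p. poly p a"] m(2) r by simp
  show ?thesis
  proof (intro bexI[of _ "lead_coeff m * r"] conjI allI impI; (elim conjE)?)
    show "lead_coeff m * r \<noteq> 0" using m(3) g(2) r by simp
    show "lead_coeff m * r \<in> R" by (rule subring_closed(4)[OF R lR rR])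
    fix h :: "'a \<Rightarrow> 'b" assume h: "hom_on R h" and nz: "h (lead_coeff m * r) \<noteq> 0"
    have nz: "h (lead_coeff m) \<noteq> 0" "h r \<noteq> 0"
      using nz hom_simps(3)[OF R h lR rR] by auto
    let ?M = "map_poly h m"
    have "coeff ?M (degree m) \<noteq> 0" using nz(1) by (simp add: coeff_map_poly hom_zero[OF R h])
    then have "degree ?M \<ge> degree m" by (rule le_degree)
    then have "degree ?M > 0" using mdeg by simp
    then obtain z where z: "poly ?M z = 0" using alg_closed_imp_poly_has_root by blast
    have van: "poly (map_poly h p) z = 0" if p: "p \<in> polys_over R" "poly p a = 0" for p
    proof -
      obtain k q s where kq: "q \<in> polys_over R" "s \<in> polys_over R"
          "Polynomial.smult (lead_coeff m ^ k) p = m * q + s" "s = 0 \<or> degree s < degree m"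
        using pseudo_division[OF R m(1,3) p(1)] by blast
      have "poly s a = 0" using arg_cong[OF kq(3), of "\<lambda>p. poly p a"] p(2) m(2) by simp
      then have "s = 0" using min[OF kq(2)] kq(4) by (metis not_less)
      then have e: "[:lead_coeff m ^ k:] * p = m * q" using kq(3) by simp
      have lk: "lead_coeff m ^ k \<in> R" by (rule subring_power[OF R lR])
      have "map_poly h [:lead_coeff m ^ k:] * map_poly h p = ?M * map_poly h q"
        using arg_cong[OF e, of "map_poly h"]
          map_poly_hom(2)[OF R h cl(2)[OF lk] p(1)] map_poly_hom(2)[OF R h m(1) kq(1)] by simp
      from arg_cong[OF this, of "\<lambda>p. poly p z"]
      have "poly (map_poly h [:lead_coeff m ^ k:]) z * poly (map_poly h p) z = 0" using z by simp
      moreover have "map_poly h [:lead_coeff m ^ k:] = [:h (lead_coeff m) ^ k:]"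
        by (rule poly_eqI)
          (simp add: coeff_map_poly hom_zero[OF R h] coeff_pCons hom_power[OF R h lR] split: nat.split)
      ultimately show ?thesis using nz(1) by simp
    qed
    obtain h' where h': "hom_on (adjoin R a) h'"
      "\<And>p. p \<in> polys_over R \<Longrightarrow> h' (poly p a) = poly (map_poly h p) z"
      using extend_hom[OF R h van] by blast
    have ext: "h' c = h c" if "c \<in> R" for c
    proof -
      have "map_poly h [:c:] = [:h c:]"
        by (rule poly_eqI) (simp add: coeff_map_poly hom_zero[OF R h] coeff_pCons split: nat.split)
      then show ?thesis using h'(2)[OF cl(2)[OF that]] by simp
    qed
    have "h' (poly u a) * h' (poly p0 a) = h' r"
    proof -
      have "poly u a \<in> adjoin R a" "poly p0 a \<in> adjoin R a" using uv(1) p0(1) by (auto simp: adjoin_def)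
      then show ?thesis using h'(1) by (simp add: hom_on_def flip: ub)
    qed
    then have "h' (poly p0 a) \<noteq> 0" using ext[OF rR] nz(2) by auto
    then show "\<exists>h'. hom_on (adjoin R a) h' \<and> (\<forall>c\<in>R. h' c = h c) \<and> h' (poly p0 a) \<noteq> 0"
      using h'(1) ext by blast
  qed
qed

text \<open>Here any \<open>z\<close> gives an extension; choose one off the finitely many roots of
  the image of \<open>p0\<close>.\<close>

lemma hom_extension_transcendental:
  fixes R :: "'a::idom set"
  assumes R: "subring_set R" and p0: "p0 \<in> polys_over R" "poly p0 a \<noteq> 0"
    and tr: "\<And>p. p \<in> polys_over R \<Longrightarrow> poly p a = 0 \<Longrightarrow> p = 0"
  shows "\<exists>r\<in>R. r \<noteq> 0 \<and> (\<forall>h :: 'a \<Rightarrow> 'b::field_char_0. hom_on R h \<and> h r \<noteq> 0 \<longrightarrow>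
    (\<exists>h'. hom_on (adjoin R a) h' \<and> (\<forall>c\<in>R. h' c = h c) \<and> h' (poly p0 a) \<noteq> 0))"
proof (intro bexI[of _ "lead_coeff p0"] conjI allI impI; (elim conjE)?)
  show "lead_coeff p0 \<noteq> 0" using p0(2) by auto
  show "lead_coeff p0 \<in> R" using p0(1) by (simp add: polys_over_def)
  fix h :: "'a \<Rightarrow> 'b" assume h: "hom_on R h" and nz: "h (lead_coeff p0) \<noteq> 0"
  have "coeff (map_poly h p0) (degree p0) \<noteq> 0" using nz by (simp add: coeff_map_poly hom_zero[OF R h])
  then have "map_poly h p0 \<noteq> 0" by auto
  then have "finite {z. poly (map_poly h p0) z = 0}" by (rule poly_roots_finite)
  then obtain z where z: "poly (map_poly h p0) z \<noteq> 0"
    using ex_new_if_finite[OF infinite_UNIV_char_0] by blast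
  have van: "poly (map_poly h p) z = 0" if p: "p \<in> polys_over R" "poly p a = 0" for p
    using tr[OF p] by simp
  obtain h' where h': "hom_on (adjoin R a) h'"
    "\<And>p. p \<in> polys_over R \<Longrightarrow> h' (poly p a) = poly (map_poly h p) z"
    using extend_hom[OF R h van] by blast
  have ext: "h' c = h c" if "c \<in> R" for c
  proof -
    have "map_poly h [:c:] = [:h c:]"
      by (rule poly_eqI) (simp add: coeff_map_poly hom_zero[OF R h] coeff_pCons split: nat.split)
    then show ?thesis using h'(2)[OF polys_over_closed(2)[OF R that]] by simp
  qed
  show "\<exists>h'. hom_on (adjoin R a) h' \<and> (\<forall>c\<in>R. h' c = h c) \<and> h' (poly p0 a) \<noteq> 0"
    using h' ext z p0(1) by metis
qed

lemma hom_extension: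
  fixes R :: "'a::idom set"
  assumes R: "subring_set R" and b: "b \<in> adjoin R a" "b \<noteq> 0"
  shows "\<exists>r\<in>R. r \<noteq> 0 \<and> (\<forall>h :: 'a \<Rightarrow> 'b::{alg_closed_field, field_char_0}. hom_on R h \<and> h r \<noteq> 0 \<longrightarrow>
    (\<exists>h'. hom_on (adjoin R a) h' \<and> (\<forall>c\<in>R. h' c = h c) \<and> h' b \<noteq> 0))"
proof -
  obtain p0 where "p0 \<in> polys_over R" "b = poly p0 a" using b(1) by (auto simp: adjoin_def)
  then show ?thesis
    using hom_extension_algebraic[OF R, of p0 a] hom_extension_transcendental[OF R, of p0 a] b(2) by metis
qed

fun adjoin_list :: "'a::comm_ring_1 set \<Rightarrow> 'a list \<Rightarrow> 'a set" where
  "adjoin_list R [] = R"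
| "adjoin_list R (a # as) = adjoin_list (adjoin R a) as"

lemma adjoin_list_subring: "subring_set R \<Longrightarrow> subring_set (adjoin_list R as)"
  by (induction as arbitrary: R) (auto simp: adjoin_subring)

lemma adjoin_list_contains: "subring_set R \<Longrightarrow> R \<subseteq> adjoin_list R as \<and> set as \<subseteq> adjoin_list R as"
proof (induction as arbitrary: R)
  case (Cons a as)
  from Cons.IH[OF adjoin_subring[OF Cons.prems]] adjoin_contains[OF Cons.prems] show ?case by fastforce
qed simp

text \<open>The requirement that \<open>b\<close> survive is pushed down through the generators,
  each time becoming the requirement that one non-zero element of the smaller ring survive.\<close>

lemma hom_extension_list:
  fixes R :: "'a::idom set"
  assumes "subring_set R" and "b \<in> adjoin_list R as" "b \<noteq> 0"
  shows "\<exists>r\<in>R. r \<noteq> 0 \<and> (\<forall>h :: 'a \<Rightarrow> 'b::{alg_closed_field, field_char_0}. hom_on R h \<and> h r \<noteq> 0 \<longrightarrow>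
    (\<exists>h'. hom_on (adjoin_list R as) h' \<and> (\<forall>c\<in>R. h' c = h c) \<and> h' b \<noteq> 0))"
  using assms
proof (induction as arbitrary: R)
  case Nil
  then show ?case by (intro bexI[of _ b]) auto
next
  case (Cons a as)
  note R = Cons.prems(1)
  have "b \<in> adjoin_list (adjoin R a) as" using Cons.prems(2) by simp
  from Cons.IH[OF adjoin_subring[OF R] this Cons.prems(3)]
  obtain s where s: "s \<in> adjoin R a" "s \<noteq> 0"
    "\<And>h :: 'a \<Rightarrow> 'b. hom_on (adjoin R a) h \<Longrightarrow> h s \<noteq> 0 \<Longrightarrow>
      \<exists>h'. hom_on (adjoin_list (adjoin R a) as) h' \<and> (\<forall>c\<in>adjoin R a. h' c = h c) \<and> h' b \<noteq> 0"
    by blast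
  obtain r where r: "r \<in> R" "r \<noteq> 0"
    "\<And>h :: 'a \<Rightarrow> 'b. hom_on R h \<Longrightarrow> h r \<noteq> 0 \<Longrightarrow>
      \<exists>h'. hom_on (adjoin R a) h' \<and> (\<forall>c\<in>R. h' c = h c) \<and> h' s \<noteq> 0"
    using hom_extension[OF R s(1,2)] by blast
  show ?case
  proof (intro bexI[of _ r] conjI allI impI r(1,2); elim conjE)
    fix h :: "'a \<Rightarrow> 'b" assume "hom_on R h" "h r \<noteq> 0"
    from r(3)[OF this] obtain h1 where h1: "hom_on (adjoin R a) h1" "\<forall>c\<in>R. h1 c = h c" "h1 s \<noteq> 0"
      by blast
    from s(3)[OF h1(1,3)] obtain h2 where
      "hom_on (adjoin_list (adjoin R a) as) h2" "\<forall>c\<in>adjoin R a. h2 c = h1 c" "h2 b \<noteq> 0" by blast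
    then show "\<exists>h'. hom_on (adjoin_list R (a # as)) h' \<and> (\<forall>c\<in>R. h' c = h c) \<and> h' b \<noteq> 0"
      using h1 adjoin_contains(1)[OF R, of a] by (intro exI[of _ h2]) auto
  qed
qed

text \<open>This evaluates finitely many power series at \<open>t\<close> without convergence: a
  ring homomorphism replaces substitution. The base ring consists of the polynomials, so the
  obstruction \<open>r\<close> is a polynomial, and \<open>F\<close> is its set of roots.\<close>

lemma fps_specialization:
  fixes as :: "'k::{alg_closed_field, field_char_0} fps list"
  shows "\<exists>B F. subring_set B \<and> set as \<subseteq> B \<and> range fps_of_poly \<subseteq> B \<and> finite F \<and>
    (\<forall>t. t \<notin> F \<longrightarrow> (\<exists>h. hom_on B h \<and> (\<forall>p. h (fps_of_poly p) = poly p t)))"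
proof -
  let ?R = "range (fps_of_poly :: 'k poly \<Rightarrow> 'k fps)"
  have R: "subring_set ?R"
    unfolding subring_set_def image_def
    by (auto simp flip: fps_of_poly_0 fps_of_poly_1 fps_of_poly_add fps_of_poly_mult fps_of_poly_uminus)
  \<comment> \<open>Taking \<open>b = 1\<close> asks for nothing but the existence of the
    extension.\<close>
  have one: "1 \<in> adjoin_list ?R as" "(1::'k fps) \<noteq> 0"
    using subring_closed(2)[OF adjoin_list_subring[OF R]] by auto
  from hom_extension_list[OF R one] obtain r where r: "r \<in> ?R" "r \<noteq> 0"
    "\<And>h :: 'k fps \<Rightarrow> 'k. hom_on ?R h \<Longrightarrow> h r \<noteq> 0 \<Longrightarrow>
      \<exists>h'. hom_on (adjoin_list ?R as) h' \<and> (\<forall>c\<in>?R. h' c = h c)" by blast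
  obtain p where p: "r = fps_of_poly p" using r(1) by blast
  have "p \<noteq> 0" using r(2) p by auto
  then have fin: "finite {t. poly p t = 0}" by (rule poly_roots_finite)
  have inj: "inj (fps_of_poly :: 'k poly \<Rightarrow> 'k fps)" by (rule injI) (simp add: fps_of_poly_eq_iff)
  have "\<exists>h. hom_on (adjoin_list ?R as) h \<and> (\<forall>p. h (fps_of_poly p) = poly p t)"
    if t: "t \<notin> {t. poly p t = 0}" for t
  proof -
    define h where "h c = poly (inv_into UNIV fps_of_poly c) t" for c
    have h: "h (fps_of_poly q) = poly q t" for q by (simp add: h_def inv_f_f[OF inj])
    have "hom_on ?R h"
      unfolding hom_on_def using h[of 1]
      by (auto simp: h simp flip: fps_of_poly_add fps_of_poly_mult)
    moreover have "h r \<noteq> 0" using t p h by simp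
    ultimately obtain h' where "hom_on (adjoin_list ?R as) h'" "\<forall>c\<in>?R. h' c = h c" using r(3) by blast
    then show ?thesis using h by auto
  qed
  then show ?thesis
    using adjoin_list_subring[OF R, of as] adjoin_list_contains[OF R, of as] fin by blast
qed

section \<open>Formal flows\<close>

text \<open>Coefficient \<open>n + 1\<close> of each series is determined by the coefficients up to
  \<open>n\<close> of other members of the family. \<open>I\<close> may be infinite, so a family
  closed under differentiation can be used whole, without choosing generators.\<close>

lemma linear_fps_system_zero:
  fixes U :: "'i \<Rightarrow> 'k::field_char_0 fps"
  assumes zero: "\<And>i. i \<in> I \<Longrightarrow> fps_nth (U i) 0 = 0"
    and deriv: "\<And>i. i \<in> I \<Longrightarrow> \<exists>g. (\<forall>c\<in>C. g c \<in> I) \<and> fps_deriv (U i) = (\<Sum>c\<in>C. \<eta> c * U (g c))"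
    and "i \<in> I"
  shows "U i = 0"
proof -
  have "\<forall>i\<in>I. \<forall>j\<le>n. fps_nth (U i) j = 0" for n
  proof (induction n)
    case 0
    then show ?case using zero by simp
  next
    case (Suc n)
    have "fps_nth (U i) (Suc n) = 0" if i: "i \<in> I" for i
    proof -
      obtain g where g: "\<forall>c\<in>C. g c \<in> I" "fps_deriv (U i) = (\<Sum>c\<in>C. \<eta> c * U (g c))"
        using deriv[OF i] by blast
      have "of_nat (Suc n) * fps_nth (U i) (Suc n) = fps_nth (fps_deriv (U i)) n" by simp
      also have "\<dots> = (\<Sum>c\<in>C. \<Sum>j=0..n. fps_nth (\<eta> c) j * fps_nth (U (g c)) (n - j))"
        unfolding g(2) by (simp add: fps_sum_nth fps_mult_nth)
      also have "\<dots> = 0" using Suc g(1) by (intro sum.neutral ballI) simp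
      finally show ?thesis by (metis mult_eq_0_iff of_nat_eq_0_iff nat.distinct(1))
    qed
    then show ?case using Suc by (auto simp: le_Suc_eq)
  qed
  then show ?thesis using assms(3) by (auto simp: fps_eq_iff)
qed

text \<open>Coefficients of the exponential of the integral of \<open>l\<close>: the recursion is
  \<open>D' = l D\<close> with \<open>D(0) = 1\<close>.\<close>

fun exp_coeff :: "'k::field_char_0 fps \<Rightarrow> nat \<Rightarrow> 'k" where
  "exp_coeff l 0 = 1"
| "exp_coeff l (Suc n) = (\<Sum>i\<le>n. fps_nth l i * exp_coeff l (n - i)) / of_nat (Suc n)"

lemma exp_coeff_deriv: "fps_deriv (Abs_fps (exp_coeff l)) = l * Abs_fps (exp_coeff l)"
  by (rule fps_ext) (simp add: fps_mult_nth atMost_atLeast0 del: of_nat_Suc)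

lemma polyfuns_sum: "(\<And>i. i \<in> I \<Longrightarrow> p i \<in> polyfuns \<Phi>) \<Longrightarrow> (\<lambda>v. \<Sum>i\<in>I. p i v) \<in> polyfuns \<Phi>"
  by (induction I rule: infinite_finite_induct) (auto intro: polyfuns.intros)

text \<open>\<open>formal \<Phi> cf P Q\<close>: \<open>Q\<close> is a value of the polynomial function \<open>P\<close> at the formal curve with coordinates
  \<open>cf\<close>. It is a relation because \<open>P\<close> is a function, not a polynomial expression.\<close>

inductive formal :: "('g \<Rightarrow> 'k) set \<Rightarrow> (('g \<Rightarrow> 'k) \<Rightarrow> 'g \<Rightarrow> 'k fps) \<Rightarrow> (('g \<Rightarrow> 'g) \<Rightarrow> 'k::field) \<Rightarrow> 'k fps \<Rightarrow> bool"
  for \<Phi> cf where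
  coord: "\<phi> \<in> \<Phi> \<Longrightarrow> formal \<Phi> cf (\<lambda>A. \<phi> (A v)) (cf \<phi> v)"
| const: "formal \<Phi> cf (\<lambda>_. c) (fps_const c)"
| add: "formal \<Phi> cf P Q \<Longrightarrow> formal \<Phi> cf P' Q' \<Longrightarrow> formal \<Phi> cf (\<lambda>A. P A + P' A) (Q + Q')"
| mult: "formal \<Phi> cf P Q \<Longrightarrow> formal \<Phi> cf P' Q' \<Longrightarrow> formal \<Phi> cf (\<lambda>A. P A * P' A) (Q * Q')"

context fd_lie_algebra
begin

abbreviation "LF \<equiv> linear_functionals sc"

lemma LF_lin:
  assumes "\<phi> \<in> LF"
  shows "\<phi> (u + v) = \<phi> u + \<phi> v" "\<phi> (sc r v) = r * \<phi> v" "\<phi> (sum g I) = (\<Sum>i\<in>I. \<phi> (g i))"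
    "\<phi> 0 = 0"
proof -
  interpret Vector_Spaces.linear sc "(*)" \<phi> using assms by (simp add: linear_functionals_def)
  show "\<phi> (u + v) = \<phi> u + \<phi> v" by (rule add)
  show "\<phi> (sc r v) = r * \<phi> v" by (rule scale)
  show "\<phi> (sum g I) = (\<Sum>i\<in>I. \<phi> (g i))" by (rule sum)
  show "\<phi> 0 = 0" by (rule zero)
qed

lemma LF_br:
  assumes "\<phi> \<in> LF"
  shows "(\<lambda>v. \<phi> (br c v)) \<in> LF"
  unfolding linear_functionals_def
  by (simp add: Vector_Spaces.linear_iff vector_space_axioms vector_space_mult br_lin LF_lin(1,2)[OF assms])

lemma LF_rep: "(\<lambda>v. representation Bas v b) \<in> LF"
  using rep_linear by (simp add: linear_functionals_def)

lemma LF_separating: "(\<And>\<phi>. \<phi> \<in> LF \<Longrightarrow> \<phi> u = \<phi> v) \<Longrightarrow> u = v"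
  using rep_eqI LF_rep by metis

text \<open>The coefficients of the formal solution of \<open>A' = (\<Sum>c\<in>C. \<eta> c * ad c) A\<close> with \<open>A(0) = id\<close>.\<close>

fun flow :: "'g set \<Rightarrow> ('g \<Rightarrow> 'k fps) \<Rightarrow> nat \<Rightarrow> 'g \<Rightarrow> 'g" where
  "flow C \<eta> 0 v = v"
| "flow C \<eta> (Suc n) v =
    sc (1 / of_nat (Suc n)) (\<Sum>c\<in>C. \<Sum>i\<le>n. sc (fps_nth (\<eta> c) i) (br c (flow C \<eta> (n - i) v)))"

lemma flow_linear: "flow C \<eta> n (u + v) = flow C \<eta> n u + flow C \<eta> n v"
    "flow C \<eta> n (sc r v) = sc r (flow C \<eta> n v)"
proof (induction n rule: less_induct)
  case (less n)
  { case 1 show ?case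
    proof (cases n)
      case (Suc m)
      then show ?thesis using less
        by (simp add: br_lin scale_right_distrib sum.distrib del: of_nat_Suc)
    qed simp }
  { case 2 show ?case
    proof (cases n)
      case (Suc m)
      then show ?thesis using less
        by (simp add: br_lin scale_sum_right mult.commute mult.left_commute del: of_nat_Suc)
    qed simp }
qed

definition flowf :: "'g set \<Rightarrow> ('g \<Rightarrow> 'k fps) \<Rightarrow> ('g \<Rightarrow> 'k) \<Rightarrow> 'g \<Rightarrow> 'k fps" where
  "flowf C \<eta> \<phi> v = Abs_fps (\<lambda>n. \<phi> (flow C \<eta> n v))"

text \<open>Transferring \<open>ad c\<close> from the curve to the functional keeps the system
  within linear functionals, as \<open>linear_fps_system_zero\<close> needs.\<close>

lemma flowf_deriv:
  assumes "\<phi> \<in> LF"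
  shows "fps_deriv (flowf C \<eta> \<phi> v) = (\<Sum>c\<in>C. \<eta> c * flowf C \<eta> (\<lambda>v. \<phi> (br c v)) v)"
  by (rule fps_ext)
    (simp add: flowf_def LF_lin[OF assms] fps_sum_nth fps_mult_nth atMost_atLeast0 del: of_nat_Suc)

lemma formal_polyfun: "formal LF cf P Q \<Longrightarrow> P \<in> polyfuns (matrix_coeffs sc)"
proof (induction rule: formal.induct)
  case (coord \<phi> v)
  then show ?case by (intro polyfuns.coord) (auto simp: matrix_coeffs_def)
qed (auto intro: polyfuns.intros)

lemma polyfun_formal: "P \<in> polyfuns (matrix_coeffs sc) \<Longrightarrow> \<exists>Q. formal LF cf P Q"
  by (induction rule: polyfuns.induct) (auto simp: matrix_coeffs_def intro: formal.intros)

lemma polyfun_translate: "P \<in> polyfuns (matrix_coeffs sc) \<Longrightarrow> (\<lambda>Y. P (Y \<circ> X)) \<in> polyfuns (matrix_coeffs sc)"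
proof (induction rule: polyfuns.induct)
  case (coord \<phi>)
  then obtain \<psi> v where "\<phi> = (\<lambda>A. \<psi> (A v))" "\<psi> \<in> LF" by (auto simp: matrix_coeffs_def)
  then show ?case by (intro polyfuns.coord) (auto simp: matrix_coeffs_def)
qed (auto intro: polyfuns.intros)

text \<open>\<open>P' c X\<close> is the derivative of \<open>P\<close> at \<open>X\<close> in the
  direction \<open>ad c\<close> composed with \<open>X\<close>. It is recorded through a polynomial
  \<open>q\<close> to match \<open>lie_of_group\<close>. The point is that \<open>P' c\<close> is
  again a polynomial function with a formal value.\<close>

lemma formal_deriv:
  assumes "formal LF (flowf C \<eta>) P Q"
  shows "\<exists>P' Q'. (\<forall>c\<in>C. formal LF (flowf C \<eta>) (P' c) (Q' c)) \<and>
    fps_deriv Q = (\<Sum>c\<in>C. \<eta> c * Q' c) \<and>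
    (\<forall>c X. \<exists>q. (\<forall>t. poly q t = P (\<lambda>v. X v + sc t (br c (X v)))) \<and> coeff q 0 = P X \<and> coeff q 1 = P' c X)"
  using assms
proof (induction rule: formal.induct)
  case (coord \<phi> v)
  note l = LF_lin[OF coord]
  have q: "\<exists>q. (\<forall>t. poly q t = \<phi> (X v + sc t (br c (X v)))) \<and> coeff q 0 = \<phi> (X v) \<and> coeff q 1 = \<phi> (br c (X v))"
    for c X
    by (rule exI[of _ "[:\<phi> (X v), \<phi> (br c (X v)):]"]) (simp add: l)
  have "\<forall>c\<in>C. formal LF (flowf C \<eta>) (\<lambda>A. \<phi> (br c (A v))) (flowf C \<eta> (\<lambda>v. \<phi> (br c v)) v)"
    using formal.coord[OF LF_br[OF coord], of "flowf C \<eta>" _ v] by blast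
  then show ?case using q flowf_deriv[OF coord, of C \<eta> v]
    by (intro exI[of _ "\<lambda>c A. \<phi> (br c (A v))"] exI[of _ "\<lambda>c. flowf C \<eta> (\<lambda>v. \<phi> (br c v)) v"]) blast
next
  case (const a)
  have "\<exists>q. (\<forall>t. poly q t = a) \<and> coeff q 0 = a \<and> coeff q 1 = 0" by (rule exI[of _ "[:a:]"]) simp
  then show ?case using formal.const[of LF "flowf C \<eta>" 0]
    by (intro exI[of _ "\<lambda>_ _. 0"] exI[of _ "\<lambda>_. 0"]) auto
next
  case (add P Q R S)
  then obtain P' Q' R' S' where
    P': "\<forall>c\<in>C. formal LF (flowf C \<eta>) (P' c) (Q' c)" "fps_deriv Q = (\<Sum>c\<in>C. \<eta> c * Q' c)"
      "\<And>c X. \<exists>q. (\<forall>t. poly q t = P (\<lambda>v. X v + sc t (br c (X v)))) \<and> coeff q 0 = P X \<and> coeff q 1 = P' c X" and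
    R': "\<forall>c\<in>C. formal LF (flowf C \<eta>) (R' c) (S' c)" "fps_deriv S = (\<Sum>c\<in>C. \<eta> c * S' c)"
      "\<And>c X. \<exists>q. (\<forall>t. poly q t = R (\<lambda>v. X v + sc t (br c (X v)))) \<and> coeff q 0 = R X \<and> coeff q 1 = R' c X"
    by blast
  have "\<exists>q. (\<forall>t. poly q t = P (\<lambda>v. X v + sc t (br c (X v))) + R (\<lambda>v. X v + sc t (br c (X v)))) \<and>
    coeff q 0 = P X + R X \<and> coeff q 1 = P' c X + R' c X" for c X
  proof -
    obtain q1 q2 where "(\<forall>t. poly q1 t = P (\<lambda>v. X v + sc t (br c (X v)))) \<and> coeff q1 0 = P X \<and> coeff q1 1 = P' c X"
      "(\<forall>t. poly q2 t = R (\<lambda>v. X v + sc t (br c (X v)))) \<and> coeff q2 0 = R X \<and> coeff q2 1 = R' c X"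
      using P'(3)[of X c] R'(3)[of X c] by blast
    then show ?thesis by (intro exI[of _ "q1 + q2"]) simp
  qed
  moreover have "\<forall>c\<in>C. formal LF (flowf C \<eta>) (\<lambda>A. P' c A + R' c A) (Q' c + S' c)"
    using P'(1) R'(1) by (auto intro: formal.add)
  moreover have "fps_deriv (Q + S) = (\<Sum>c\<in>C. \<eta> c * (Q' c + S' c))"
    by (simp add: P'(2) R'(2) distrib_left sum.distrib)
  ultimately show ?case
    by (intro exI[of _ "\<lambda>c A. P' c A + R' c A"] exI[of _ "\<lambda>c. Q' c + S' c"]) blast
next
  case (mult P Q R S)
  then obtain P' Q' R' S' where
    P': "\<forall>c\<in>C. formal LF (flowf C \<eta>) (P' c) (Q' c)" "fps_deriv Q = (\<Sum>c\<in>C. \<eta> c * Q' c)"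
      "\<And>c X. \<exists>q. (\<forall>t. poly q t = P (\<lambda>v. X v + sc t (br c (X v)))) \<and> coeff q 0 = P X \<and> coeff q 1 = P' c X" and
    R': "\<forall>c\<in>C. formal LF (flowf C \<eta>) (R' c) (S' c)" "fps_deriv S = (\<Sum>c\<in>C. \<eta> c * S' c)"
      "\<And>c X. \<exists>q. (\<forall>t. poly q t = R (\<lambda>v. X v + sc t (br c (X v)))) \<and> coeff q 0 = R X \<and> coeff q 1 = R' c X"
    by blast
  have "\<exists>q. (\<forall>t. poly q t = P (\<lambda>v. X v + sc t (br c (X v))) * R (\<lambda>v. X v + sc t (br c (X v)))) \<and>
    coeff q 0 = P X * R X \<and> coeff q 1 = P' c X * R X + P X * R' c X" for c X
  proof -
    obtain q1 q2 where "(\<forall>t. poly q1 t = P (\<lambda>v. X v + sc t (br c (X v)))) \<and> coeff q1 0 = P X \<and> coeff q1 1 = P' c X"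
      "(\<forall>t. poly q2 t = R (\<lambda>v. X v + sc t (br c (X v)))) \<and> coeff q2 0 = R X \<and> coeff q2 1 = R' c X"
      using P'(3)[of X c] R'(3)[of X c] by blast
    then show ?thesis by (intro exI[of _ "q1 * q2"]) (simp add: coeff_mult)
  qed
  moreover have "\<forall>c\<in>C. formal LF (flowf C \<eta>) (\<lambda>A. P' c A * R A + P A * R' c A) (Q' c * S + Q * S' c)"
    using P'(1) R'(1) mult.hyps by (intro ballI formal.add formal.mult) simp_all
  moreover have "fps_deriv (Q * S) = (\<Sum>c\<in>C. \<eta> c * (Q' c * S + Q * S' c))"
    by (simp add: P'(2) R'(2) distrib_left sum.distrib sum_distrib_left sum_distrib_right algebra_simps)
  ultimately show ?case
    by (intro exI[of _ "\<lambda>c A. P' c A * R A + P A * R' c A"] exI[of _ "\<lambda>c. Q' c * S + Q * S' c"]) blast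
qed

lemma formal_constant_term: "formal LF (flowf C \<eta>) P Q \<Longrightarrow> fps_nth Q 0 = P id"
  by (induction rule: formal.induct) (simp_all add: flowf_def fps_mult_nth)

text \<open>The polynomial functions vanishing on \<open>H\<close> are closed under \<open>P\<close>
  to \<open>P' c\<close>, so their formal values satisfy a linear system with zero initial
  values.\<close>

lemma formal_vanish:
  assumes H: "id \<in> H" "\<And>A B. A \<in> H \<Longrightarrow> B \<in> H \<Longrightarrow> A \<circ> B \<in> H"
    and lie: "\<And>c. c \<in> C \<Longrightarrow> br c \<in> lie_of_group sc H"
    and f: "formal LF (flowf C \<eta>) P Q" and van: "\<And>A. A \<in> H \<Longrightarrow> P A = 0"
  shows "Q = 0"
proof -
  let ?I = "{(P, Q). formal LF (flowf C \<eta>) P Q \<and> (\<forall>A\<in>H. P A = 0)}"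
  have "snd (P, Q) = 0"
  proof (rule linear_fps_system_zero[where I = ?I and C = C and \<eta> = \<eta>])
    show "fps_nth (snd i) 0 = 0" if "i \<in> ?I" for i using that H(1) formal_constant_term by auto
    show "\<exists>g. (\<forall>c\<in>C. g c \<in> ?I) \<and> fps_deriv (snd i) = (\<Sum>c\<in>C. \<eta> c * snd (g c))" if "i \<in> ?I" for i
    proof -
      obtain P Q where iPQ: "i = (P, Q)" by (cases i)
      then have i: "i = (P, Q)" "formal LF (flowf C \<eta>) P Q" "\<And>A. A \<in> H \<Longrightarrow> P A = 0"
        using that by auto
      from formal_deriv[OF i(2)] obtain P' Q' where
        P': "\<And>c. c \<in> C \<Longrightarrow> formal LF (flowf C \<eta>) (P' c) (Q' c)" "fps_deriv Q = (\<Sum>c\<in>C. \<eta> c * Q' c)"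
        "\<And>c X. \<exists>q. (\<forall>t. poly q t = P (\<lambda>v. X v + sc t (br c (X v)))) \<and> coeff q 0 = P X \<and> coeff q 1 = P' c X"
        by blast
      have "P' c X = 0" if c: "c \<in> C" and X: "X \<in> H" for c X
      proof -
        \<comment> \<open>Right translation by \<open>X\<close> carries the tangent condition from
          the identity to \<open>X\<close>.\<close>
        have PX: "(\<lambda>Y. P (Y \<circ> X)) \<in> polyfuns (matrix_coeffs sc)"
          by (rule polyfun_translate[OF formal_polyfun[OF i(2)]])
        have van: "\<forall>Y\<in>H. P (Y \<circ> X) = 0" using i(3) H(2) X by blast
        have "\<forall>P\<in>polyfuns (matrix_coeffs sc). (\<forall>A\<in>H. P A = 0) \<longrightarrow>
            (\<exists>q. (\<forall>t. poly q t = P (\<lambda>v. v + sc t (br c v))) \<and> coeff q 1 = 0)"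
          using lie[OF c] by (simp add: lie_of_group_def)
        from mp[OF bspec[OF this PX] van]
        obtain q where q: "\<And>t. poly q t = P ((\<lambda>v. v + sc t (br c v)) \<circ> X)" "coeff q 1 = 0"
          by blast
        obtain q' where q': "\<And>t. poly q' t = P (\<lambda>v. X v + sc t (br c (X v)))" "coeff q' 1 = P' c X"
          using P'(3)[of X c] by blast
        have "poly q = poly q'" using q(1) q'(1) by (simp add: fun_eq_iff comp_def)
        then have "q = q'" by (simp only: poly_eq_poly_eq_iff)
        then show ?thesis using q(2) q'(2) by simp
      qed
      then show ?thesis using P' i(1) by (intro exI[of _ "\<lambda>c. (P' c, Q' c)"]) auto
    qed
  qed (use f van in auto)
  then show ?thesis by simp
qed

text \<open>Sought are \<open>\<eta>\<close> and \<open>lam\<close> with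
  \<open>sum \<eta> c [c, s + t w] + lam (s + t w) = w\<close>. Then \<open>A(t) s\<close> and
  \<open>d (s + t w)\<close>, where \<open>d' = - lam d\<close>, solve the same linear system with
  the same initial value.\<close>

lemma flow_along_line:
  assumes V: "subspace V" "\<And>c v. c \<in> C \<Longrightarrow> v \<in> V \<Longrightarrow> br c v \<in> V" and C: "finite C"
    and tangent: "\<And>u. u \<in> V \<Longrightarrow> \<exists>y\<in>span C. \<exists>l. u = br y s + sc l s"
    and s: "s \<in> V" and w: "w \<in> V"
  shows "\<exists>\<eta> d. fps_nth d 0 = 1 \<and> (\<forall>\<phi>\<in>LF. flowf C \<eta> \<phi> s = d * (fps_const (\<phi> s) + fps_X * fps_const (\<phi> w)))"
proof -
  have "\<exists>z l. u = (\<Sum>c\<in>C. sc (z c) (br c s)) + sc l s" if u: "u \<in> V" for u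
  proof -
    obtain y l where y: "y \<in> span C" "u = br y s + sc l s" using tangent[OF u] by blast
    then obtain z where "y = (\<Sum>c\<in>C. sc (z c) c)" using span_finite[OF C] by auto
    then show ?thesis using y(2) by (auto simp: br_sum_left br_lin)
  qed
  then obtain z l where zl: "\<And>u. u \<in> V \<Longrightarrow> u = (\<Sum>c\<in>C. sc (z u c) (br c s)) + sc (l u) s" by metis
  \<comment> \<open>Comparing powers of \<open>t\<close>: order 0 expands \<open>w\<close> at
    \<open>s\<close>, and the action on \<open>w\<close> of the coefficients of order
    \<open>n\<close> must be cancelled by those of order \<open>n + 1\<close> acting on
    \<open>s\<close>. So \<open>u n\<close> is the vector to be expanded at order
    \<open>n\<close>.\<close>
  define step where "step u = - ((\<Sum>c\<in>C. sc (z u c) (br c w)) + sc (l u) w)" for u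
  define u where "u = rec_nat w (\<lambda>_. step)"
  have u: "u 0 = w" "u (Suc n) = step (u n)" for n by (simp_all add: u_def)
  have uV: "u n \<in> V" for n
  proof (induction n)
    case (Suc n)
    show ?case unfolding u step_def
      using V w by (intro subspace_neg subspace_add subspace_sum subspace_scale) auto
  qed (simp add: u w)
  define \<eta> where "\<eta> c = Abs_fps (\<lambda>n. z (u n) c)" for c
  define lam where "lam = Abs_fps (\<lambda>n. l (u n))"
  define S where "S \<phi> = fps_const (\<phi> s) + fps_X * fps_const (\<phi> w)" for \<phi> :: "'g \<Rightarrow> 'k"
  have S_nth: "fps_nth (g * S \<phi>) n = fps_nth g n * \<phi> s + (if n = 0 then 0 else fps_nth g (n - 1) * \<phi> w)"
    for g :: "'k fps" and \<phi> n
    unfolding S_def distrib_left mult.left_commute[of g fps_X]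
    by (simp add: fps_mult_right_const_nth)
  have eq: "(\<Sum>c\<in>C. \<eta> c * S (\<lambda>v. \<phi> (br c v))) + lam * S \<phi> = fps_const (\<phi> w)" if \<phi>: "\<phi> \<in> LF" for \<phi>
  proof (rule fps_ext)
    fix n
    have e: "\<phi> (u m) = (\<Sum>c\<in>C. z (u m) c * \<phi> (br c s)) + l (u m) * \<phi> s" for m
      by (subst zl[OF uV]) (simp add: LF_lin[OF \<phi>])
    have k: "(\<Sum>c\<in>C. z (u m) c * \<phi> (br c w)) + l (u m) * \<phi> w = - \<phi> (u (Suc m))" for m
    proof -
      have "\<phi> (u (Suc m)) + ((\<Sum>c\<in>C. z (u m) c * \<phi> (br c w)) + l (u m) * \<phi> w) =
          \<phi> (u (Suc m) + ((\<Sum>c\<in>C. sc (z (u m) c) (br c w)) + sc (l (u m)) w))"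
        by (simp add: LF_lin[OF \<phi>])
      also have "\<dots> = 0" unfolding u step_def by (simp add: LF_lin[OF \<phi>])
      finally show ?thesis by (simp add: eq_neg_iff_add_eq_0 add.commute)
    qed
    have nth: "fps_nth ((\<Sum>c\<in>C. \<eta> c * S (\<lambda>v. \<phi> (br c v))) + lam * S \<phi>) n =
        (\<Sum>c\<in>C. z (u n) c * \<phi> (br c s) + (if n = 0 then 0 else z (u (n - 1)) c * \<phi> (br c w))) +
        (l (u n) * \<phi> s + (if n = 0 then 0 else l (u (n - 1)) * \<phi> w))"
      by (simp only: fps_add_nth fps_sum_nth S_nth) (simp add: \<eta>_def lam_def)
    show "fps_nth ((\<Sum>c\<in>C. \<eta> c * S (\<lambda>v. \<phi> (br c v))) + lam * S \<phi>) n =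
        fps_nth (fps_const (\<phi> w)) n"
    proof (cases n)
      case 0
      then show ?thesis unfolding nth using e[of 0] u(1) by simp
    next
      case (Suc m)
      have "fps_nth ((\<Sum>c\<in>C. \<eta> c * S (\<lambda>v. \<phi> (br c v))) + lam * S \<phi>) n =
          ((\<Sum>c\<in>C. z (u m) c * \<phi> (br c w)) + l (u m) * \<phi> w) +
          ((\<Sum>c\<in>C. z (u (Suc m)) c * \<phi> (br c s)) + l (u (Suc m)) * \<phi> s)"
        unfolding nth by (simp add: Suc sum.distrib add_ac)
      also have "\<dots> = 0" unfolding k e[symmetric] by simp
      finally show ?thesis by (simp add: Suc)
    qed
  qed
  define d where "d = Abs_fps (exp_coeff (- lam))"
  have d: "fps_deriv d = - lam * d" "fps_nth d 0 = 1" unfolding d_def exp_coeff_deriv by simp_all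
  have "flowf C \<eta> \<phi> s - d * S \<phi> = 0" if "\<phi> \<in> LF" for \<phi>
  proof (rule linear_fps_system_zero[where I = LF and C = C and \<eta> = \<eta>, OF _ _ that])
    fix \<phi> assume \<phi>: "\<phi> \<in> LF"
    show "fps_nth (flowf C \<eta> \<phi> s - d * S \<phi>) 0 = 0" by (simp only: fps_sub_nth S_nth d(2)) (simp add: flowf_def)
    have "fps_deriv (S \<phi>) = fps_const (\<phi> w)" by (simp add: S_def)
    then have "fps_deriv (d * S \<phi>) = - lam * d * S \<phi> + d * ((\<Sum>c\<in>C. \<eta> c * S (\<lambda>v. \<phi> (br c v))) + lam * S \<phi>)"
      unfolding eq[OF \<phi>] by (simp add: d(1) algebra_simps)
    also have "\<dots> = (\<Sum>c\<in>C. \<eta> c * (d * S (\<lambda>v. \<phi> (br c v))))"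
      by (simp add: algebra_simps sum_distrib_left)
    finally have "fps_deriv (flowf C \<eta> \<phi> s - d * S \<phi>) =
        (\<Sum>c\<in>C. \<eta> c * (flowf C \<eta> (\<lambda>v. \<phi> (br c v)) s - d * S (\<lambda>v. \<phi> (br c v))))"
      by (simp add: flowf_deriv[OF \<phi>] algebra_simps sum_subtractf)
    then show "\<exists>g. (\<forall>c\<in>C. g c \<in> LF) \<and> fps_deriv (flowf C \<eta> \<phi> s - d * S \<phi>) =
        (\<Sum>c\<in>C. \<eta> c * (flowf C \<eta> (g c) s - d * S (g c)))"
      using LF_br[OF \<phi>] by (intro exI[of _ "\<lambda>c v. \<phi> (br c v)"]) blast
  qed
  then show ?thesis using d(2) unfolding S_def by (metis eq_iff_diff_eq_0)
qed

end

section \<open>Orbits of algebraic groups\<close>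

locale closed_group = fd_simple_lie_algebra sc br
  for sc :: "'k::{alg_closed_field, field_char_0} \<Rightarrow> 'g::ab_group_add \<Rightarrow> 'g" and br +
  fixes H :: "('g \<Rightarrow> 'g) set"
  assumes H_closed: "\<exists>S\<subseteq>polyfuns (matrix_coeffs sc). H = {A\<in>lie_automorphisms sc br. \<forall>p\<in>S. p A = 0}"
    and H_id: "id \<in> H" and H_comp: "A \<in> H \<Longrightarrow> B \<in> H \<Longrightarrow> A \<circ> B \<in> H"
begin

lemma endomorphism_polyfun:
  assumes \<phi>: "\<phi> \<in> LF"
  shows "(\<lambda>A. \<phi> (A (br a b)) - \<phi> (br (A a) (A b))) \<in> polyfuns (matrix_coeffs sc)"
proof -
  have mc: "(\<lambda>A. \<psi> (A v)) \<in> polyfuns (matrix_coeffs sc)" if "\<psi> \<in> LF" for \<psi> v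
    using that by (intro polyfuns.coord) (auto simp: matrix_coeffs_def)
  let ?r = "representation Bas"
  have br: "\<phi> (br u v) = (\<Sum>c\<in>Bas. \<Sum>d\<in>Bas. \<phi> (br c d) * (?r u c * ?r v d))" for u v
  proof -
    have 1: "br u v = (\<Sum>c\<in>Bas. sc (?r u c) (br c v))" by (rule linear_expand[OF linear_br_left])
    have 2: "br c v = (\<Sum>d\<in>Bas. sc (?r v d) (br c d))" for c by (rule linear_expand[OF linear_ad])
    show ?thesis by (subst 1, subst 2) (simp add: LF_lin[OF \<phi>] sum_distrib_left mult_ac)
  qed
  have eq: "(\<lambda>A. \<phi> (A (br a b)) - \<phi> (br (A a) (A b))) =
      (\<lambda>A. \<phi> (A (br a b)) + (- 1) * (\<Sum>c\<in>Bas. \<Sum>d\<in>Bas. \<phi> (br c d) * (?r (A a) c * ?r (A b) d)))"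
    by (rule ext, subst br) simp
  have 1: "(\<lambda>A. \<phi> (br c d) * (?r (A a) c * ?r (A b) d)) \<in> polyfuns (matrix_coeffs sc)" for c d
    by (rule polyfuns.mult[OF polyfuns.const polyfuns.mult[OF mc[OF LF_rep] mc[OF LF_rep]]])
  have 2: "(\<lambda>A. \<Sum>c\<in>Bas. \<Sum>d\<in>Bas. \<phi> (br c d) * (?r (A a) c * ?r (A b) d)) \<in> polyfuns (matrix_coeffs sc)"
    by (intro polyfuns_sum 1)
  show ?thesis unfolding eq by (rule polyfuns.add[OF mc[OF \<phi>] polyfuns.mult[OF polyfuns.const 2]])
qed

text \<open>Compatibility with the bracket is polynomial and so passes from \<open>H\<close> to
  \<open>A\<close>. Invertibility is not: the kernel is an ideal missing \<open>s\<close>, hence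
  zero, and finite dimension gives bijectivity.\<close>

lemma vanishing_ideal_membership:
  assumes lin: "\<And>u v. A (u + v) = A u + A v" "\<And>r v. A (sc r v) = sc r (A v)"
    and van: "\<And>P. P \<in> polyfuns (matrix_coeffs sc) \<Longrightarrow> (\<forall>X\<in>H. P X = 0) \<Longrightarrow> P A = 0"
    and s: "A s \<noteq> 0"
  shows "A \<in> H"
proof -
  obtain S where S: "S \<subseteq> polyfuns (matrix_coeffs sc)" "H = {A\<in>lie_automorphisms sc br. \<forall>p\<in>S. p A = 0}"
    using H_closed by blast
  have linA: "Vector_Spaces.linear sc sc A"
    using lin by (simp add: Vector_Spaces.linear_iff vector_space_axioms)
  then interpret A: Vector_Spaces.linear sc sc A .
  have hom: "A (br a b) = br (A a) (A b)" for a b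
  proof (rule LF_separating)
    fix \<phi> assume \<phi>: "\<phi> \<in> LF"
    have "\<forall>X\<in>H. \<phi> (X (br a b)) - \<phi> (br (X a) (X b)) = 0"
      unfolding S(2) lie_automorphisms_def by auto
    then show "\<phi> (A (br a b)) = \<phi> (br (A a) (A b))"
      using van[OF endomorphism_polyfun[OF \<phi>]] by simp
  qed
  have "lie_ideal sc br {v. A v = 0}"
    unfolding lie_ideal_def using A.subspace_kernel by (auto simp: hom)
  from simple[OF this] s have "{v. A v = 0} = {0}" by auto
  then have "inj A" unfolding A.inj_iff_eq_0 by blast
  then have "bij A" using linear_inj_imp_surj[OF linA] by (simp add: bij_def)
  then have "A \<in> lie_automorphisms sc br"
    using linA hom by (simp add: lie_automorphisms_def endos_def)
  moreover have "p A = 0" if "p \<in> S" for p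
    using that S by (intro van) auto
  ultimately show ?thesis using S(2) by blast
qed

text \<open>The endomorphism \<open>A\<close> is the formal flow with its matrix entries specialized
  by \<open>h\<close>, which sends \<open>fps_X\<close> to \<open>t\<close>. Identities between
  power series pass to \<open>A\<close>: those saying that it satisfies the equations of
  \<open>H\<close>, and the one placing \<open>A s\<close> on the ray of
  \<open>s + t w\<close>.\<close>

lemma line_in_orbit:
  assumes V: "subspace V" "\<And>c v. c \<in> L \<Longrightarrow> v \<in> V \<Longrightarrow> br c v \<in> V"
    and L: "subspace L" "\<And>c. c \<in> L \<Longrightarrow> br c \<in> lie_of_group sc H"
    and tangent: "\<And>u. u \<in> V \<Longrightarrow> \<exists>y\<in>L. \<exists>l. u = br y s + sc l s"
    and s: "s \<in> V" and w: "w \<in> V"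
  shows "\<exists>F. finite F \<and> (\<forall>t. t \<notin> F \<longrightarrow> s + sc t w \<noteq> 0 \<longrightarrow>
    (\<exists>A\<in>H. \<exists>c. c \<noteq> 0 \<and> A s = sc c (s + sc t w)))"
proof -
  obtain C where C: "C \<subseteq> L" "independent C" "L \<subseteq> span C" using maximal_independent_subset[of L] by blast
  have finC: "finite C" using C(2) finiteI_independent by blast
  have "\<exists>y\<in>span C. \<exists>l. u = br y s + sc l s" if "u \<in> V" for u
    using tangent[OF that] C(3) by blast
  from flow_along_line[OF V(1) _ finC this s w] V(2) C(1) obtain \<eta> d where
    d: "fps_nth d 0 = 1" and
    fl: "\<And>\<phi>. \<phi> \<in> LF \<Longrightarrow> flowf C \<eta> \<phi> s = d * (fps_const (\<phi> s) + fps_X * fps_const (\<phi> w))"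
    by blast
  let ?rep = "\<lambda>b v. representation Bas v b"
  let ?e = "\<lambda>b c. flowf C \<eta> (?rep b) c"
  \<comment> \<open>The inverse of \<open>d\<close> is adjoined as well, so that the specialized
    scalar \<open>h d\<close> is a unit.\<close>
  have "finite ((\<lambda>(b, c). ?e b c) ` (Bas \<times> Bas) \<union> {d, inverse d})" using finite_Basis by auto
  from finite_list[OF this]
  obtain as where as: "set as = (\<lambda>(b, c). ?e b c) ` (Bas \<times> Bas) \<union> {d, inverse d}" ..
  obtain B F where B: "subring_set B" "set as \<subseteq> B" "range fps_of_poly \<subseteq> B" and F: "finite F"
    and h: "\<And>t. t \<notin> F \<Longrightarrow> \<exists>h :: 'k fps \<Rightarrow> 'k. hom_on B h \<and> (\<forall>p. h (fps_of_poly p) = poly p t)"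
    using fps_specialization[of as] by blast
  have "\<exists>A\<in>H. \<exists>c. c \<noteq> 0 \<and> A s = sc c (s + sc t w)" if t: "t \<notin> F" and nz: "s + sc t w \<noteq> 0" for t
  proof -
    obtain h :: "'k fps \<Rightarrow> 'k" where h: "hom_on B h" and hp: "\<And>p. h (fps_of_poly p) = poly p t"
      using h[OF t] by blast
    note hs = hom_simps[OF B(1) h] and Bc = subring_closed[OF B(1)]
    have cB: "fps_const a \<in> B" "h (fps_const a) = a" for a
      using subsetD[OF B(3) rangeI[of fps_of_poly "[:a:]"]] hp[of "[:a:]"]
      unfolding fps_of_poly_const by simp_all
    have X: "fps_of_poly [:0, 1:] = (fps_X :: 'k fps)" by (simp add: fps_of_poly_pCons)
    have XB: "fps_X \<in> B" "h fps_X = t"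
      using subsetD[OF B(3) rangeI[of fps_of_poly "[:0, 1:]"]] hp[of "[:0, 1:]"] unfolding X by simp_all
    have eB: "?e b c \<in> B" if "b \<in> Bas" "c \<in> Bas" for b c using that B(2) as by auto
    have dB: "d \<in> B" "inverse d \<in> B" using B(2) as by auto
    have "d * inverse d = 1" using d by (simp add: inverse_mult_eq_1')
    then have "h d * h (inverse d) = 1" using hs(3)[OF dB] hs(1) by simp
    then have hd: "h d \<noteq> 0" by auto
    define A where "A v = (\<Sum>b\<in>Bas. sc (\<Sum>c\<in>Bas. ?rep c v * h (?e b c)) b)" for v
    have ex: "flowf C \<eta> \<phi> v = (\<Sum>b\<in>Bas. \<Sum>c\<in>Bas. fps_const (\<phi> b * ?rep c v) * ?e b c)"
      if \<phi>: "\<phi> \<in> LF" for \<phi> v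
    proof (rule fps_ext)
      fix n
      have lin: "Vector_Spaces.linear sc sc (flow C \<eta> n)"
        by (simp add: Vector_Spaces.linear_iff vector_space_axioms flow_linear)
      have "\<phi> (flow C \<eta> n v) = \<phi> (\<Sum>b\<in>Bas. sc (?rep b (flow C \<eta> n v)) b)"
        by (rule arg_cong[OF expand])
      also have "\<dots> = (\<Sum>b\<in>Bas. ?rep b (flow C \<eta> n v) * \<phi> b)" by (simp add: LF_lin[OF \<phi>])
      also have "\<dots> = (\<Sum>b\<in>Bas. \<Sum>c\<in>Bas. \<phi> b * ?rep c v * ?rep b (flow C \<eta> n c))"
        by (subst linear_expand[OF lin]) (simp add: rep_sum rep_scale sum_distrib_left sum_distrib_right mult_ac)
      finally show "fps_nth (flowf C \<eta> \<phi> v) n =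
          fps_nth (\<Sum>b\<in>Bas. \<Sum>c\<in>Bas. fps_const (\<phi> b * ?rep c v) * ?e b c) n"
        by (simp add: flowf_def fps_sum_nth)
    qed
    have fB: "flowf C \<eta> \<phi> v \<in> B" and hf: "h (flowf C \<eta> \<phi> v) = \<phi> (A v)" if \<phi>: "\<phi> \<in> LF" for \<phi> v
    proof -
      have in1: "fps_const (\<phi> b * ?rep c v) * ?e b c \<in> B" if "b \<in> Bas" "c \<in> Bas" for b c
        by (intro Bc cB eB that)
      have in2: "(\<Sum>c\<in>Bas. fps_const (\<phi> b * ?rep c v) * ?e b c) \<in> B" if "b \<in> Bas" for b
        by (intro subring_sum[OF B(1)] in1 that)
      show "flowf C \<eta> \<phi> v \<in> B" unfolding ex[OF \<phi>] by (intro subring_sum[OF B(1)] in2)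
      have "h (flowf C \<eta> \<phi> v) = (\<Sum>b\<in>Bas. \<Sum>c\<in>Bas. h (fps_const (\<phi> b * ?rep c v) * ?e b c))"
        unfolding ex[OF \<phi>]
        by (subst hom_sum[OF B(1) h in2], assumption) (intro sum.cong refl hom_sum[OF B(1) h] in1)
      also have "\<dots> = (\<Sum>b\<in>Bas. \<Sum>c\<in>Bas. \<phi> b * ?rep c v * h (?e b c))"
        by (intro sum.cong refl) (simp add: hs(3)[OF cB(1) eB] cB(2))
      also have "\<dots> = \<phi> (A v)"
        unfolding A_def by (simp add: LF_lin[OF \<phi>] sum_distrib_left sum_distrib_right mult_ac)
      finally show "h (flowf C \<eta> \<phi> v) = \<phi> (A v)" .
    qed
    \<comment> \<open>A homomorphism commutes with evaluating a polynomial function at the formal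
      curve.\<close>
    have hQ: "Q \<in> B \<and> h Q = P A" if "formal LF (flowf C \<eta>) P Q" for P Q
      using that by (induction rule: formal.induct) (simp_all add: fB hf cB Bc hs)
    have lin: "A (u + v) = A u + A v" "A (sc r v) = sc r (A v)" for u v r
      unfolding A_def
      by (simp_all add: rep_add rep_scale distrib_right sum.distrib scale_left_distrib scale_sum_right
          sum_distrib_left mult.assoc)
    have "\<phi> (A s) = \<phi> (sc (h d) (s + sc t w))" if \<phi>: "\<phi> \<in> LF" for \<phi>
    proof -
      have "h (flowf C \<eta> \<phi> s) = h d * (\<phi> s + t * \<phi> w)"
        unfolding fl[OF \<phi>] by (simp add: hs Bc cB XB dB)
      then show ?thesis by (simp add: hf[OF \<phi>] LF_lin[OF \<phi>])
    qed
    then have As: "A s = sc (h d) (s + sc t w)" by (rule LF_separating)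
    have van: "P A = 0" if P: "P \<in> polyfuns (matrix_coeffs sc)" "\<forall>X\<in>H. P X = 0" for P
    proof -
      obtain Q where Q: "formal LF (flowf C \<eta>) P Q" using polyfun_formal[OF P(1)] by blast
      have "Q = 0" by (rule formal_vanish[OF H_id H_comp _ Q]) (use L(2) C(1) P(2) in auto)
      then show ?thesis using hQ[OF Q] hom_zero[OF B(1) h] by simp
    qed
    have "A \<in> H"
    proof (rule vanishing_ideal_membership[where A = A and s = s])
      show "P A = 0" if "P \<in> polyfuns (matrix_coeffs sc)" "\<forall>X\<in>H. P X = 0" for P
        by (rule van[OF that])
      show "A s \<noteq> 0" using As hd nz by simp
    qed (rule lin)+
    then show ?thesis using As hd by blast
  qed
  then show ?thesis using F by blast
qed

lemma orbit_transitive: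
  assumes V: "subspace V" "\<And>c v. c \<in> L \<Longrightarrow> v \<in> V \<Longrightarrow> br c v \<in> V"
    and L: "subspace L" "\<And>c. c \<in> L \<Longrightarrow> br c \<in> lie_of_group sc H"
    and inv: "\<And>A. A \<in> H \<Longrightarrow> inv_into UNIV A \<in> H"
    and s: "s \<in> V" "s \<noteq> 0" "\<And>u. u \<in> V \<Longrightarrow> \<exists>y\<in>L. \<exists>l. u = br y s + sc l s"
    and s': "s' \<in> V" "\<And>u. u \<in> V \<Longrightarrow> \<exists>y\<in>L. \<exists>l. u = br y s' + sc l s'"
  shows "\<exists>A\<in>H. \<exists>c. c \<noteq> 0 \<and> s' = sc c (A s)"
proof -
  define w where "w = s' - s"
  have w: "w \<in> V" "- w \<in> V" unfolding w_def using V(1) s s' by (auto intro: subspace_diff)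
  obtain F1 where F1: "finite F1" "\<And>t. t \<notin> F1 \<Longrightarrow> s + sc t w \<noteq> 0 \<Longrightarrow>
      \<exists>A\<in>H. \<exists>c. c \<noteq> 0 \<and> A s = sc c (s + sc t w)"
    using line_in_orbit[OF V L s(3) s(1) w(1)] by blast
  obtain F2 where F2: "finite F2" "\<And>t. t \<notin> F2 \<Longrightarrow> s' + sc t (- w) \<noteq> 0 \<Longrightarrow>
      \<exists>A\<in>H. \<exists>c. c \<noteq> 0 \<and> A s' = sc c (s' + sc t (- w))"
    using line_in_orbit[OF V L s'(2) s'(1) w(2)] by blast
  have "finite {t. s + sc t w = 0}"
  proof (rule finite_subset)
    show "{t. s + sc t w = 0} \<subseteq> {SOME t. s + sc t w = 0}"
    proof
      fix t assume "t \<in> {t. s + sc t w = 0}"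
      then have t: "s + sc t w = 0" by simp
      define r where "r = (SOME t. s + sc t w = 0)"
      have r: "s + sc r w = 0" unfolding r_def by (rule someI[of "\<lambda>t. s + sc t w = 0", OF t])
      have "sc t w = sc r w" using t r by (metis add_left_imp_eq)
      moreover have "w \<noteq> 0" using t s(2) by auto
      ultimately have "t = r" by simp
      then show "t \<in> {SOME t. s + sc t w = 0}" by (simp add: r_def)
    qed
  qed simp
  \<comment> \<open>The line through \<open>s\<close> and \<open>s'\<close> has parameter
    \<open>t\<close> from \<open>s\<close> and \<open>1 - t\<close> from \<open>s'\<close>. A common
    parameter must avoid both exceptional sets and the at most one zero of the line.\<close>
  then have fin: "finite (F1 \<union> (\<lambda>t. 1 - t) ` F2 \<union> {t. s + sc t w = 0})" using F1(1) F2(1) by simp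
  obtain t where t: "t \<notin> F1 \<union> (\<lambda>t. 1 - t) ` F2 \<union> {t. s + sc t w = 0}"
    using ex_new_if_finite[OF infinite_UNIV_char_0 fin] by blast
  have t2: "1 - t \<notin> F2"
  proof
    assume "1 - t \<in> F2"
    then have "1 - (1 - t) \<in> (\<lambda>t. 1 - t) ` F2" by (rule imageI)
    then show False using t by simp
  qed
  have "s' = s + w" by (simp add: w_def)
  then have eq: "s' + sc (1 - t) (- w) = s + sc t w" by (simp add: scale_left_diff_distrib)
  obtain A c where A: "A \<in> H" "c \<noteq> 0" "A s = sc c (s + sc t w)" using F1(2)[of t] t by blast
  obtain B d where B: "B \<in> H" "d \<noteq> 0" "B s' = sc d (s + sc t w)"
    using F2(2)[OF t2] t unfolding eq by blast
  let ?B = "inv_into UNIV B"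
  have BA: "B \<in> lie_automorphisms sc br" using B(1) H_closed by blast
  then have bij: "bij B" and linB: "\<And>r v. B (sc r v) = sc r (B v)"
    by (auto simp: lie_automorphisms_def endos_def Vector_Spaces.linear_iff)
  have "B (sc (c / d) s') = A s" using A(3) B(2,3) by (simp add: linB)
  then have "?B (A s) = sc (c / d) s'" using bij by (metis bij_is_inj inv_f_f)
  then have "s' = sc (d / c) ((?B \<circ> A) s)" using A(2) B(2) by simp
  moreover have "?B \<circ> A \<in> H" by (intro H_comp inv A B)
  moreover have "d / c \<noteq> 0" using A(2) B(2) by simp
  ultimately show ?thesis by blast
qed

end

section \<open>Embeddable elements\<close>

context fd_lie_algebra
begin

lemma polyfun_br:
  assumes F: "\<And>\<phi>. \<phi> \<in> LF \<Longrightarrow> (\<lambda>v. \<phi> (F v)) \<in> polyfuns LF" and \<phi>: "\<phi> \<in> LF"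
  shows "(\<lambda>v. \<phi> (br v (F v))) \<in> polyfuns LF"
proof -
  let ?r = "representation Bas"
  have br: "\<phi> (br u v) = (\<Sum>c\<in>Bas. ?r u c * \<phi> (br c v))" for u v
    by (subst linear_expand[OF linear_br_left]) (simp add: LF_lin[OF \<phi>])
  have 1: "(\<lambda>v. ?r v c * \<phi> (br c (F v))) \<in> polyfuns LF" for c
    by (rule polyfuns.mult[OF polyfuns.coord[OF LF_rep] F[OF LF_br[OF \<phi>]]])
  show ?thesis by (subst br) (rule polyfuns_sum[OF 1])
qed

end

lemma (in minimal_triple) embeddable_open:
  "openin (zariski (linear_functionals sc) V) (embeddable sc br x)"
proof -
  let ?q = "\<lambda>s. br s (br s (br s (br s f)))"
  have "(\<lambda>v. \<phi> (?q v)) \<in> polyfuns LF" if "\<phi> \<in> LF" for \<phi>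
    by (rule polyfun_br[OF polyfun_br[OF polyfun_br[OF polyfun_br[OF polyfuns.const]]] that])
  then have "(\<lambda>\<phi> v. \<phi> (?q v)) ` LF \<subseteq> polyfuns LF" by blast
  moreover have "embeddable sc br x = V - {v. \<forall>p\<in>(\<lambda>\<phi> v. \<phi> (?q v)) ` LF. p v = 0}"
  proof -
    have "?q v = 0 \<longleftrightarrow> (\<forall>\<phi>\<in>LF. \<phi> (?q v) = 0)" for v
      using LF_separating[of "?q v" 0] LF_lin(4) by metis
    then show ?thesis using embeddable_iff by auto
  qed
  ultimately show ?thesis unfolding openin_zariski zariski_open_def by blast
qed

lemma (in minimal_triple) embeddable_nonempty:
  assumes "\<forall>n\<ge>1. \<not> type_C sc br n"
  shows "embeddable sc br x \<noteq> {}"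
proof
  assume "embeddable sc br x = {}"
  then interpret flat_triple sc br e x f
    using embeddable_iff by unfold_locales blast
  show False using flat_type_C assms by blast
qed

text \<open>The adjoint group is a connected component, hence closed in the automorphism group; a
  closed subset of it is cut out there by the union of both sets of equations.\<close>

lemma (in fd_simple_lie_algebra) connected_subgroup_closed:
  fixes L H
  assumes "connected_subgroup_of sc br L H"
  shows "\<exists>S\<subseteq>polyfuns (matrix_coeffs sc). H = {A\<in>lie_automorphisms sc br. \<forall>p\<in>S. p A = 0}"
proof -
  let ?mc = "matrix_coeffs sc" and ?Aut = "lie_automorphisms sc br" and ?G = "adjoint_group sc br"
  have closed: "\<exists>S\<subseteq>polyfuns ?mc. C = X \<inter> {A. \<forall>p\<in>S. p A = 0}" if "closedin (zariski ?mc X) C" for X C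
  proof -
    have C: "C \<subseteq> X" "zariski_open ?mc X (X - C)"
      using that by (auto simp: closedin_def topspace_zariski openin_zariski)
    then obtain S where "S \<subseteq> polyfuns ?mc" "X - C = X - {v. \<forall>p\<in>S. p v = 0}"
      unfolding zariski_open_def by blast
    then have "C = X \<inter> {A. \<forall>p\<in>S. p A = 0}" using C(1) by blast
    then show ?thesis using \<open>S \<subseteq> polyfuns ?mc\<close> by blast
  qed
  have "closedin (zariski ?mc ?Aut) ?G"
    unfolding adjoint_group_def by (rule closedin_connected_component_of)
  from closed[OF this] obtain S1 where
    S1: "S1 \<subseteq> polyfuns ?mc" "?G = ?Aut \<inter> {A. \<forall>p\<in>S1. p A = 0}" by blast
  have "closedin (zariski ?mc ?G) H"
    using assms by (simp add: connected_subgroup_of_def algebraic_subgroup_def)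
  from closed[OF this] obtain S2 where
    S2: "S2 \<subseteq> polyfuns ?mc" "H = ?G \<inter> {A. \<forall>p\<in>S2. p A = 0}" by blast
  have "H = {A\<in>?Aut. \<forall>p\<in>S1 \<union> S2. p A = 0}"
    by (rule Set.set_eqI) (simp add: S2(2) S1(2) ball_Un)
  then show ?thesis using S1(1) S2(1) by (intro exI[of _ "S1 \<union> S2"] conjI) simp_all
qed

theorem proposition9p4:
  fixes sc :: "'k::{alg_closed_field, field_char_0} \<Rightarrow> 'g::ab_group_add \<Rightarrow> 'g"
    and br :: "'g \<Rightarrow> 'g \<Rightarrow> 'g"
    and e x f :: 'g
  assumes "simple_lie_algebra sc br"
    and "\<exists>B. finite_dimensional_vector_space sc B"
    and "\<forall>n\<ge>1. \<not> type_C sc br n"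
    and "minimal_nilpotent sc br f"
    and "sl2_triple sc br e x f"
  shows "embeddable sc br x \<noteq> {} \<and>
    openin (zariski (linear_functionals sc) (grade sc br x (1/2))) (embeddable sc br x) \<and>
    (\<forall>G0f. connected_subgroup_of sc br (grade0_centralizer sc br x f) G0f \<longrightarrow>
      (\<forall>s\<in>embeddable sc br x. \<forall>s'\<in>embeddable sc br x.
        \<exists>A\<in>G0f. \<exists>c. c \<noteq> 0 \<and> s' = sc c (A s)))"
proof -
  interpret simple_lie_algebra sc br by (rule assms(1))
  interpret fd_simple_lie_algebra sc br by unfold_locales (rule assms(2))
  interpret minimal_triple sc br e x f
    using minimal_nilpotent_properties[OF assms(4,5)] by unfold_locales (auto intro: assms(5))
  show ?thesis
  proof (intro conjI allI impI ballI)
    show "embeddable sc br x \<noteq> {}" by (rule embeddable_nonempty[OF assms(3)])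
    show "openin (zariski (linear_functionals sc) V) (embeddable sc br x)" by (rule embeddable_open)
    fix H s s'
    assume H: "connected_subgroup_of sc br L H" and s: "s \<in> embeddable sc br x"
      and s': "s' \<in> embeddable sc br x"
    interpret closed_group sc br H
      using H connected_subgroup_closed[OF H] fd_lie_algebra_axioms
      by unfold_locales (auto simp: connected_subgroup_of_def algebraic_subgroup_def)
    show "\<exists>A\<in>H. \<exists>c. c \<noteq> 0 \<and> s' = sc c (A s)"
    proof (rule orbit_transitive[OF subspace_G _ subspace_L])
      show "br c v \<in> V" if "c \<in> L" "v \<in> V" for c v by (rule L_V[OF that])
      show "br c \<in> lie_of_group sc H" if "c \<in> L" for c
        using H that by (auto simp: connected_subgroup_of_def)
      show "inv_into UNIV A \<in> H" if "A \<in> H" for A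
        using H that by (auto simp: connected_subgroup_of_def algebraic_subgroup_def)
      show "s \<in> V" "s' \<in> V" "s \<noteq> 0" using s s' by (auto simp: embeddable_iff)
    qed (use embeddable_tangent s s' in blast)+
  qed
qed

end
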